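(* Let $p\ge 2$ and let $V_0,\dots,V_p$ be complex vector spaces with $\dim V_i=k_i+1$, where $k_0=\sum_{i=1}^p k_i$. Let $A\in \mathbf{P}(V_0\otimes\cdots\otimes V_p)$ (a matrix of boundary format) be such that $\mathrm{Det}\,A\neq 0$. Then $A$ is triangulable if and only if $A$ is not stable for the action of $SL(V_0)\times\cdots\times SL(V_p)$.
   Context: A $(p+1)$-dimensional matrix of boundary format is an element $A\in V_0\otimes\cdots\otimes V_p$ with $\dim V_i=k_i+1$ and $k_0=\sum_{i=1}^pk_i$. The same letter denotes a nonzero tensor and its class in the projective space $\mathbf{P}(V_0\otimes\cdots\otimes V_p)$. Given bases $e^{(j)}_0,\dots,e^{(j)}_{k_j}$ of $V_j$, write $A=\sum a_{i_0,\dots,i_p}e^{(0)}_{i_0}\otimes\cdots\otimes e^{(p)}_{i_p}$ (indices $0\le i_j\le k_j$). $\mathrm{Det}$ denotes the hyperdeterminant of Gelfand–Kapranov–Zelevinsky, i.e. the equation of the dual variety (a hypersurface for this format) of the Segre variety $\mathbf{P}(V_0)\times\cdots\times\mathbf{P}(V_p)$. For boundary format, $\mathrm{Det}\,A\ne0$ if and only if there are no nonzero $v_i\in V_i^*$ ($1\le i\le p$) such that the contraction $A(v_1\otimes\cdots\otimes v_p)\in V_0$ vanishes. $A$ is called triangulable if there exist bases in the $V_j$ such that $a_{i_0,\dots,i_p}=0$ whenever $i_0>\sum_{t=1}^p i_t$. The group $SL(V_0)\times\cdots\times SL(V_p)$ acts naturally on $\mathbf{P}(V_0\otimes\cdots\otimes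 V_p)$, and stability is in the sense of Mumford's Geometric Invariant Theory for this linear action.
   Formalization: The formal theorem assumes k_0 > 0; when k_0 = 0 all V_i are one-dimensional and the group is trivial, so the only point is both triangulable and stable and the claim fails. Stable means closed orbit in the vector space and finite stabilizer. *)

theory Defs
  imports
    "HOL-Library.Poly_Mapping"
    "HOL-Computational_Algebra.Factorial_Ring"
    "Jordan_Normal_Form.Determinant"
begin

text \<open>
  A format is a list \<open>k = [k\<^sub>0, \<dots>, k\<^sub>p]\<close>; the space \<open>V\<^sub>j\<close> is \<open>\<complex>\<close> to the power \<open>k\<^sub>j + 1\<close>, and its
  dual is identified with it by the standard pairing.  A multi-index is a list
  \<open>i = [i\<^sub>0, \<dots>, i\<^sub>p]\<close> with \<open>i\<^sub>j \<le> k\<^sub>j\<close>.  An element of \<open>V\<^sub>0 \<otimes> \<dots> \<otimes> V\<^sub>p\<close> is its array of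
  standard coordinates, extended by 0 outside the multi-indices; a point of the projective
  space is represented by a nonzero array.
\<close>

type_synonym tensor = "nat list \<Rightarrow> complex"

definition indices :: "nat list \<Rightarrow> nat list set" where
  "indices k = {i. length i = length k \<and> (\<forall>j<length k. i ! j \<le> k ! j)}"

definition tensors :: "nat list \<Rightarrow> tensor set" where
  "tensors k = {A. \<forall>i. i \<notin> indices k \<longrightarrow> A i = 0}"

definition boundary_format :: "nat list \<Rightarrow> bool" where
  "boundary_format k \<longleftrightarrow> k \<noteq> [] \<and> k ! 0 = (\<Sum>j=1..<length k. k ! j)"

definition vectors :: "nat list \<Rightarrow> complex vec list set" where
  "vectors k = {v. length v = length k \<and> (\<forall>j<length k. v ! j \<in> carrier_vec (k ! j + 1))}"

definition pure_tensor :: "nat list \<Rightarrow> complex vec list \<Rightarrow> tensor" where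
  "pure_tensor k v = (\<lambda>i. if i \<in> indices k then \<Prod>j<length k. vec_index (v ! j) (i ! j) else 0)"

definition pairing :: "nat list \<Rightarrow> tensor \<Rightarrow> tensor \<Rightarrow> complex" where
  "pairing k A T = (\<Sum>i\<in>indices k. A i * T i)"


section \<open>Polynomial functions on the tensor space\<close>

text \<open>
  A polynomial in the tensor entries is a finitely supported map from monomials to
  coefficients, where a monomial is a finitely supported exponent function on multi-indices.
\<close>

type_synonym tensor_poly = "(nat list \<Rightarrow>\<^sub>0 nat) \<Rightarrow>\<^sub>0 complex"

definition polys :: "nat list \<Rightarrow> tensor_poly set" where
  "polys k = {Q. \<forall>m\<in>Poly_Mapping.keys Q. Poly_Mapping.keys m \<subseteq> indices k}"

definition poly_eval :: "tensor_poly \<Rightarrow> tensor \<Rightarrow> complex" where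
  "poly_eval Q A =
     (\<Sum>m\<in>Poly_Mapping.keys Q. Poly_Mapping.lookup Q m *
        (\<Prod>i\<in>Poly_Mapping.keys m. A i ^ Poly_Mapping.lookup m i))"

definition zariski_closure :: "nat list \<Rightarrow> tensor set \<Rightarrow> tensor set" where
  "zariski_closure k S =
     {A \<in> tensors k. \<forall>Q\<in>polys k. (\<forall>B\<in>S. poly_eval Q B = 0) \<longrightarrow> poly_eval Q A = 0}"

definition zariski_closed :: "nat list \<Rightarrow> tensor set \<Rightarrow> bool" where
  "zariski_closed k S \<longleftrightarrow> zariski_closure k S = S"


section \<open>The hyperdeterminant\<close>

text \<open>
  At the point of the Segre variety given by nonzero vectors \<open>x\<^sub>0, \<dots>, x\<^sub>p\<close>, the tangent space of
  the affine cone is spanned by the tensors obtained from \<open>x\<^sub>0 \<otimes> \<dots> \<otimes> x\<^sub>p\<close> by replacing one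
  factor by an arbitrary vector (the partial derivatives of the Segre parametrisation).  The
  array \<open>A\<close> stands for the hyperplane of all \<open>T\<close> with \<open>pairing k A T = 0\<close>.  The sets below are
  affine cones, so they contain the zero array.
\<close>

definition tangent_hyperplanes :: "nat list \<Rightarrow> tensor set" where
  "tangent_hyperplanes k =
     {A \<in> tensors k. \<exists>x\<in>vectors k.
        (\<forall>j<length k. x ! j \<noteq> 0\<^sub>v (k ! j + 1)) \<and>
        (\<forall>j<length k. \<forall>y\<in>carrier_vec (k ! j + 1). pairing k A (pure_tensor k (x[j := y])) = 0)}"

definition dual_variety :: "nat list \<Rightarrow> tensor set" where
  "dual_variety k = zariski_closure k (tangent_hyperplanes k)"

text \<open>
  The equation of the dual variety is determined only up to a nonzero scalar, so being a
  hyperdeterminant is a predicate on polynomials.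
\<close>

definition is_hyperdeterminant :: "nat list \<Rightarrow> tensor_poly \<Rightarrow> bool" where
  "is_hyperdeterminant k D \<longleftrightarrow>
     D \<in> polys k \<and> irreducible D \<and> {A \<in> tensors k. poly_eval D A = 0} = dual_variety k"


section \<open>Triangulability\<close>

text \<open>
  A basis of each \<open>V\<^sub>j\<close> is given by the columns of an invertible matrix \<open>e ! j\<close>, and \<open>a\<close> is the
  array of coordinates of \<open>A\<close> with respect to these bases.
\<close>

definition bases :: "nat list \<Rightarrow> complex mat list set" where
  "bases k = {e. length e = length k \<and>
     (\<forall>j<length k. e ! j \<in> carrier_mat (k ! j + 1) (k ! j + 1) \<and> invertible_mat (e ! j))}"

definition triangulable :: "nat list \<Rightarrow> tensor \<Rightarrow> bool" where
  "triangulable k A \<longleftrightarrow>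
     (\<exists>e\<in>bases k. \<exists>a\<in>tensors k.
        A = (\<lambda>l. \<Sum>i\<in>indices k. a i * pure_tensor k (map2 col e i) l) \<and>
        (\<forall>i\<in>indices k. i ! 0 > (\<Sum>t=1..<length k. i ! t) \<longrightarrow> a i = 0))"


section \<open>Stability\<close>

definition SL_product :: "nat list \<Rightarrow> complex mat list set" where
  "SL_product k = {g. length g = length k \<and>
     (\<forall>j<length k. g ! j \<in> carrier_mat (k ! j + 1) (k ! j + 1) \<and> Determinant.det (g ! j) = 1)}"

definition act :: "nat list \<Rightarrow> complex mat list \<Rightarrow> tensor \<Rightarrow> tensor" where
  "act k g A = (\<lambda>i. if i \<in> indices k
     then \<Sum>l\<in>indices k. (\<Prod>j<length k. (g ! j) $$ (i ! j, l ! j)) * A l else 0)"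

text \<open>
  Stability of the projective point represented by a nonzero \<open>A\<close> under the linear action:
  the orbit of \<open>A\<close> is closed in the vector space and the stabilizer of \<open>A\<close> is finite (what the
  older terminology calls properly stable).  Neither condition depends on the representative.
\<close>

definition GIT_stable :: "nat list \<Rightarrow> tensor \<Rightarrow> bool" where
  "GIT_stable k A \<longleftrightarrow>
     zariski_closed k ((\<lambda>g. act k g A) ` SL_product k) \<and>
     finite {g \<in> SL_product k. act k g A = A}"

end

theory Submission
  imports
    Defs
    "HOL-Computational_Algebra.Formal_Laurent_Series"
    "HOL-Computational_Algebra.Fundamental_Theorem_Algebra"
    "Jordan_Normal_Form.Char_Poly"
begin

text \<open>
  A \<^emph>\<open>place\<close> of a field \<open>L\<close> over \<open>\<complex>\<close> is a valuation ring \<open>\<O>\<close> of \<open>L\<close> with residue field \<open>\<complex>\<close> and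
  residue map \<open>\<chi>\<close>; places extending a given specialisation exist by Zorn's lemma.  If the orbit
  of \<open>A\<close> is not closed or its stabilizer is infinite, then over an ultrapower \<open>L\<close> of \<open>\<complex>\<close> there are
  matrices \<open>g\<close> of determinant 1 and a place such that \<open>g A\<close> has entries in \<open>\<O>\<close> but \<open>g\<close> does not.
  Writing \<open>g = U D V\<close> with \<open>U, V\<close> invertible over \<open>\<O>\<close> and \<open>D\<close> diagonal (the Hilbert--Mumford argument),
  \<open>B = \<chi>(V) A\<close> has zero entries wherever the sum of the values of the diagonal entries
  is negative.  Nondegeneracy makes \<open>B\<close> nonzero on sufficiently many blocks, since \<open>s\<^sub>1 + \<dots> + s\<^sub>p\<close>
  multilinear forms have a common zero on a product of projective spaces of dimensions \<open>s\<^sub>t\<close>.  This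
  forces the values to be arithmetic progressions with a common difference, and \<open>B\<close> is triangular
  (if only one \<open>k\<^sub>t\<close>, \<open>t \<ge> 1\<close>, is positive, \<open>A\<close> is just an invertible matrix).  Conversely, a
  triangular array is contracted by the one-parameter subgroup with weights \<open>k\<^sub>0 - 2 i\<^sub>0\<close> and
  \<open>2 i\<^sub>t - k\<^sub>t\<close> to its diagonal part, which this subgroup fixes.
\<close>

section \<open>Ultrapowers of the complex numbers\<close>

text \<open>Both halves of stability come from one properness statement: if \<open>A\<close> is not
  triangulable, any \<open>g\<close> of determinant 1 over the ultrapower for which
  \<open>g A\<close> is integral at a place is itself integral there. A nonconstant \<open>g\<close>
  with \<open>g A = A\<close> is excluded by a place at which one of its entries is not integral; a
  point \<open>A'\<close> of the closure gives a place reducing \<open>g A\<close> to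
  \<open>A'\<close>, and \<open>g\<close> then reduces to an element carrying \<open>A\<close> to
  \<open>A'\<close>. The ultrapower replaces the choice of a curve in the orbit closure. The price
  is a valuation that need not be discrete, with an ordered value group that is never constructed:
  inequalities of values are divisibilities, value 0 means being a unit, and averages must use
  natural exponents, whence the cleared denominators. The hyperdeterminant enters through a count:
  if nonzero \<open>v_1, ..., v_p\<close> contract \<open>A\<close> to 0, tangency at a point with
  these last factors imposes \<open>k_0\<close> linear conditions on its first factor, a vector of
  dimension \<open>k_0 + 1\<close>.\<close>

lemma ultrafilter_exists:
  fixes F :: "'a filter"
  assumes "F \<noteq> bot"
  shows "\<exists>U\<le>F. U \<noteq> bot \<and> (\<forall>P. eventually P U \<or> eventually (\<lambda>x. \<not> P x) U)"
proof -
  \<comment> \<open>Families with the finite intersection property are used instead of filters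
    because this property passes to unions of chains at once; that a maximal family is a filter
    deciding every predicate is derived afterwards.\<close>
  let ?\<A> = "{S. S \<supseteq> {P. eventually P F} \<and> (\<forall>\<F>. finite \<F> \<and> \<F> \<subseteq> S \<longrightarrow> (\<exists>x. \<forall>P\<in>\<F>. P x))}"
  have base: "{P. eventually P F} \<in> ?\<A>"
  proof (clarsimp)
    fix \<F> assume "finite \<F>" "\<F> \<subseteq> {P. eventually P F}"
    then have "eventually (\<lambda>x. \<forall>P\<in>\<F>. P x) F"
      by (subst eventually_ball_finite_distrib) auto
    then show "\<exists>x. \<forall>P\<in>\<F>. P x" using eventually_happens'[OF assms] by auto
  qed
  have chain: "\<Union>C \<in> ?\<A>" if C: "C \<noteq> {}" "subset.chain ?\<A> C" for C
  proof -
    have "\<exists>x. \<forall>P\<in>\<F>. P x" if \<F>: "finite \<F>" "\<F> \<subseteq> \<Union>C" for \<F>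
    proof -
      obtain S where "S \<in> C" "\<F> \<subseteq> S"
        using finite_subset_Union_chain[OF \<F> C] .
      then show ?thesis using C(2) \<open>finite \<F>\<close> by (auto simp: subset.chain_def)
    qed
    moreover have "{P. eventually P F} \<subseteq> \<Union>C"
      using C by (force simp: subset.chain_def)
    ultimately show ?thesis by blast
  qed
  obtain M where M: "M \<in> ?\<A>" and max: "\<And>X. X \<in> ?\<A> \<Longrightarrow> M \<subseteq> X \<Longrightarrow> X = M"
    using subset_Zorn_nonempty[of ?\<A>] base chain by (metis (no_types, lifting) empty_iff)
  have fip: "\<exists>x. \<forall>P\<in>\<F>. P x" if "finite \<F>" "\<F> \<subseteq> M" for \<F>
    using M that by blast
  \<comment> \<open>A predicate compatible with every finite part of \<open>M\<close> can be
    adjoined, so maximality already puts it in \<open>M\<close>; \<open>mono\<close>,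
    \<open>conj\<close> and \<open>ult\<close> all follow from this.\<close>
  have mem: "P \<in> M" if P: "\<And>\<F>. finite \<F> \<Longrightarrow> \<F> \<subseteq> M \<Longrightarrow> \<exists>x. P x \<and> (\<forall>Q\<in>\<F>. Q x)" for P
  proof -
    have "insert P M \<in> ?\<A>"
    proof (intro CollectI conjI allI impI)
      show "{P. eventually P F} \<subseteq> insert P M" using M by blast
      fix \<F> assume *: "finite \<F> \<and> \<F> \<subseteq> insert P M"
      then have "finite (\<F> - {P})" "\<F> - {P} \<subseteq> M" by auto
      from P[OF this] show "\<exists>x. \<forall>P\<in>\<F>. P x" by blast
    qed
    from max[OF this] show ?thesis by blast
  qed
  have mono: "Q \<in> M" if "P \<in> M" "\<And>x. P x \<Longrightarrow> Q x" for P Q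
  proof (rule mem)
    fix \<F> assume "finite \<F>" "\<F> \<subseteq> M"
    then show "\<exists>x. Q x \<and> (\<forall>Q\<in>\<F>. Q x)" using fip[of "insert P \<F>"] that by auto
  qed
  have conj: "(\<lambda>x. P x \<and> Q x) \<in> M" if "P \<in> M" "Q \<in> M" for P Q
  proof (rule mem)
    fix \<F> assume "finite \<F>" "\<F> \<subseteq> M"
    then show "\<exists>x. (P x \<and> Q x) \<and> (\<forall>Q\<in>\<F>. Q x)" using fip[of "insert P (insert Q \<F>)"] that by auto
  qed
  have ult: "P \<in> M \<or> (\<lambda>x. \<not> P x) \<in> M" for P
  proof (rule ccontr)
    assume "\<not> ?thesis"
    then obtain \<F> \<G> where 1: "finite \<F>" "\<F> \<subseteq> M" "\<not> (\<exists>x. P x \<and> (\<forall>Q\<in>\<F>. Q x))"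
      and 2: "finite \<G>" "\<G> \<subseteq> M" "\<not> (\<exists>x. \<not> P x \<and> (\<forall>Q\<in>\<G>. Q x))"
      using mem[of P] mem[of "\<lambda>x. \<not> P x"] by blast
    have "\<exists>x. \<forall>P\<in>\<F> \<union> \<G>. P x" by (rule fip) (use 1 2 in auto)
    then show False using 1 2 by blast
  qed
  have "is_filter (\<lambda>P. P \<in> M)"
  proof
    show "(\<lambda>x. True) \<in> M" using M by auto
  qed (auto intro: conj mono)
  then have ev: "eventually P (Abs_filter (\<lambda>P. P \<in> M)) \<longleftrightarrow> P \<in> M" for P
    by (simp add: eventually_Abs_filter)
  show ?thesis
  proof (intro exI[of _ "Abs_filter (\<lambda>P. P \<in> M)"] conjI)
    show "Abs_filter (\<lambda>P. P \<in> M) \<le> F" using M by (auto simp: le_filter_def ev)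
    show "Abs_filter (\<lambda>P. P \<in> M) \<noteq> bot"
      using fip[of "{\<lambda>x. False}"] by (auto simp: trivial_limit_def ev)
  qed (use ult ev in auto)
qed

text \<open>Almost every index \<open>J\<close> is a finite set containing any prescribed element. A
  family \<open>g J\<close> that meets all conditions listed in a finite \<open>J\<close> therefore
  meets each single condition almost everywhere, which is how compactness enters.\<close>

definition ultra_filter :: "'x set filter" where
  "ultra_filter = (SOME U. U \<le> finite_subsets_at_top UNIV \<and> U \<noteq> bot \<and>
     (\<forall>P. eventually P U \<or> eventually (\<lambda>x. \<not> P x) U))"

lemma ultra_filter:
  "(ultra_filter :: 'x set filter) \<le> finite_subsets_at_top UNIV"
  "(ultra_filter :: 'x set filter) \<noteq> bot"
  "eventually P (ultra_filter :: 'x set filter) \<or> eventually (\<lambda>x. \<not> P x) (ultra_filter :: 'x set filter)"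
  using someI_ex[OF ultrafilter_exists[OF finite_subsets_at_top_neq_bot[of "UNIV :: 'x set"], unfolded Bex_def]]
  unfolding ultra_filter_def[symmetric] by auto

lemma eventually_ultra_filter_not:
  "eventually (\<lambda>x. \<not> P x) ultra_filter \<longleftrightarrow> \<not> eventually P ultra_filter"
  using ultra_filter(2,3) eventually_conj[of P ultra_filter "\<lambda>x. \<not> P x"] by (auto simp: trivial_limit_def)

lemma eventually_ultra_filter_False: "\<not> eventually (\<lambda>J. False) ultra_filter"
  using ultra_filter(2) by (simp add: trivial_limit_def)

lemma eventually_ultra_filter_mem: "eventually (\<lambda>J. x \<in> J) (ultra_filter :: 'x set filter)"
  by (rule filter_leD[OF ultra_filter(1)])
     (auto simp: eventually_finite_subsets_at_top intro!: exI[of _ "{x}"])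

lemma eventually_ultra_filter_finite: "eventually finite (ultra_filter :: 'x set filter)"
  by (rule filter_leD[OF ultra_filter(1)])
     (auto simp: eventually_finite_subsets_at_top)

section \<open>The ultrapower as a field\<close>

definition ultra_eq :: "('x set \<Rightarrow> complex) \<Rightarrow> ('x set \<Rightarrow> complex) \<Rightarrow> bool" where
  "ultra_eq f g \<longleftrightarrow> eventually (\<lambda>J. f J = g J) ultra_filter"

quotient_type 'x ultra = "'x set \<Rightarrow> complex" / ultra_eq
  morphisms rep_ultra ultra
proof (rule equivpI)
  show "reflp ultra_eq" by (auto simp: reflp_def ultra_eq_def)
  show "symp ultra_eq" by (auto simp: symp_def ultra_eq_def eq_commute)
  show "transp ultra_eq"
    unfolding transp_def ultra_eq_def by (auto elim: eventually_elim2)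
qed

instantiation ultra :: (type) comm_ring_1
begin
lift_definition zero_ultra :: "'a ultra" is "\<lambda>_. 0" .
lift_definition one_ultra :: "'a ultra" is "\<lambda>_. 1" .
lift_definition plus_ultra :: "'a ultra \<Rightarrow> 'a ultra \<Rightarrow> 'a ultra" is "\<lambda>f g J. f J + g J"
  unfolding ultra_eq_def by (auto elim: eventually_elim2)
lift_definition times_ultra :: "'a ultra \<Rightarrow> 'a ultra \<Rightarrow> 'a ultra" is "\<lambda>f g J. f J * g J"
  unfolding ultra_eq_def by (auto elim: eventually_elim2)
lift_definition minus_ultra :: "'a ultra \<Rightarrow> 'a ultra \<Rightarrow> 'a ultra" is "\<lambda>f g J. f J - g J"
  unfolding ultra_eq_def by (auto elim: eventually_elim2)
lift_definition uminus_ultra :: "'a ultra \<Rightarrow> 'a ultra" is "\<lambda>f J. - f J"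
  unfolding ultra_eq_def by (auto elim: eventually_mono)
instance
proof
  fix a b c :: "'a ultra"
  show "a * b * c = a * (b * c)" by transfer (simp add: ultra_eq_def mult.assoc)
  show "a * b = b * a" by transfer (simp add: ultra_eq_def mult.commute)
  show "1 * a = a" by transfer (simp add: ultra_eq_def)
  show "a + b + c = a + (b + c)" by transfer (simp add: ultra_eq_def add.assoc)
  show "a + b = b + a" by transfer (simp add: ultra_eq_def add.commute)
  show "0 + a = a" by transfer (simp add: ultra_eq_def)
  show "- a + a = 0" by transfer (simp add: ultra_eq_def)
  show "a - b = a + - b" by transfer (simp add: ultra_eq_def)
  show "(a + b) * c = a * c + b * c" by transfer (simp add: ultra_eq_def distrib_right)
  show "(0::'a ultra) \<noteq> 1"
    by transfer (use ultra_filter(2) in \<open>simp add: ultra_eq_def trivial_limit_def\<close>)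
qed
end

instantiation ultra :: (type) inverse
begin
lift_definition divide_ultra :: "'a ultra \<Rightarrow> 'a ultra \<Rightarrow> 'a ultra" is "\<lambda>f g J. f J / g J"
  unfolding ultra_eq_def by (auto elim: eventually_elim2)
lift_definition inverse_ultra :: "'a ultra \<Rightarrow> 'a ultra" is "\<lambda>f J. inverse (f J)"
  unfolding ultra_eq_def by (auto elim: eventually_mono)
instance ..
end

instance ultra :: (type) field
proof
  fix a b :: "'a ultra"
  show "inverse (0::'a ultra) = 0" by transfer (simp add: ultra_eq_def)
  show "a / b = a * inverse b" by transfer (simp add: ultra_eq_def divide_inverse)
  show "a \<noteq> 0 \<Longrightarrow> inverse a * a = 1"
    by transfer (auto simp: ultra_eq_def eventually_ultra_filter_not[symmetric] elim: eventually_mono)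
qed

lift_definition ultra_const :: "complex \<Rightarrow> 'x ultra" is "\<lambda>c _. c" .

lemma ultra_eq_iff: "ultra f = ultra g \<longleftrightarrow> eventually (\<lambda>J. f J = g J) ultra_filter"
  by (simp add: ultra.abs_eq_iff ultra_eq_def)

lemma ultra_arith:
  "ultra f + ultra g = ultra (\<lambda>J. f J + g J)"
  "ultra f * ultra g = ultra (\<lambda>J. f J * g J)"
  "1 = ultra (\<lambda>J. 1)" "0 = ultra (\<lambda>J. 0)"
  "ultra_const c = ultra (\<lambda>J. c)"
  by (simp_all add: plus_ultra.abs_eq times_ultra.abs_eq one_ultra.abs_eq zero_ultra.abs_eq ultra_const.abs_eq)

lemma ultra_sum: "(\<Sum>x\<in>X. ultra (f x)) = ultra (\<lambda>J. \<Sum>x\<in>X. f x J)"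
  by (induction X rule: infinite_finite_induct) (auto simp: ultra_arith)

lemma ultra_prod: "(\<Prod>x\<in>X. ultra (f x)) = ultra (\<lambda>J. \<Prod>x\<in>X. f x J)"
  by (induction X rule: infinite_finite_induct) (auto simp: ultra_arith)

section \<open>Places\<close>

locale place = field_hom \<iota> for \<iota> :: "complex \<Rightarrow> 'a::field" +
  fixes \<O> :: "'a set" and \<chi> :: "'a \<Rightarrow> complex"
  assumes const_mem: "\<iota> c \<in> \<O>" and \<chi>_const: "\<chi> (\<iota> c) = c"
    and add_mem: "x \<in> \<O> \<Longrightarrow> y \<in> \<O> \<Longrightarrow> x + y \<in> \<O>"
    and \<chi>_add: "x \<in> \<O> \<Longrightarrow> y \<in> \<O> \<Longrightarrow> \<chi> (x + y) = \<chi> x + \<chi> y"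
    and mult_mem: "x \<in> \<O> \<Longrightarrow> y \<in> \<O> \<Longrightarrow> x * y \<in> \<O>"
    and \<chi>_mult: "x \<in> \<O> \<Longrightarrow> y \<in> \<O> \<Longrightarrow> \<chi> (x * y) = \<chi> x * \<chi> y"
    and inverse_mem: "x \<notin> \<O> \<Longrightarrow> inverse x \<in> \<O>"
    and \<chi>_inverse: "x \<notin> \<O> \<Longrightarrow> \<chi> (inverse x) = 0"

text \<open>The weak Nullstellensatz in one variable: a nonzero element of least degree generates
  the ideal, and any root of it would be a common root.\<close>

lemma complex_poly_ideal_contains_1:
  fixes J :: "complex poly set"
  assumes add: "\<And>p q. p \<in> J \<Longrightarrow> q \<in> J \<Longrightarrow> p + q \<in> J"
    and mult: "\<And>p q. p \<in> J \<Longrightarrow> p * q \<in> J"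
    and no_root: "\<And>t. \<exists>p\<in>J. poly p t \<noteq> 0"
  shows "1 \<in> J"
proof -
  obtain q0 where "q0 \<in> J" "q0 \<noteq> 0" using no_root[of 0] by (metis poly_0)
  then obtain q where q: "q \<in> J" "q \<noteq> 0" and min: "\<And>r. r \<in> J \<Longrightarrow> r \<noteq> 0 \<Longrightarrow> degree q \<le> degree r"
    using ex_has_least_nat[of "\<lambda>q. q \<in> J \<and> q \<noteq> 0" q0 degree] by blast
  have dvd: "q dvd f" if "f \<in> J" for f
  proof -
    have "f mod q = f + q * (- (f div q))" by (simp add: minus_mult_div_eq_mod[symmetric] algebra_simps)
    then have "f mod q \<in> J" using add[OF that mult[OF q(1)], of "- (f div q)"] by metis
    then show ?thesis using min[of "f mod q"] degree_mod_less[OF q(2), of f] by force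
  qed
  have "degree q = 0"
  proof (rule ccontr)
    assume "degree q \<noteq> 0"
    then have "\<not> constant (poly q)" by (simp add: constant_degree)
    then obtain t where t: "poly q t = 0" using fundamental_theorem_of_algebra by blast
    have "poly f t = 0" if "f \<in> J" for f using dvd[OF that] t by (auto simp: dvd_def)
    then show False using no_root[of t] by blast
  qed
  then obtain c where "q = [:c:]" by (metis degree_eq_zeroE)
  then have "q * [:1/c:] = 1" using q by simp
  then show ?thesis using mult[OF q(1)] by metis
qed

text \<open>
  \<open>G\<close> is the graph of a ring homomorphism to \<open>\<complex>\<close> from a subring of the field; given closure under
  addition and multiplication, \<open>(0, 1) \<notin> G\<close> says that \<open>G\<close> is single-valued.
\<close>

definition place_graph :: "(complex \<Rightarrow> 'a::field) \<Rightarrow> ('a \<times> complex) set \<Rightarrow> bool" where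
  "place_graph \<iota> G \<longleftrightarrow> (\<forall>c. (\<iota> c, c) \<in> G) \<and> (0, 1) \<notin> G \<and>
     (\<forall>x a y b. (x, a) \<in> G \<longrightarrow> (y, b) \<in> G \<longrightarrow> (x + y, a + b) \<in> G \<and> (x * y, a * b) \<in> G)"

lemma place_graphD:
  assumes "place_graph \<iota> G"
  shows "(\<iota> c, c) \<in> G" "(0, 1) \<notin> G"
    "(x, a) \<in> G \<Longrightarrow> (y, b) \<in> G \<Longrightarrow> (x + y, a + b) \<in> G"
    "(x, a) \<in> G \<Longrightarrow> (y, b) \<in> G \<Longrightarrow> (x * y, a * b) \<in> G"
  using assms unfolding place_graph_def by simp_all

locale maximal_place_graph = field_hom \<iota> for \<iota> :: "complex \<Rightarrow> 'a::field" +
  fixes G :: "('a \<times> complex) set"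
  assumes graph: "place_graph \<iota> G"
    and maximal: "place_graph \<iota> G' \<Longrightarrow> G \<subseteq> G' \<Longrightarrow> G' = G"
begin

lemma const_G: "(\<iota> c, c) \<in> G"
  and not_G: "(0, 1) \<notin> G"
  and add_G: "(x, a) \<in> G \<Longrightarrow> (y, b) \<in> G \<Longrightarrow> (x + y, a + b) \<in> G"
  and mult_G: "(x, a) \<in> G \<Longrightarrow> (y, b) \<in> G \<Longrightarrow> (x * y, a * b) \<in> G"
  using place_graphD[OF graph] by simp_all

lemma zero_G: "(0, 0) \<in> G" and one_G: "(1, 1) \<in> G"
  using const_G[of 0] const_G[of 1] by simp_all

lemma uminus_G: "(x, a) \<in> G \<Longrightarrow> (- x, - a) \<in> G"
  using mult_G[OF const_G[of "-1"], of x a] by (simp add: hom_distribs)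

lemma diff_G: "(x, a) \<in> G \<Longrightarrow> (y, b) \<in> G \<Longrightarrow> (x - y, a - b) \<in> G"
  using add_G[OF _ uminus_G, of x a y b] by simp

lemma sum_G: "(\<And>i. i \<in> I \<Longrightarrow> (f i, g i) \<in> G) \<Longrightarrow> (sum f I, sum g I) \<in> G"
  by (induction I rule: infinite_finite_induct) (auto intro: add_G zero_G)

lemma power_G: "(x, a) \<in> G \<Longrightarrow> (x ^ n, a ^ n) \<in> G"
  by (induction n) (auto intro: mult_G one_G)

lemma zero_G_iff: "(0, c) \<in> G \<longleftrightarrow> c = 0"
proof
  assume "(0, c) \<in> G"
  then show "c = 0" using mult_G[OF const_G[of "1/c"], of 0 c] not_G by (cases "c = 0") auto
qed (simp add: zero_G)

lemma unique_G: "(x, a) \<in> G \<Longrightarrow> (x, b) \<in> G \<Longrightarrow> a = b"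
  using diff_G[of x a x b] by (simp add: zero_G_iff)

text \<open>Maximality forbids extending the homomorphism to the ring generated by \<open>x\<close>,
  whatever value \<open>t\<close> is given to \<open>x\<close>. The residues of the polynomial
  relations of \<open>x\<close> thus form an ideal of complex polynomials without a common root, so
  it contains 1. This is where algebraic closedness keeps the residue field equal to the complex
  numbers.\<close>

lemma not_Domain:
  assumes x: "x \<notin> Domain G"
  shows "\<exists>p. (coeff p 0, 1) \<in> G \<and> (\<forall>i>0. (coeff p i, 0) \<in> G) \<and> poly p x = 0"
proof -
  define J where "J = {q. \<exists>p. (\<forall>i. (coeff p i, coeff q i) \<in> G) \<and> poly p x = 0}"
  have "1 \<in> J"
  proof (rule complex_poly_ideal_contains_1)
    fix p q assume "p \<in> J" "q \<in> J"
    then obtain p' q' where "\<forall>i. (coeff p' i, coeff p i) \<in> G" "poly p' x = 0"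
      "\<forall>i. (coeff q' i, coeff q i) \<in> G" "poly q' x = 0" by (auto simp: J_def)
    then show "p + q \<in> J" unfolding J_def by (auto intro!: exI[of _ "p' + q'"] add_G)
  next
    fix p q assume "p \<in> J"
    then obtain p' where "\<forall>i. (coeff p' i, coeff p i) \<in> G" "poly p' x = 0" by (auto simp: J_def)
    then show "p * q \<in> J" unfolding J_def
      by (auto simp: coeff_mult coeff_map_poly intro!: exI[of _ "p' * map_poly \<iota> q"] sum_G mult_G const_G)
  next
    fix t
    \<comment> \<open>The candidate extension with value \<open>t\<close> at \<open>x\<close>; its
      failure to be single-valued yields a relation of \<open>x\<close> whose residue does not
      vanish at \<open>t\<close>.\<close>
    define G' where "G' = {(poly p x, poly q t) |p q. \<forall>i. (coeff p i, coeff q i) \<in> G}"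
    have G'I: "(poly p x, poly q t) \<in> G'" if "\<And>i. (coeff p i, coeff q i) \<in> G" for p q
      using that unfolding G'_def by blast
    have sub: "G \<subseteq> G'"
    proof clarify
      fix y a assume "(y, a) \<in> G"
      then show "(y, a) \<in> G'" using G'I[of "[:y:]" "[:a:]"] by (simp add: coeff_pCons zero_G split: nat.split)
    qed
    have "(x, t) \<in> G'" using G'I[of "[:0,1:]" "[:0,1:]"] by (simp add: coeff_pCons zero_G one_G split: nat.split)
    then have "G' \<noteq> G" using x by auto
    then have "\<not> place_graph \<iota> G'" using maximal sub by blast
    moreover have "(y + z, a + b) \<in> G' \<and> (y * z, a * b) \<in> G'" if yz: "(y, a) \<in> G'" "(z, b) \<in> G'" for y a z b
    proof -
      obtain p q p' q' where "y = poly p x" "a = poly q t" "z = poly p' x" "b = poly q' t"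
        "\<And>i. (coeff p i, coeff q i) \<in> G" "\<And>i. (coeff p' i, coeff q' i) \<in> G"
        using yz unfolding G'_def by blast
      then show ?thesis using G'I[of "p + p'" "q + q'"] G'I[of "p * p'" "q * q'"]
        by (simp add: add_G coeff_mult sum_G mult_G)
    qed
    ultimately have "(0, 1) \<in> G'" using sub const_G unfolding place_graph_def by blast
    then obtain p q where "\<forall>i. (coeff p i, coeff q i) \<in> G" "poly p x = 0" "poly q t = 1"
      unfolding G'_def by force
    then show "\<exists>q\<in>J. poly q t \<noteq> 0" unfolding J_def by (auto intro!: exI[of _ q])
  qed
  then obtain p where p: "\<And>i. (coeff p i, coeff 1 i) \<in> G" "poly p x = 0" by (auto simp: J_def)
  have "(coeff p i, 0) \<in> G" if "i > 0" for i using p(1)[of i] that by simp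
  then show ?thesis using p(1)[of 0] p(2) by (intro exI[of _ p]) simp
qed

text \<open>The domain of a maximal graph is a local ring. A relation for \<open>inverse y\<close>
  whose residue is the polynomial 1, multiplied by a power of \<open>y\<close>, would give 0 a power
  of \<open>c\<close> as residue.\<close>

lemma inverse_G:
  assumes y: "(y, c) \<in> G" and c: "c \<noteq> 0"
  shows "(inverse y, inverse c) \<in> G"
proof -
  have y0: "y \<noteq> 0" using y c zero_G_iff by blast
  have "inverse y \<in> Domain G"
  proof (rule ccontr)
    assume "inverse y \<notin> Domain G"
    then obtain p where p: "(coeff p 0, 1) \<in> G" "\<forall>i>0. (coeff p i, 0) \<in> G" "poly p (inverse y) = 0"
      using not_Domain by blast
    let ?n = "degree p"
    have "(\<Sum>i\<le>?n. coeff p i * y ^ (?n - i)) = (\<Sum>i\<le>?n. coeff p i * inverse y ^ i) * y ^ ?n"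
      unfolding sum_distrib_right
    proof (rule sum.cong)
      fix i assume "i \<in> {..?n}"
      then have "y ^ ?n = y ^ i * y ^ (?n - i)" by (simp add: power_add[symmetric])
      then show "coeff p i * y ^ (?n - i) = coeff p i * inverse y ^ i * y ^ ?n"
        using y0 by (simp add: power_inverse)
    qed simp
    also have "\<dots> = 0" using p(3) by (simp add: poly_altdef)
    finally have 0: "(\<Sum>i\<le>?n. coeff p i * y ^ (?n - i)) = 0" .
    have "(\<Sum>i\<le>?n. coeff p i * y ^ (?n - i), \<Sum>i\<le>?n. (if i = 0 then 1 else 0) * c ^ (?n - i)) \<in> G"
      using p by (intro sum_G mult_G power_G y) auto
    moreover have "(\<Sum>i\<le>?n. (if i = 0 then 1 else 0) * c ^ (?n - i)) = c ^ ?n"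
      by (subst sum.remove[of _ 0]) auto
    ultimately show False using c by (simp add: 0 zero_G_iff)
  qed
  then obtain d where d: "(inverse y, d) \<in> G" by blast
  from mult_G[OF y d] y0 have "(1, c * d) \<in> G" by simp
  with unique_G[OF one_G] have "c * d = 1" by metis
  then have "d = inverse c" using c by (simp add: field_simps)
  with d show ?thesis by simp
qed

text \<open>Says that the maximal ideal generates the unit ideal after adjoining \<open>x\<close>,
  with \<open>n\<close> bounding the degree. These relations drive the descent showing that
  \<open>x\<close> or \<open>inverse x\<close> lies in the domain.\<close>

definition unit_relation :: "'a \<Rightarrow> nat \<Rightarrow> bool" where
  "unit_relation x n \<longleftrightarrow> (\<exists>\<mu>. (\<forall>i. (\<mu> i, 0) \<in> G) \<and> (\<Sum>i=1..n. \<mu> i * x ^ i) = 1)"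

text \<open>The constant term can be absorbed, because \<open>1 - \<kappa> 0\<close> has residue 1
  and is therefore invertible within \<open>G\<close>.\<close>

lemma unit_relationI:
  assumes \<kappa>: "\<And>i. (\<kappa> i, 0) \<in> G" and 1: "(\<Sum>i\<le>n. \<kappa> i * x ^ i) = 1"
  shows "unit_relation x n"
proof -
  have u: "(inverse (1 - \<kappa> 0), 1) \<in> G"
    using inverse_G[OF diff_G[OF one_G \<kappa>[of 0]]] by simp
  have nz: "1 - \<kappa> 0 \<noteq> 0" using diff_G[OF one_G \<kappa>[of 0]] by (auto simp: zero_G_iff)
  have "{..n} = insert 0 {1..n}" by auto
  then have "1 - \<kappa> 0 = (\<Sum>i=1..n. \<kappa> i * x ^ i)" using 1 by (simp add: algebra_simps)
  then have "1 = inverse (1 - \<kappa> 0) * (\<Sum>i=1..n. \<kappa> i * x ^ i)" using nz by simp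
  then have "(\<Sum>i=1..n. (inverse (1 - \<kappa> 0) * \<kappa> i) * x ^ i) = 1"
    by (simp add: sum_distrib_left mult.assoc)
  moreover have "(inverse (1 - \<kappa> 0) * \<kappa> i, 0) \<in> G" for i using mult_G[OF u \<kappa>[of i]] by simp
  ultimately show ?thesis unfolding unit_relation_def by (intro exI[of _ "\<lambda>i. inverse (1 - \<kappa> 0) * \<kappa> i"]) simp
qed

lemma unit_relation_not_Domain:
  assumes "x \<notin> Domain G"
  shows "\<exists>n. unit_relation x n"
proof -
  from not_Domain[OF assms] obtain p where
    p: "(coeff p 0, 1) \<in> G" "\<forall>i>0. (coeff p i, 0) \<in> G" "poly p x = 0" by blast
  define \<kappa> where "\<kappa> i = (if i = 0 then 1 - coeff p 0 else - coeff p i)" for i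
  have \<kappa>: "(\<kappa> i, 0) \<in> G" for i
    using diff_G[OF one_G p(1)] uminus_G[of "coeff p i" 0] p(2) by (auto simp: \<kappa>_def)
  have "(\<Sum>i\<le>degree p. \<kappa> i * x ^ i) = (\<Sum>i\<le>degree p. (if i = 0 then 1 else 0) - coeff p i * x ^ i)"
    by (rule sum.cong) (auto simp: \<kappa>_def)
  also have "\<dots> = 1" using p(3) by (simp add: sum_subtractf poly_altdef)
  finally have "unit_relation x (degree p)" by (rule unit_relationI[OF \<kappa>])
  then show ?thesis ..
qed

text \<open>The relation for \<open>inverse x\<close>, multiplied by \<open>x ^ n\<close>, expresses
  \<open>x ^ n\<close> through lower powers and so removes the leading term of the relation for
  \<open>x\<close>.\<close>

lemma unit_relation_reduce:
  assumes x: "x \<noteq> 0" and n: "unit_relation x n" and l: "unit_relation (inverse x) l" and le: "l \<le> n"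
  shows "n > 0 \<and> unit_relation x (n - 1)"
proof -
  obtain \<mu> \<nu> where \<mu>: "\<And>i. (\<mu> i, 0) \<in> G" "(\<Sum>i=1..n. \<mu> i * x ^ i) = 1"
    and \<nu>: "\<And>i. (\<nu> i, 0) \<in> G" "(\<Sum>i=1..l. \<nu> i * inverse x ^ i) = 1"
    using n l unfolding unit_relation_def by blast
  have n0: "n > 0" using \<mu>(2) by (cases n) auto
  \<comment> \<open>The first summand keeps the relation for \<open>x\<close>, the second is its
    leading coefficient times the shifted relation for \<open>inverse x\<close>; only indices below
    \<open>n\<close> are summed later.\<close>
  define \<kappa> where "\<kappa> i = (if 1 \<le> i then \<mu> i else 0) + (if n - l \<le> i then \<mu> n * \<nu> (n - i) else 0)" for i
  have \<kappa>: "(\<kappa> i, 0) \<in> G" for i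
    using add_G[OF \<mu>(1)[of i] mult_G[OF \<mu>(1)[of n] \<nu>(1)[of "n-i"]]] mult_G[OF \<mu>(1)[of n] \<nu>(1)[of "n-i"]] \<mu>(1)[of i] zero_G
    by (auto simp: \<kappa>_def)
  have "x ^ n = (\<Sum>j=1..l. \<nu> j * inverse x ^ j) * x ^ n" unfolding \<nu>(2) by simp
  also have "\<dots> = (\<Sum>j=1..l. \<nu> j * x ^ (n - j))" unfolding sum_distrib_right
  proof (rule sum.cong)
    fix j assume "j \<in> {1..l}"
    then have "x ^ n = x ^ j * x ^ (n - j)" using le by (simp add: power_add[symmetric])
    then show "\<nu> j * inverse x ^ j * x ^ n = \<nu> j * x ^ (n - j)" using x by (simp add: power_inverse)
  qed simp
  also have "\<dots> = (\<Sum>i\<in>{n-l..n-1}. \<nu> (n - i) * x ^ i)"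
    by (rule sum.reindex_bij_witness[of _ "\<lambda>i. n - i" "\<lambda>j. n - j"]) (use le n0 in auto)
  finally have xn: "x ^ n = (\<Sum>i\<in>{n-l..n-1}. \<nu> (n - i) * x ^ i)" .
  have "(\<Sum>i\<le>n-1. \<kappa> i * x ^ i) = (\<Sum>i\<le>n-1. if 1 \<le> i then \<mu> i * x ^ i else 0) +
      (\<Sum>i\<le>n-1. if n - l \<le> i then \<mu> n * (\<nu> (n - i) * x ^ i) else 0)"
    unfolding sum.distrib[symmetric] by (rule sum.cong) (auto simp: \<kappa>_def algebra_simps)
  also have "(\<Sum>i\<le>n-1. if 1 \<le> i then \<mu> i * x ^ i else 0) = (\<Sum>i=1..n-1. \<mu> i * x ^ i)"
    by (rule sum.mono_neutral_cong_right) auto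
  also have "(\<Sum>i\<le>n-1. if n - l \<le> i then \<mu> n * (\<nu> (n - i) * x ^ i) else 0) = (\<Sum>i\<in>{n-l..n-1}. \<mu> n * (\<nu> (n - i) * x ^ i))"
    by (rule sum.mono_neutral_cong_right) auto
  also have "\<dots> = \<mu> n * x ^ n" by (subst xn) (simp add: sum_distrib_left)
  also have "(\<Sum>i=1..n-1. \<mu> i * x ^ i) + \<mu> n * x ^ n = (\<Sum>i=1..n. \<mu> i * x ^ i)"
    using n0 by (cases n) auto
  finally have "(\<Sum>i\<le>n-1. \<kappa> i * x ^ i) = 1" using \<mu>(2) by simp
  from unit_relationI[OF \<kappa> this] n0 show ?thesis by simp
qed

text \<open>Infinite descent: the longer of the two relations can always be shortened.\<close>

lemma unit_relation_exclusive:
  "x \<noteq> 0 \<Longrightarrow> unit_relation x n \<Longrightarrow> unit_relation (inverse x) l \<Longrightarrow> False"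
proof (induction "n + l" arbitrary: n l rule: less_induct)
  case less
  show ?case
  proof (cases "l \<le> n")
    case True
    with unit_relation_reduce[OF less.prems True] less.hyps[of "n - 1" l] less.prems show False by auto
  next
    case False
    with unit_relation_reduce[of "inverse x" l n] less.hyps[of n "l - 1"] less.prems show False by auto
  qed
qed

lemma Domain_or_inverse:
  assumes "x \<notin> Domain G"
  shows "(inverse x, 0) \<in> G"
proof -
  have x: "x \<noteq> 0" using assms zero_G by auto
  have "inverse x \<in> Domain G"
    using unit_relation_exclusive[OF x] unit_relation_not_Domain assms by blast
  then obtain a where a: "(inverse x, a) \<in> G" by blast
  with inverse_G[OF a] assms have "a = 0" by auto
  with a show ?thesis by simp
qed

lemma place_of_graph: "place \<iota> (Domain G) (\<lambda>x. THE a. (x, a) \<in> G)"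
proof -
  have the: "(THE a. (x, a) \<in> G) = a" if "(x, a) \<in> G" for x a
    using that unique_G by blast
  show ?thesis
  proof
    fix x y c
    show "\<iota> c \<in> Domain G" "(THE a. (\<iota> c, a) \<in> G) = c" using const_G the by blast+
    show "inverse x \<in> Domain G" "(THE a. (inverse x, a) \<in> G) = 0" if "x \<notin> Domain G"
      using Domain_or_inverse[OF that] the by blast+
    assume "x \<in> Domain G" "y \<in> Domain G"
    then obtain a b where ab: "(x, a) \<in> G" "(y, b) \<in> G" by blast
    then show "x + y \<in> Domain G" "x * y \<in> Domain G" using add_G mult_G by blast+
    show "(THE a. (x + y, a) \<in> G) = (THE a. (x, a) \<in> G) + (THE a. (y, a) \<in> G)"
      "(THE a. (x * y, a) \<in> G) = (THE a. (x, a) \<in> G) * (THE a. (y, a) \<in> G)"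
      using ab the add_G[OF ab] mult_G[OF ab] by simp_all
  qed
qed

end

text \<open>Chevalley's extension theorem with an algebraically closed target. Each closure
  condition of \<open>place_graph\<close> involves at most two pairs, so unions of chains are
  admissible for Zorn's lemma.\<close>

theorem place_extension:
  fixes \<iota> :: "complex \<Rightarrow> 'a::field"
  assumes \<iota>: "field_hom \<iota>" and G0: "place_graph \<iota> G0"
  shows "\<exists>\<O> \<chi>. place \<iota> \<O> \<chi> \<and> (\<forall>x a. (x, a) \<in> G0 \<longrightarrow> x \<in> \<O> \<and> \<chi> x = a)"
proof -
  let ?\<A> = "{G. place_graph \<iota> G \<and> G0 \<subseteq> G}"
  have "\<exists>M\<in>?\<A>. \<forall>X\<in>?\<A>. M \<subseteq> X \<longrightarrow> X = M"
  proof (rule subset_Zorn_nonempty)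
    show "?\<A> \<noteq> {}" using G0 by auto
    fix C assume C: "C \<noteq> {}" "subset.chain ?\<A> C"
    then have pg: "place_graph \<iota> G" "G0 \<subseteq> G" if "G \<in> C" for G
      using that by (auto simp: subset.chain_def)
    have "place_graph \<iota> (\<Union>C)"
      unfolding place_graph_def
    proof (intro conjI allI impI)
      obtain G where G: "G \<in> C" using C(1) by blast
      show "(\<iota> c, c) \<in> \<Union>C" for c using G place_graphD(1)[OF pg(1)[OF G]] by blast
      show "(0, 1) \<notin> \<Union>C"
      proof
        assume "(0, 1) \<in> \<Union>C"
        then obtain S where S: "S \<in> C" "(0, 1) \<in> S" by blast
        show False using S(2) place_graphD(2)[OF pg(1)[OF S(1)]] by contradiction
      qed
      fix x a y b assume "(x, a) \<in> \<Union>C" "(y, b) \<in> \<Union>C"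
      then obtain S T where "S \<in> C" "T \<in> C" "(x, a) \<in> S" "(y, b) \<in> T" by blast
      moreover have "S \<subseteq> T \<or> T \<subseteq> S"
        using subset.chain_total[OF C(2) \<open>S \<in> C\<close> \<open>T \<in> C\<close>] by blast
      ultimately obtain H where H: "H \<in> C" "(x, a) \<in> H" "(y, b) \<in> H" by blast
      then have "(x + y, a + b) \<in> H" "(x * y, a * b) \<in> H"
        using place_graphD(3,4)[OF pg(1)[OF H(1)] H(2,3)] by simp_all
      then show "(x + y, a + b) \<in> \<Union>C" "(x * y, a * b) \<in> \<Union>C"
        using H(1) by blast+
    qed
    moreover have "G0 \<subseteq> \<Union>C" using C(1) pg(2) by blast
    ultimately show "\<Union>C \<in> ?\<A>" by simp
  qed
  then obtain G where G: "place_graph \<iota> G" "G0 \<subseteq> G" and max: "\<And>X. place_graph \<iota> X \<Longrightarrow> G0 \<subseteq> X \<Longrightarrow> G \<subseteq> X \<Longrightarrow> X = G"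
    by (metis (no_types, lifting) mem_Collect_eq)
  interpret field_hom \<iota> by fact
  interpret maximal_place_graph \<iota> G
  proof
    show "place_graph \<iota> G" by fact
    show "G' = G" if "place_graph \<iota> G'" "G \<subseteq> G'" for G'
      using max[OF that(1) subset_trans[OF G(2) that(2)] that(2)] .
  qed
  have "x \<in> Domain G \<and> (THE a. (x, a) \<in> G) = a" if "(x, a) \<in> G0" for x a
    using that G(2) unique_G by (intro conjI the_equality) blast+
  then show ?thesis using place_of_graph by blast
qed

text \<open>A nonconstant \<open>x\<close> is transcendental, so \<open>inverse x\<close> may be
  specialised to 0; since \<open>x * inverse x = 1\<close>, \<open>x\<close> cannot then be
  integral.\<close>

lemma place_avoiding:
  fixes \<iota> :: "complex \<Rightarrow> 'a::field"
  assumes \<iota>: "field_hom \<iota>" and x: "x \<notin> range \<iota>"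
  shows "\<exists>\<O> \<chi>. place \<iota> \<O> \<chi> \<and> x \<notin> \<O>"
proof -
  interpret field_hom \<iota> by fact
  interpret P: map_poly_inj_idom_hom \<iota> ..
  define G where "G = {(poly (map_poly \<iota> p) (inverse x), poly p 0) |p. True}"
  have GI: "(poly (map_poly \<iota> p) (inverse x), poly p 0) \<in> G" for p unfolding G_def by blast
  \<comment> \<open>Transcendence of \<open>inverse x\<close>: a nonzero polynomial is a constant
    times linear factors, none of which vanishes at \<open>inverse x\<close>.\<close>
  have nz: "poly (map_poly \<iota> p) (inverse x) \<noteq> 0" if "p \<noteq> 0" for p
    using that
  proof (induction "degree p" arbitrary: p)
    case 0
    then obtain c where "p = [:c:]" by (metis degree_eq_zeroE)
    with 0 show ?case by (simp add: map_poly_pCons)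
  next
    case (Suc n)
    then have "\<not> constant (poly p)" by (simp add: constant_degree)
    then obtain t where "poly p t = 0" using fundamental_theorem_of_algebra by blast
    then obtain q where q: "p = [:-t, 1:] * q" by (auto simp: poly_eq_0_iff_dvd)
    with Suc have "q \<noteq> 0" "degree q = n" by (auto simp del: mult_pCons_left simp add: degree_mult_eq)
    with Suc have "poly (map_poly \<iota> q) (inverse x) \<noteq> 0" by blast
    moreover have "inverse x \<noteq> \<iota> t"
    proof
      assume "inverse x = \<iota> t"
      then have "x = \<iota> (inverse t)" by (metis hom_inverse inverse_inverse_eq)
      then show False using x by blast
    qed
    moreover have "map_poly \<iota> p = [:-\<iota> t, 1:] * map_poly \<iota> q"
      unfolding q P.hom_mult by (simp add: map_poly_pCons hom_uminus)
    ultimately show ?case by simp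
  qed
  have "place_graph \<iota> G"
    unfolding place_graph_def
  proof (intro conjI allI impI)
    show "(\<iota> c, c) \<in> G" for c using GI[of "[:c:]"] by (cases "c = 0") (simp_all add: map_poly_pCons)
    show "(0, 1) \<notin> G"
    proof
      assume "(0, 1) \<in> G"
      then obtain p where "poly (map_poly \<iota> p) (inverse x) = 0" "poly p 0 = 1" unfolding G_def by auto
      moreover then have "p \<noteq> 0" by auto
      ultimately show False using nz[of p] by simp
    qed
    fix y a z b assume "(y, a) \<in> G" "(z, b) \<in> G"
    then obtain p q where "y = poly (map_poly \<iota> p) (inverse x)" "z = poly (map_poly \<iota> q) (inverse x)"
      "a = poly p 0" "b = poly q 0" unfolding G_def by blast
    then show "(y + z, a + b) \<in> G" "(y * z, a * b) \<in> G"
      using GI[of "p + q"] GI[of "p * q"] by (simp_all add: P.hom_add P.hom_mult)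
  qed
  from place_extension[OF \<iota> this] obtain \<O> \<chi> where P: "place \<iota> \<O> \<chi>"
    and ext: "\<And>x a. (x, a) \<in> G \<Longrightarrow> x \<in> \<O> \<and> \<chi> x = a" by blast
  interpret pl: place \<iota> \<O> \<chi> by fact
  have "x \<notin> \<O>"
  proof
    assume "x \<in> \<O>"
    have "inverse x \<in> \<O>" "\<chi> (inverse x) = 0" using ext[OF GI[of "[:0,1:]"]] by simp_all
    moreover have "x * inverse x = \<iota> 1" using x rangeI[of \<iota> 0] by (cases "x = 0") auto
    ultimately show False using pl.\<chi>_mult[OF \<open>x \<in> \<O>\<close>, of "inverse x"] pl.\<chi>_const[of 1] by simp
  qed
  then show ?thesis using P by blast
qed

section \<open>Arithmetic of a place and the order of its values\<close>

context place
begin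

lemma zero_mem [simp]: "0 \<in> \<O>" and \<chi>_zero [simp]: "\<chi> 0 = 0"
  and one_mem [simp]: "1 \<in> \<O>" and \<chi>_one [simp]: "\<chi> 1 = 1"
  using const_mem[of 0] \<chi>_const[of 0] const_mem[of 1] \<chi>_const[of 1] by simp_all

lemma uminus_mem: "x \<in> \<O> \<Longrightarrow> - x \<in> \<O>"
  and \<chi>_uminus: "x \<in> \<O> \<Longrightarrow> \<chi> (- x) = - \<chi> x"
  using mult_mem[OF const_mem[of "-1"], of x] \<chi>_mult[OF const_mem[of "-1"], of x] \<chi>_const[of "-1"]
  by (simp_all add: hom_uminus)

lemma diff_mem: "x \<in> \<O> \<Longrightarrow> y \<in> \<O> \<Longrightarrow> x - y \<in> \<O>"
  using add_mem[OF _ uminus_mem, of x y] by simp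

lemma sum_mem: "(\<And>i. i \<in> I \<Longrightarrow> f i \<in> \<O>) \<Longrightarrow> sum f I \<in> \<O>"
  by (induction I rule: infinite_finite_induct) (auto intro: add_mem)

lemma \<chi>_sum: "(\<And>i. i \<in> I \<Longrightarrow> f i \<in> \<O>) \<Longrightarrow> \<chi> (sum f I) = (\<Sum>i\<in>I. \<chi> (f i))"
  by (induction I rule: infinite_finite_induct) (auto simp: \<chi>_add sum_mem)

lemma prod_mem: "(\<And>i. i \<in> I \<Longrightarrow> f i \<in> \<O>) \<Longrightarrow> prod f I \<in> \<O>"
  by (induction I rule: infinite_finite_induct) (auto intro: mult_mem)

lemma \<chi>_prod: "(\<And>i. i \<in> I \<Longrightarrow> f i \<in> \<O>) \<Longrightarrow> \<chi> (prod f I) = (\<Prod>i\<in>I. \<chi> (f i))"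
  by (induction I rule: infinite_finite_induct) (auto simp: \<chi>_mult prod_mem)

lemma power_mem: "x \<in> \<O> \<Longrightarrow> x ^ n \<in> \<O>"
  by (induction n) (auto intro: mult_mem)

lemma inverse_mem_of_\<chi>: "x \<in> \<O> \<Longrightarrow> \<chi> x \<noteq> 0 \<Longrightarrow> inverse x \<in> \<O>"
  using inverse_mem[of x] \<chi>_inverse[of "inverse x"] by fastforce

text \<open>The order of the value group: the value of \<open>x\<close> is at most that of
  \<open>y\<close>, where 0 has value infinity.\<close>

definition divides_in :: "'a \<Rightarrow> 'a \<Rightarrow> bool" where
  "divides_in x y \<longleftrightarrow> (\<exists>z\<in>\<O>. y = x * z)"

lemma divides_in_refl: "divides_in x x"
  by (auto simp: divides_in_def intro!: bexI[of _ 1])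

lemma divides_in_trans: "divides_in x y \<Longrightarrow> divides_in y z \<Longrightarrow> divides_in x z"
  unfolding divides_in_def by (metis mult.assoc mult_mem)

lemma divides_in_total: "divides_in x y \<or> divides_in y x"
proof (cases "x = 0 \<or> y = 0")
  case True
  then show ?thesis by (auto simp: divides_in_def intro: bexI[of _ 0])
next
  case False
  then have "y = x * (y / x)" "x = y * inverse (y / x)" by simp_all
  then show ?thesis using inverse_mem[of "y / x"] unfolding divides_in_def by blast
qed

lemma ex_divides_in_all:
  "finite I \<Longrightarrow> I \<noteq> {} \<Longrightarrow> \<exists>i\<in>I. \<forall>j\<in>I. divides_in (f i) (f j)"
proof (induction I rule: finite_ne_induct)
  case (singleton x)
  then show ?case by (simp add: divides_in_refl)
next
  case (insert x F)
  then obtain i where i: "i \<in> F" "\<And>j. j \<in> F \<Longrightarrow> divides_in (f i) (f j)" by blast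
  show ?case
  proof (cases "divides_in (f i) (f x)")
    case True
    then show ?thesis using i by blast
  next
    case False
    then have "divides_in (f x) (f i)" using divides_in_total by blast
    then show ?thesis using i divides_in_trans divides_in_refl by blast
  qed
qed

end

section \<open>Multi-indices and multilinear forms\<close>

lemma indices_Nil [simp]: "indices [] = {[]}"
  by (auto simp: indices_def)

lemma Cons_mem_indices [simp]: "a # js \<in> indices (m # k) \<longleftrightarrow> a \<le> m \<and> js \<in> indices k"
  by (auto simp: indices_def nth_Cons split: nat.splits)

lemma indices_Cons: "indices (m # k) = (\<lambda>(a, js). a # js) ` ({..m} \<times> indices k)"
proof (rule equalityI; rule subsetI)
  fix i assume i: "i \<in> indices (m # k)"
  then obtain a js where "i = a # js" by (cases i) (auto simp: indices_def)
  with i show "i \<in> (\<lambda>(a, js). a # js) ` ({..m} \<times> indices k)" by auto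
qed auto

lemma indices_length: "i \<in> indices k \<Longrightarrow> length i = length k"
  and indices_nth: "i \<in> indices k \<Longrightarrow> j < length k \<Longrightarrow> i ! j \<le> k ! j"
  by (auto simp: indices_def)

lemma finite_indices [simp]: "finite (indices k)"
  by (induction k) (auto simp: indices_Cons)

lemma sum_indices_Cons:
  "(\<Sum>i\<in>indices (m # k). f i) = (\<Sum>a\<le>m. \<Sum>js\<in>indices k. f (a # js))"
  unfolding indices_Cons
  by (subst sum.reindex) (auto simp: inj_on_def sum.cartesian_product intro!: sum.cong)

lemma sum_indices_prod:
  fixes f :: "nat \<Rightarrow> nat \<Rightarrow> 'a::comm_semiring_1"
  shows "(\<Sum>i\<in>indices k. \<Prod>j<length k. f j (i ! j)) = (\<Prod>j<length k. \<Sum>r\<le>k ! j. f j r)"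
proof (induction k arbitrary: f)
  case (Cons m k)
  show ?case
    by (simp add: sum_indices_Cons prod.lessThan_Suc_shift sum_distrib_right
        del: prod.lessThan_Suc flip: sum_distrib_left)
       (simp add: Cons[of "\<lambda>j. f (Suc j)"])
qed simp

lemma indices_eq_iff:
  assumes "i \<in> indices k" "l \<in> indices k"
  shows "i = l \<longleftrightarrow> (\<forall>j<length k. i ! j = l ! j)"
  using assms by (auto simp: indices_def list_eq_iff_nth_eq)

text \<open>\<open>multiact\<close> is the simultaneous action of matrices over an arbitrary ring, of which
  \<open>act\<close> and the change of bases in \<open>triangulable\<close> are instances.\<close>

definition multiact :: "nat list \<Rightarrow> (nat \<Rightarrow> 'a::comm_ring_1 mat) \<Rightarrow> (nat list \<Rightarrow> 'a) \<Rightarrow> nat list \<Rightarrow> 'a" where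
  "multiact k g A i = (if i \<in> indices k
     then \<Sum>l\<in>indices k. (\<Prod>j<length k. g j $$ (i ! j, l ! j)) * A l else 0)"

definition format_mats :: "nat list \<Rightarrow> (nat \<Rightarrow> 'a mat) \<Rightarrow> bool" where
  "format_mats k g \<longleftrightarrow> (\<forall>j<length k. g j \<in> carrier_mat (k ! j + 1) (k ! j + 1))"

lemma format_mats_times:
  "format_mats k g \<Longrightarrow> format_mats k h \<Longrightarrow> format_mats k (\<lambda>j. g j * h j)"
  by (auto simp: format_mats_def)

lemma mat_times_index:
  assumes "g \<in> carrier_mat (n + 1) (n + 1)" "h \<in> carrier_mat (n + 1) (n + 1)" "a \<le> n" "b \<le> n"
  shows "(g * h) $$ (a, b) = (\<Sum>c\<le>n. g $$ (a, c) * h $$ (c, b))"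
  using assms by (simp add: scalar_prod_def atLeast0LessThan lessThan_Suc_atMost del: sum.op_ivl_Suc)

lemma multiact_multiact:
  assumes "format_mats k g" "format_mats k h"
  shows "multiact k g (multiact k h A) = multiact k (\<lambda>j. g j * h j) A"
proof
  fix i
  show "multiact k g (multiact k h A) i = multiact k (\<lambda>j. g j * h j) A i"
  proof (cases "i \<in> indices k")
    case True
    have *: "(\<Sum>l\<in>indices k. (\<Prod>j<length k. g j $$ (i ! j, l ! j)) * (\<Prod>j<length k. h j $$ (l ! j, q ! j))) =
      (\<Prod>j<length k. (g j * h j) $$ (i ! j, q ! j))" if "q \<in> indices k" for q
    proof -
      have "(\<Sum>l\<in>indices k. (\<Prod>j<length k. g j $$ (i ! j, l ! j)) * (\<Prod>j<length k. h j $$ (l ! j, q ! j))) =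
        (\<Prod>j<length k. \<Sum>r\<le>k ! j. g j $$ (i ! j, r) * h j $$ (r, q ! j))"
        by (simp add: sum_indices_prod[symmetric] prod.distrib)
      also have "\<dots> = (\<Prod>j<length k. (g j * h j) $$ (i ! j, q ! j))"
        by (intro prod.cong refl mat_times_index[symmetric])
           (use assms True that in \<open>auto simp: format_mats_def indices_nth\<close>)
      finally show ?thesis .
    qed
    have "multiact k g (multiact k h A) i =
      (\<Sum>l\<in>indices k. \<Sum>q\<in>indices k. (\<Prod>j<length k. g j $$ (i ! j, l ! j)) * (\<Prod>j<length k. h j $$ (l ! j, q ! j)) * A q)"
      using True by (auto simp: multiact_def sum_distrib_left mult.assoc intro!: sum.cong)
    also have "\<dots> = (\<Sum>q\<in>indices k. (\<Sum>l\<in>indices k. (\<Prod>j<length k. g j $$ (i ! j, l ! j)) * (\<Prod>j<length k. h j $$ (l ! j, q ! j))) * A q)"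
      by (subst sum.swap) (simp add: sum_distrib_right)
    also have "\<dots> = multiact k (\<lambda>j. g j * h j) A i"
      using True by (simp add: multiact_def *)
    finally show ?thesis .
  qed (simp add: multiact_def)
qed

lemma multiact_diagonal:
  fixes d :: "nat \<Rightarrow> nat \<Rightarrow> 'a::comm_ring_1"
  assumes g: "\<And>j a b. j < length k \<Longrightarrow> a \<le> k ! j \<Longrightarrow> b \<le> k ! j \<Longrightarrow> g j $$ (a, b) = (if a = b then d j a else 0)"
    and i: "i \<in> indices k"
  shows "multiact k g A i = (\<Prod>j<length k. d j (i ! j)) * A i"
proof -
  have "(\<Prod>j<length k. g j $$ (i ! j, l ! j)) = (if l = i then (\<Prod>j<length k. d j (i ! j)) else 0)"
    if l: "l \<in> indices k" for l
  proof (cases "l = i")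
    case True
    then show ?thesis using i g by (auto intro!: prod.cong simp: indices_nth)
  next
    case False
    then obtain j where "j < length k" "l ! j \<noteq> i ! j" using indices_eq_iff[OF l i] by blast
    then show ?thesis using False i l g by (auto intro!: prod_zero simp: indices_nth intro!: bexI[of _ j])
  qed
  then have "multiact k g A i = (\<Sum>l\<in>indices k. (if l = i then (\<Prod>j<length k. d j (i ! j)) else 0) * A l)"
    using i by (simp add: multiact_def)
  also have "\<dots> = (\<Sum>l\<in>indices k. if l = i then (\<Prod>j<length k. d j (i ! j)) * A l else 0)"
    by (intro sum.cong) auto
  finally have "multiact k g A i = (\<Sum>l\<in>indices k. if l = i then (\<Prod>j<length k. d j (i ! j)) * A l else 0)" .
  then show ?thesis using i by (simp add: sum.delta)
qed

lemma multiact_one_index: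
  assumes "\<And>j. j < length k \<Longrightarrow> g j = 1\<^sub>m (k ! j + 1)" and "i \<in> indices k"
  shows "multiact k g A i = A i"
proof -
  have "multiact k g A i = (\<Prod>j<length k. 1) * A i"
    by (rule multiact_diagonal[OF _ assms(2)]) (auto simp: assms(1))
  then show ?thesis by simp
qed

lemma multiact_cong:
  assumes "\<And>j. j < length k \<Longrightarrow> g j = h j" "\<And>i. i \<in> indices k \<Longrightarrow> A i = B i"
  shows "multiact k g A = multiact k h B"
  using assms by (auto simp: multiact_def fun_eq_iff intro!: sum.cong prod.cong arg_cong2[where f="(*)"])

lemma multiact_one:
  assumes g: "\<And>j. j < length k \<Longrightarrow> g j = 1\<^sub>m (k ! j + 1)" and A: "\<And>i. i \<notin> indices k \<Longrightarrow> A i = 0"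
  shows "multiact k g A = A"
proof
  fix i
  show "multiact k g A i = A i"
    using multiact_one_index[of k g i A] g A by (cases "i \<in> indices k") (auto simp: multiact_def)
qed

lemma act_eq_multiact: "act k g A = multiact k (\<lambda>j. g ! j) A"
  by (auto simp: act_def multiact_def fun_eq_iff)

section \<open>Common zeros of multilinear forms by deformation and specialisation\<close>

definition multilinear :: "nat list \<Rightarrow> (nat list \<Rightarrow> 'a::comm_ring_1) \<Rightarrow> (nat \<Rightarrow> nat \<Rightarrow> 'a) \<Rightarrow> 'a" where
  "multilinear s c x = (\<Sum>i\<in>indices s. c i * (\<Prod>t<length s. x t (i ! t)))"

lemma (in comm_ring_hom) hom_multilinear:
  "hom (multilinear s c x) = multilinear s (\<lambda>i. hom (c i)) (\<lambda>t r. hom (x t r))"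
  by (simp add: multilinear_def hom_distribs)

lemma multilinear_scale:
  assumes "\<And>t r. t < length s \<Longrightarrow> r \<le> s ! t \<Longrightarrow> x t r = a t * y t r"
  shows "multilinear s c x = (\<Prod>t<length s. a t) * multilinear s c y"
proof -
  have "(\<Prod>t<length s. x t (i ! t)) = (\<Prod>t<length s. a t) * (\<Prod>t<length s. y t (i ! t))" if "i \<in> indices s" for i
    unfolding prod.distrib[symmetric] using that assms by (intro prod.cong) (auto simp: indices_nth)
  then show ?thesis unfolding multilinear_def sum_distrib_left
    by (intro sum.cong) (auto simp: algebra_simps)
qed

text \<open>Congruence modulo \<open>fps_X ^ n\<close>.\<close>

definition fps_cong :: "nat \<Rightarrow> complex fps \<Rightarrow> complex fps \<Rightarrow> bool" where
  "fps_cong n f g \<longleftrightarrow> (\<forall>m<n. fps_nth f m = fps_nth g m)"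

lemma fps_cong_refl: "fps_cong n f f"
  by (simp add: fps_cong_def)

lemma fps_cong_mult: "fps_cong n f f' \<Longrightarrow> fps_cong n g g' \<Longrightarrow> fps_cong n (f * g) (f' * g')"
  by (auto simp: fps_cong_def fps_mult_nth intro!: sum.cong)

lemma fps_cong_prod: "(\<And>i. i \<in> I \<Longrightarrow> fps_cong n (f i) (g i)) \<Longrightarrow> fps_cong n (prod f I) (prod g I)"
  by (induction I rule: infinite_finite_induct) (auto intro: fps_cong_mult fps_cong_refl)

lemma fps_cong_multilinear:
  assumes "\<And>t r. fps_cong n (x t r) (y t r)"
  shows "fps_cong n (multilinear s c x) (multilinear s c y)"
proof -
  have "fps_cong n (c i * (\<Prod>t<length s. x t (i ! t))) (c i * (\<Prod>t<length s. y t (i ! t)))" for i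
    by (intro fps_cong_mult fps_cong_refl fps_cong_prod assms)
  then show ?thesis unfolding multilinear_def by (auto simp: fps_cong_def fps_sum_nth)
qed

text \<open>The factor \<open>fps_X\<close> makes the right-hand side a contraction in the X-adic
  topology: each application fixes one more coefficient.\<close>

lemma fps_multilinear_fixed_point:
  fixes c :: "nat \<times> nat \<Rightarrow> nat list \<Rightarrow> complex fps"
  shows "\<exists>x. \<forall>t r. x t r = (if r = 0 then 1 else - fps_X * multilinear s (c (t, r)) x)"
proof -
  define F where "F x t r = (if r = 0 then 1 else - fps_X * multilinear s (c (t, r)) x)"
    for x :: "nat \<Rightarrow> nat \<Rightarrow> complex fps" and t r :: nat
  have F: "fps_cong (Suc n) (F x t r) (F y t r)" if "\<And>t r. fps_cong n (x t r) (y t r)" for n x y t r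
    using fps_cong_multilinear[where s=s and c = "c (t, r)", OF that]
    by (auto simp: F_def fps_cong_def less_Suc_eq_0_disj)
  define X where "X n = (F ^^ n) (\<lambda>_ _. 0)" for n
  have step: "fps_cong n (X n t r) (X (Suc n) t r)" for n t r
  proof (induction n arbitrary: t r)
    case 0
    then show ?case by (simp add: fps_cong_def)
  next
    case (Suc n)
    then show ?case using F[of n "X n" "X (Suc n)"] by (simp add: X_def)
  qed
  have mono: "fps_cong n (X n t r) (X (n + d) t r)" for n d t r
  proof (induction d)
    case (Suc d)
    then show ?case using step[of "n + d" t r] by (auto simp: fps_cong_def)
  qed (simp add: fps_cong_refl)
  \<comment> \<open>Coefficient \<open>m\<close> is stable from iterate \<open>m + 1\<close> on, so
    the limit is read off along the diagonal.\<close>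
  define x where "x t r = Abs_fps (\<lambda>m. fps_nth (X (Suc m) t r) m)" for t r
  have x: "fps_cong n (x t r) (X n t r)" for n t r
    unfolding fps_cong_def
  proof (intro allI impI)
    fix m assume "m < n"
    then show "fps_nth (x t r) m = fps_nth (X n t r) m"
      using mono[of "Suc m" t r "n - Suc m"] by (simp add: x_def fps_cong_def)
  qed
  have "x t r = F x t r" for t r
  proof (rule fps_ext)
    fix m
    have "fps_cong (Suc (Suc m)) (F x t r) (X (Suc (Suc m)) t r)"
      using F[where n = "Suc m" and x = x and y = "X (Suc m)" and t = t and r = r, OF x] by (simp add: X_def)
    then show "fps_nth (x t r) m = fps_nth (F x t r) m"
      using x[of "Suc (Suc m)" t r] by (simp add: fps_cong_def)
  qed
  then show ?thesis unfolding F_def by blast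
qed

lemma field_hom_fls_const: "field_hom (fls_const :: complex \<Rightarrow> complex fls)"
  by unfold_locales (simp_all add: fls_plus_const)

lemma comm_ring_hom_fps_to_fls: "comm_ring_hom (fps_to_fls :: complex fps \<Rightarrow> complex fls)"
  by unfold_locales (simp_all add: fls_times_fps_to_fls)

lemma card_pairs: "card (SIGMA t:{..<length s}. {1..s ! t}) = sum_list (s :: nat list)"
  by (simp add: sum_list_sum_nth atLeast0LessThan)

text \<open>
  The intersection of \<open>sum_list s\<close> hypersurfaces of multidegree \<open>(1, \<dots>, 1)\<close> in a product of
  projective spaces of dimensions \<open>s\<close> is nonempty: the system \<open>v\<^sub>t\<^sub>,\<^sub>r \<Prod>\<^sub>u\<^sub>\<noteq>\<^sub>t v\<^sub>u\<^sub>,\<^sub>0 + \<epsilon> f\<^sub>t\<^sub>,\<^sub>r(v) = 0\<close>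
  has a formal solution near the solution \<open>e\<^sub>0 \<otimes> \<dots> \<otimes> e\<^sub>0\<close> for \<open>\<epsilon> = 0\<close>, which is
  specialised at \<open>\<epsilon> = \<infinity>\<close>.
\<close>

theorem multilinear_common_zero:
  fixes s :: "nat list" and c :: "'e \<Rightarrow> nat list \<Rightarrow> complex"
  assumes E: "finite E" "card E \<le> sum_list s"
  shows "\<exists>v. (\<forall>t<length s. \<exists>r\<le>s ! t. v t r \<noteq> 0) \<and> (\<forall>e\<in>E. multilinear s (c e) v = 0)"
proof -
  define P where "P = (SIGMA t:{..<length s}. {1..s ! t})"
  have "card E \<le> card P" using E(2) by (simp only: P_def card_pairs)
  moreover have "finite P" by (simp add: P_def)
  ultimately obtain h where h: "h ` E \<subseteq> P" "inj_on h E" using card_le_inj[OF E(1)] by blast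
  \<comment> \<open>Each form is attached to its own coordinate \<open>(t, r)\<close> with
    \<open>r > 0\<close>; coordinates missed by \<open>h\<close> get an arbitrary form, which only
    adds equations.\<close>
  define c' where "c' q = c (inv_into E h q)" for q
  obtain x where x: "\<And>t r. x t r = (if r = 0 then 1 else - fps_X * multilinear s (\<lambda>i. fps_const (c' (t, r) i)) x)"
    using fps_multilinear_fixed_point[of s "\<lambda>q i. fps_const (c' q i)"] by blast
  interpret fps: comm_ring_hom "fps_to_fls :: complex fps \<Rightarrow> complex fls" by (rule comm_ring_hom_fps_to_fls)
  interpret \<iota>: field_hom "fls_const :: complex \<Rightarrow> complex fls" by (rule field_hom_fls_const)
  define y where "y t r = fps_to_fls (x t r)" for t r
  have y0: "y t 0 = 1" for t by (simp add: y_def x[of t 0])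
  have y: "y t r = - fls_X * multilinear s (\<lambda>i. fls_const (c' (t, r) i)) y" if "r \<noteq> 0" for t r
    using that unfolding y_def by (subst x) (simp add: fps.hom_mult fps.hom_multilinear)
  have "fls_X \<noteq> fls_const a" for a :: complex
  proof
    assume "fls_X = fls_const a"
    then have "fls_nth fls_X 1 = fls_nth (fls_const a) 1" by simp
    then show False by simp
  qed
  then have "fls_X \<notin> range (fls_const :: complex \<Rightarrow> complex fls)" by blast
  then obtain \<O> \<chi> where "place fls_const \<O> \<chi>" and X: "(fls_X :: complex fls) \<notin> \<O>"
    using place_avoiding[OF field_hom_fls_const] by blast
  then interpret place "fls_const :: complex \<Rightarrow> complex fls" \<O> \<chi> by simp
  \<comment> \<open>This is the inverse of the deformation parameter \<open>fls_X\<close>, which the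
    preceding text calls \<epsilon>; residue 0 here puts that parameter at infinity.\<close>
  define \<epsilon> where "\<epsilon> = inverse (fls_X :: complex fls)"
  have \<epsilon>: "\<epsilon> \<in> \<O>" "\<chi> \<epsilon> = 0" using inverse_mem[OF X] \<chi>_inverse[OF X] by (simp_all add: \<epsilon>_def)
  have y': "multilinear s (\<lambda>i. fls_const (c' (t, r) i)) y = - \<epsilon> * y t r" if "r \<noteq> 0" for t r
    using y[OF that, of t] by (simp add: \<epsilon>_def)
  have "\<exists>\<rho>\<in>{..s ! t}. \<forall>r\<in>{..s ! t}. divides_in (y t \<rho>) (y t r)" for t
    by (rule ex_divides_in_all) auto
  then obtain \<rho> where \<rho>: "\<And>t. \<rho> t \<le> s ! t" "\<And>t r. r \<le> s ! t \<Longrightarrow> divides_in (y t (\<rho> t)) (y t r)"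
    by (metis atMost_iff)
  have nz: "y t (\<rho> t) \<noteq> 0" for t using \<rho>(2)[of 0 t] y0[of t] by (auto simp: divides_in_def)
  \<comment> \<open>Homogeneous coordinates divided by one of least value are integral, and one of
    them is 1, so the residue point is nonzero in every factor.\<close>
  define u where "u t r = y t r / y t (\<rho> t)" for t r
  have u: "u t r \<in> \<O>" "y t r = y t (\<rho> t) * u t r" if "r \<le> s ! t" for t r
    using \<rho>(2)[OF that] nz[of t] by (auto simp: divides_in_def u_def)
  have u\<rho>: "u t (\<rho> t) = 1" for t using u(2)[OF \<rho>(1)[of t]] nz[of t] by simp
  define v where "v t r = \<chi> (u t r)" for t r
  have zero: "multilinear s (c' (t, r)) v = 0" if tr: "(t, r) \<in> P" for t r
  proof -
    let ?c = "\<lambda>i. fls_const (c' (t, r) i)"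
    have t: "t < length s" and r: "r \<noteq> 0" "r \<le> s ! t" using tr by (auto simp: P_def)
    \<comment> \<open>Since \<open>y t 0 = 1\<close>, rescaling by the factors
      \<open>y t (\<rho> t)\<close> is undone by the coordinates \<open>u t 0\<close>. The equation
      becomes homogeneous, its right-hand side being \<epsilon> times an integral element.\<close>
    have 1: "(\<Prod>t<length s. u t 0) * (\<Prod>t<length s. y t (\<rho> t)) = 1"
      using u(2)[of 0] y0 by (simp add: prod.distrib[symmetric] mult.commute)
    have "multilinear s ?c u = (\<Prod>t<length s. u t 0) * ((\<Prod>t<length s. y t (\<rho> t)) * multilinear s ?c u)"
      using 1 by (simp add: mult.assoc[symmetric])
    also have "(\<Prod>t<length s. y t (\<rho> t)) * multilinear s ?c u = multilinear s ?c y"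
      by (rule multilinear_scale[symmetric]) (use u in auto)
    also have "\<dots> = - \<epsilon> * y t r" by (rule y'[OF r(1)])
    also have "(\<Prod>t<length s. u t 0) = u t 0 * (\<Prod>t\<in>{..<length s} - {t}. u t 0)"
      using t by (simp add: prod.remove)
    also have "\<dots> * (- \<epsilon> * y t r) = (u t 0 * y t (\<rho> t)) * (\<epsilon> * (- ((\<Prod>t\<in>{..<length s} - {t}. u t 0) * u t r)))"
      using u(2)[OF r(2)] by simp
    also have "u t 0 * y t (\<rho> t) = 1" using u(2)[of 0 t] y0[of t] by (simp add: mult.commute)
    finally have eq: "multilinear s ?c u = \<epsilon> * (- ((\<Prod>t\<in>{..<length s} - {t}. u t 0) * u t r))" by simp
    have "- ((\<Prod>t\<in>{..<length s} - {t}. u t 0) * u t r) \<in> \<O>"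
      by (intro uminus_mem mult_mem prod_mem u) (use r in auto)
    then have "\<chi> (multilinear s ?c u) = 0" unfolding eq by (subst \<chi>_mult) (simp_all add: \<epsilon>)
    moreover have mem: "u t (i ! t) \<in> \<O>" if "i \<in> indices s" "t < length s" for i t
      using that u(1) by (auto simp: indices_nth)
    have "\<chi> (multilinear s ?c u) = multilinear s (c' (t, r)) v"
      unfolding multilinear_def v_def
      by (subst \<chi>_sum, intro mult_mem const_mem prod_mem, force intro: mem, rule sum.cong[OF refl],
          subst \<chi>_mult, rule const_mem, intro prod_mem, force intro: mem,
          subst \<chi>_prod, force intro: mem, simp add: \<chi>_const)
    ultimately show ?thesis by simp
  qed
  show ?thesis
  proof (intro exI[of _ v] conjI allI impI ballI)
    fix t assume "t < length s"
    show "\<exists>r\<le>s ! t. v t r \<noteq> 0"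
      using \<rho>(1)[of t] by (intro exI[of _ "\<rho> t"]) (simp add: v_def u\<rho>)
  next
    fix e assume e: "e \<in> E"
    then have "c' (h e) = c e" using h(2) by (simp add: c'_def)
    then show "multilinear s (c e) v = 0" using zero[of "fst (h e)" "snd (h e)"] e h(1) by auto
  qed
qed

section \<open>Diagonalisation over a valuation ring\<close>

definition diagonal :: "nat \<Rightarrow> (nat \<Rightarrow> 'a::zero) \<Rightarrow> 'a mat" where
  "diagonal n d = mat n n (\<lambda>(i, j). if i = j then d i else 0)"

lemma diagonal_carrier [simp]: "diagonal n d \<in> carrier_mat n n"
  and diagonal_index: "i < n \<Longrightarrow> j < n \<Longrightarrow> diagonal n d $$ (i, j) = (if i = j then d i else 0)"
  by (simp_all add: diagonal_def)

lemma det_diagonal: "det (diagonal n d) = (\<Prod>i<n. d i :: 'a::comm_ring_1)"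
proof -
  have "upper_triangular (diagonal n d)" by (auto simp: diagonal_def)
  then have "det (diagonal n d) = prod_list (diag_mat (diagonal n d))"
    by (rule det_upper_triangular[OF _ diagonal_carrier])
  also have "diag_mat (diagonal n d) = map d [0..<n]"
    by (auto simp: diag_mat_def diagonal_def intro!: map_cong)
  also have "prod_list (map d [0..<n]) = (\<Prod>i<n. d i)"
    by (simp add: prod.distinct_set_conv_list[symmetric] atLeast0LessThan)
  finally show ?thesis .
qed

context place
begin

definition integral_mats :: "nat \<Rightarrow> nat \<Rightarrow> 'a mat set" where
  "integral_mats m n = {M \<in> carrier_mat m n. \<forall>i<m. \<forall>j<n. M $$ (i, j) \<in> \<O>}"

lemma integral_mats_carrier: "M \<in> integral_mats m n \<Longrightarrow> M \<in> carrier_mat m n"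
  by (simp add: integral_mats_def)

lemma integral_mats_index: "M \<in> integral_mats m n \<Longrightarrow> i < m \<Longrightarrow> j < n \<Longrightarrow> M $$ (i, j) \<in> \<O>"
  by (simp add: integral_mats_def)

lemma integral_mats_times:
  "A \<in> integral_mats m n \<Longrightarrow> B \<in> integral_mats n l \<Longrightarrow> A * B \<in> integral_mats m l"
  by (auto simp: integral_mats_def scalar_prod_def intro!: sum_mem mult_mem)

lemma integral_mats_uminus: "A \<in> integral_mats m n \<Longrightarrow> - A \<in> integral_mats m n"
  by (auto simp: integral_mats_def intro!: uminus_mem)

lemma integral_mats_one [simp]: "1\<^sub>m n \<in> integral_mats n n"
  and integral_mats_zero [simp]: "0\<^sub>m m n \<in> integral_mats m n"
  by (auto simp: integral_mats_def)

lemma integral_mats_four_block: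
  "A \<in> integral_mats m n \<Longrightarrow> B \<in> integral_mats m q \<Longrightarrow> C \<in> integral_mats p n \<Longrightarrow> D \<in> integral_mats p q \<Longrightarrow>
    four_block_mat A B C D \<in> integral_mats (m + p) (n + q)"
  by (auto simp: integral_mats_def)

definition integral_GL :: "nat \<Rightarrow> 'a mat set" where
  "integral_GL n = {U \<in> integral_mats n n. \<exists>U'\<in>integral_mats n n. U * U' = 1\<^sub>m n \<and> U' * U = 1\<^sub>m n}"

lemma integral_GL_integral: "U \<in> integral_GL n \<Longrightarrow> U \<in> integral_mats n n"
  and integral_GL_carrier: "U \<in> integral_GL n \<Longrightarrow> U \<in> carrier_mat n n"
  by (auto simp: integral_GL_def integral_mats_def)

lemma integral_GL_one [simp]: "1\<^sub>m n \<in> integral_GL n"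
  by (auto simp: integral_GL_def intro!: bexI[of _ "1\<^sub>m n"])

lemma integral_GL_times:
  assumes "U \<in> integral_GL n" "V \<in> integral_GL n"
  shows "U * V \<in> integral_GL n"
proof -
  obtain U' V' where U: "U \<in> integral_mats n n" "U' \<in> integral_mats n n" "U * U' = 1\<^sub>m n" "U' * U = 1\<^sub>m n"
    and V: "V \<in> integral_mats n n" "V' \<in> integral_mats n n" "V * V' = 1\<^sub>m n" "V' * V = 1\<^sub>m n"
    using assms unfolding integral_GL_def by blast
  note c = U(1,2)[THEN integral_mats_carrier] V(1,2)[THEN integral_mats_carrier]
  have "(U * V) * (V' * U') = U * (V * V') * U'" "(V' * U') * (U * V) = V' * (U' * U) * V"
    using c by (simp_all add: assoc_mult_mat[of _ n n _ n _ n])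
  then have "(U * V) * (V' * U') = 1\<^sub>m n" "(V' * U') * (U * V) = 1\<^sub>m n"
    using c U V by simp_all
  then show ?thesis using U V unfolding integral_GL_def
    by (auto intro!: integral_mats_times bexI[of _ "V' * U'"])
qed

lemma integral_GL_swap:
  assumes "a < n" "b < n"
  shows "swaprows_mat n a b \<in> integral_GL n"
proof -
  have "swaprows_mat n a b \<in> integral_mats n n" using assms by (auto simp: integral_mats_def)
  then show ?thesis using swaprows_mat_inv[OF assms] unfolding integral_GL_def by blast
qed

lemma uminus_zero_mat: "- (0\<^sub>m m n :: 'a mat) = 0\<^sub>m m n"
  by (rule eq_matI) auto

lemma integral_GL_four_block_lower:
  assumes c: "c \<in> integral_mats n 1" and U: "U \<in> integral_GL n"
  shows "four_block_mat (1\<^sub>m 1) (0\<^sub>m 1 n) c U \<in> integral_GL (1 + n)"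
proof -
  obtain U' where U': "U \<in> integral_mats n n" "U' \<in> integral_mats n n" "U * U' = 1\<^sub>m n" "U' * U = 1\<^sub>m n"
    using U unfolding integral_GL_def by blast
  let ?V = "four_block_mat (1\<^sub>m 1) (0\<^sub>m 1 n) (- (U' * c)) U'"
  note cc = c[THEN integral_mats_carrier] U'(1,2)[THEN integral_mats_carrier]
  have *: "- (U' * c) + U' * c = 0\<^sub>m n 1" "c + - c = 0\<^sub>m n 1" "U * (U' * c) = c"
    using cc U'(3) by (auto simp: assoc_mult_mat[of U n n U' n c 1, symmetric])
  have "four_block_mat (1\<^sub>m 1) (0\<^sub>m 1 n) c U * ?V = 1\<^sub>m (1 + n)"
    "?V * four_block_mat (1\<^sub>m 1) (0\<^sub>m 1 n) c U = 1\<^sub>m (1 + n)"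
    using cc U'(3,4)
    by (simp_all del: One_nat_def add: mult_four_block_mat[of _ 1 1 _ n _ n _ _ 1 _ n] * uminus_zero_mat)
  moreover have "?V \<in> integral_mats (1 + n) (1 + n)"
    by (intro integral_mats_four_block integral_mats_uminus integral_mats_times[OF U'(2) c] U') simp_all
  moreover have "four_block_mat (1\<^sub>m 1) (0\<^sub>m 1 n) c U \<in> integral_mats (1 + n) (1 + n)"
    by (intro integral_mats_four_block U' c) simp_all
  ultimately show ?thesis unfolding integral_GL_def by blast
qed

lemma integral_GL_four_block_upper:
  assumes c: "c \<in> integral_mats 1 n" and U: "U \<in> integral_GL n"
  shows "four_block_mat (1\<^sub>m 1) c (0\<^sub>m n 1) U \<in> integral_GL (1 + n)"
proof -
  obtain U' where U': "U \<in> integral_mats n n" "U' \<in> integral_mats n n" "U * U' = 1\<^sub>m n" "U' * U = 1\<^sub>m n"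
    using U unfolding integral_GL_def by blast
  let ?V = "four_block_mat (1\<^sub>m 1) (- (c * U')) (0\<^sub>m n 1) U'"
  note cc = c[THEN integral_mats_carrier] U'(1,2)[THEN integral_mats_carrier]
  have *: "- (c * U') + c * U' = 0\<^sub>m 1 n" "c + - c = 0\<^sub>m 1 n" "c * U' * U = c"
    using cc U'(4) by (auto simp: assoc_mult_mat[of c 1 n U' n U n])
  have "four_block_mat (1\<^sub>m 1) c (0\<^sub>m n 1) U * ?V = 1\<^sub>m (1 + n)"
    "?V * four_block_mat (1\<^sub>m 1) c (0\<^sub>m n 1) U = 1\<^sub>m (1 + n)"
    using cc U'(3,4)
    by (simp_all del: One_nat_def add: mult_four_block_mat[of _ 1 1 _ n _ n _ _ 1 _ n] * uminus_zero_mat)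
  moreover have "?V \<in> integral_mats (1 + n) (1 + n)"
    by (intro integral_mats_four_block integral_mats_uminus integral_mats_times[OF c U'(2)] U') simp_all
  moreover have "four_block_mat (1\<^sub>m 1) c (0\<^sub>m n 1) U \<in> integral_mats (1 + n) (1 + n)"
    by (intro integral_mats_four_block U' c) simp_all
  ultimately show ?thesis unfolding integral_GL_def by blast
qed

lemma divides_in_diff_mult:
  assumes "divides_in c x" "divides_in c y" "z \<in> \<O>"
  shows "divides_in c (x - y * z)"
proof -
  obtain a b where "x = c * a" "y = c * b" "a \<in> \<O>" "b \<in> \<O>" using assms by (auto simp: divides_in_def)
  then show ?thesis using assms(3) unfolding divides_in_def
    by (intro bexI[of _ "a - b * z"] diff_mem mult_mem) (simp_all add: algebra_simps)
qed

definition smith_form :: "nat \<Rightarrow> 'a mat \<Rightarrow> 'a mat \<Rightarrow> (nat \<Rightarrow> 'a) \<Rightarrow> 'a mat \<Rightarrow> bool" where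
  "smith_form n M U d V \<longleftrightarrow> U \<in> integral_GL n \<and> V \<in> integral_GL n \<and> M = U * diagonal n d * V \<and>
     (\<forall>i j. i \<le> j \<longrightarrow> j < n \<longrightarrow> divides_in (d i) (d j))"

text \<open>Gaussian elimination with a pivot of least value, which divides every other entry. The
  clause on common divisors \<open>c\<close> is the induction invariant that puts the pivot before
  the remaining \<open>d i\<close> in the divisibility chain.\<close>

lemma smith_form_exists:
  assumes "M \<in> carrier_mat n n"
  shows "\<exists>U d V. smith_form n M U d V \<and>
    (\<forall>c. (\<forall>i<n. \<forall>j<n. divides_in c (M $$ (i, j))) \<longrightarrow> (\<forall>i<n. divides_in c (d i)))"
  using assms
proof (induction n arbitrary: M)
  case 0
  show ?case
    by (intro exI[of _ "1\<^sub>m 0"] exI[of _ "\<lambda>_. 0"]) (use 0 in \<open>auto simp: smith_form_def\<close>)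
next
  case (Suc n)
  let ?N = "Suc n"
  have "\<exists>p\<in>{..<?N} \<times> {..<?N}. \<forall>q\<in>{..<?N} \<times> {..<?N}. divides_in (M $$ p) (M $$ q)"
    by (rule ex_divides_in_all) auto
  then obtain a b where ab: "a < ?N" "b < ?N"
    and div: "\<And>i j. i < ?N \<Longrightarrow> j < ?N \<Longrightarrow> divides_in (M $$ (a, b)) (M $$ (i, j))"
    by blast
  define P :: "'a mat" where "P = swaprows_mat ?N a 0"
  define Q :: "'a mat" where "Q = swaprows_mat ?N b 0"
  have PQ: "P \<in> integral_GL ?N" "Q \<in> integral_GL ?N" "P * P = 1\<^sub>m ?N" "Q * Q = 1\<^sub>m ?N"
    unfolding P_def Q_def using ab by (auto intro!: integral_GL_swap swaprows_mat_inv)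
  note PQc = PQ(1,2)[THEN integral_GL_carrier]
  define M' where "M' = P * M * Q"
  have M'c: "M' \<in> carrier_mat ?N ?N" using PQc Suc.prems by (simp add: M'_def)
  have M': "M' = swapcols b 0 (swaprows a 0 M)"
    using Suc.prems ab unfolding M'_def P_def Q_def
    by (simp add: swaprows_mat[of M ?N ?N a 0] swapcols_mat[of "swaprows_mat ?N a 0 * M" ?N ?N b 0]
        mult_carrier_mat[of _ ?N ?N _ ?N])
  have M'_index: "M' $$ (i, j) = M $$ (if i = a then 0 else if i = 0 then a else i, if j = b then 0 else if j = 0 then b else j)"
    if "i < ?N" "j < ?N" for i j
    using that ab Suc.prems unfolding M' by auto
  define m where "m = M $$ (a, b)"
  have m: "M' $$ (0, 0) = m" using M'_index[of 0 0] by (auto simp: m_def)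
  have div': "divides_in m (M' $$ (i, j))" if "i < ?N" "j < ?N" for i j
    unfolding m_def M'_index[OF that] using that ab by (intro div) auto
  have M_eq: "M = P * M' * Q"
  proof -
    have "P * M' * Q = (P * P) * M * (Q * Q)"
      using PQc Suc.prems unfolding M'_def by (simp add: assoc_mult_mat[of _ ?N ?N _ ?N _ ?N])
    then show ?thesis using PQ Suc.prems by simp
  qed
  have "\<forall>i j. \<exists>z. i < ?N \<longrightarrow> j < ?N \<longrightarrow> z \<in> \<O> \<and> M' $$ (i, j) = m * z"
    using div' unfolding divides_in_def by blast
  then obtain z where z: "\<And>i j. i < ?N \<Longrightarrow> j < ?N \<Longrightarrow> z i j \<in> \<O>"
    "\<And>i j. i < ?N \<Longrightarrow> j < ?N \<Longrightarrow> M' $$ (i, j) = m * z i j"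
    by metis
  define c where "c = mat n 1 (\<lambda>(i, _). z (Suc i) 0)"
  define r where "r = mat 1 n (\<lambda>(_, j). z 0 (Suc j))"
  define m1 where "m1 = mat 1 1 (\<lambda>_. m)"
  \<comment> \<open>The Schur complement of the pivot. It is written with the chosen quotients
    \<open>z\<close> rather than by division, since \<open>m\<close> may be 0.\<close>
  define X where "X = mat n n (\<lambda>(i, j). M' $$ (Suc i, Suc j) - m * z (Suc i) 0 * z 0 (Suc j))"
  have Xc: "X \<in> carrier_mat n n" by (simp add: X_def)
  from Suc.IH[OF Xc] obtain U d V where UdV: "smith_form n X U d V"
    and min: "\<And>e i. (\<And>i j. i < n \<Longrightarrow> j < n \<Longrightarrow> divides_in e (X $$ (i, j))) \<Longrightarrow> i < n \<Longrightarrow> divides_in e (d i)"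
    by blast
  then have U: "U \<in> integral_GL n" and V: "V \<in> integral_GL n" and X: "X = U * diagonal n d * V"
    and chain: "\<And>i j. i \<le> j \<Longrightarrow> j < n \<Longrightarrow> divides_in (d i) (d j)"
    by (auto simp: smith_form_def)
  have cint: "c \<in> integral_mats n 1" and rint: "r \<in> integral_mats 1 n"
    by (auto simp: c_def r_def integral_mats_def z)
  define U1 where "U1 = four_block_mat (1\<^sub>m 1) (0\<^sub>m 1 n) c U"
  define V1 where "V1 = four_block_mat (1\<^sub>m 1) r (0\<^sub>m n 1) V"
  define d1 where "d1 i = (case i of 0 \<Rightarrow> m | Suc i \<Rightarrow> d i)" for i
  have U1: "U1 \<in> integral_GL ?N" and V1: "V1 \<in> integral_GL ?N"
    using integral_GL_four_block_lower[OF cint U] integral_GL_four_block_upper[OF rint V]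
    by (simp_all add: U1_def V1_def)
  note car = integral_mats_carrier[OF cint] integral_mats_carrier[OF rint] integral_GL_carrier[OF U] integral_GL_carrier[OF V]
  have m1c: "m1 \<in> carrier_mat 1 1" by (simp add: m1_def)
  have D1: "diagonal ?N d1 = four_block_mat m1 (0\<^sub>m 1 n) (0\<^sub>m n 1) (diagonal n d)"
    by (rule eq_matI) (auto simp: diagonal_def m1_def d1_def split: nat.splits)
  have *: "(0\<^sub>m 1 n :: 'a mat) * diagonal n d = 0\<^sub>m 1 n" "(0\<^sub>m 1 n :: 'a mat) + 0\<^sub>m 1 n = 0\<^sub>m 1 n"
    by (simp_all add: left_mult_zero_mat[OF diagonal_carrier])
  have "U1 * diagonal ?N d1 * V1 = four_block_mat m1 (m1 * r) (c * m1) (c * m1 * r + U * diagonal n d * V)"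
    unfolding D1 U1_def V1_def using car m1c *
    by (simp del: One_nat_def add: mult_four_block_mat[of _ 1 1 _ n _ n _ _ 1 _ n]
        mult_carrier_mat[of _ n n _ n] mult_carrier_mat[of _ n 1 _ 1] right_mult_zero_mat[of _ n n])
  also have "\<dots> = four_block_mat m1 (m1 * r) (c * m1) (c * m1 * r + X)" by (simp only: X)
  also have "\<dots> = M'"
  proof (rule eq_matI)
    fix i j assume "i < dim_row M'" "j < dim_col M'"
    then have ij: "i < ?N" "j < ?N" using M'c by auto
    show "four_block_mat m1 (m1 * r) (c * m1) (c * m1 * r + X) $$ (i, j) = M' $$ (i, j)"
    proof (cases i; cases j)
      assume "i = 0" "j = 0"
      then show ?thesis using ij car Xc by (simp add: m1_def m)
    next
      fix j' assume "i = 0" "j = Suc j'"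
      then show ?thesis using ij car Xc z(2)[of 0 j]
        by (simp add: m1_def r_def scalar_prod_def)
    next
      fix i' assume "i = Suc i'" "j = 0"
      then show ?thesis using ij car Xc z(2)[of i 0]
        by (simp add: m1_def c_def scalar_prod_def)
    next
      fix i' j' assume "i = Suc i'" "j = Suc j'"
      then show ?thesis using ij car Xc
        by (simp add: m1_def c_def r_def X_def scalar_prod_def)
    qed
  qed (use M'c Xc m1c in auto)
  finally have M'_eq: "M' = U1 * diagonal ?N d1 * V1" ..
  have dX: "divides_in e (X $$ (i, j))" if e: "\<And>i j. i < ?N \<Longrightarrow> j < ?N \<Longrightarrow> divides_in e (M' $$ (i, j))" and ij: "i < n" "j < n" for e i j
  proof -
    have "divides_in e (M' $$ (Suc i, Suc j) - M' $$ (Suc i, 0) * z 0 (Suc j))"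
      using ij by (intro divides_in_diff_mult e z) auto
    then show ?thesis using ij z(2)[of "Suc i" 0] by (simp add: X_def)
  qed
  have dd1: "divides_in e (d1 i)" if e: "\<And>i j. i < ?N \<Longrightarrow> j < ?N \<Longrightarrow> divides_in e (M' $$ (i, j))" and i: "i < ?N" for e i
  proof (cases i)
    case 0
    then show ?thesis using e[of 0 0] m by (simp add: d1_def)
  next
    case (Suc i')
    then show ?thesis using min[of e i'] dX[OF e] i by (simp add: d1_def)
  qed
  have "smith_form ?N M (P * U1) d1 (V1 * Q)"
    unfolding smith_form_def
  proof (intro conjI allI impI)
    show "P * U1 \<in> integral_GL ?N" "V1 * Q \<in> integral_GL ?N" using integral_GL_times PQ U1 V1 by auto
    show "M = P * U1 * diagonal ?N d1 * (V1 * Q)"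
      unfolding M_eq M'_eq using PQc U1[THEN integral_GL_carrier] V1[THEN integral_GL_carrier]
      by (simp add: assoc_mult_mat[of _ ?N ?N _ ?N _ ?N] mult_carrier_mat[of _ ?N ?N _ ?N])
    fix i j assume ij: "i \<le> j" "j < ?N"
    show "divides_in (d1 i) (d1 j)"
    proof (cases i)
      case 0
      then show ?thesis using dd1[OF div' ij(2)] by (simp add: d1_def)
    next
      case (Suc i')
      then obtain j' where "j = Suc j'" using ij by (cases j) auto
      then show ?thesis using Suc chain ij by (simp add: d1_def)
    qed
  qed
  moreover have "divides_in e (d1 i)" if "\<forall>i<?N. \<forall>j<?N. divides_in e (M $$ (i, j))" "i < ?N" for e i
    using that ab by (intro dd1) (auto simp: M'_index)
  ultimately show ?case by blast
qed

end

section \<open>Binomial weights with uniform marginals\<close>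

section \<open>Values of the diagonal entries\<close>

text \<open>The Vandermonde identity weighted by a function of the sum: independent binomial
  variables with the same parameter add up to a binomial variable.\<close>

lemma vandermonde_weighted:
  fixes h :: "nat \<Rightarrow> nat"
  shows "(\<Sum>a\<le>k. \<Sum>m\<le>l. (k choose a) * ((l choose m) * h (a + m))) = (\<Sum>n\<le>k + l. ((k + l) choose n) * h n)"
proof -
  have "(\<Sum>n\<le>k + l. ((k + l) choose n) * h n) = (\<Sum>n\<le>k + l. \<Sum>a\<le>n. (k choose a) * (l choose (n - a)) * h n)"
    by (simp add: vandermonde[symmetric] sum_distrib_right)
  also have "\<dots> = (\<Sum>(n, a)\<in>(SIGMA n:{..k + l}. {..n}). (k choose a) * (l choose (n - a)) * h n)"
    by (simp add: sum.Sigma)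
  also have "\<dots> = (\<Sum>(n, a)\<in>(\<lambda>(a, m). (a + m, a)) ` ({..k} \<times> {..l}). (k choose a) * (l choose (n - a)) * h n)"
  proof (rule sum.mono_neutral_right)
    show "\<forall>i\<in>(SIGMA n:{..k + l}. {..n}) - (\<lambda>(a, m). (a + m, a)) ` ({..k} \<times> {..l}).
      (case i of (n, a) \<Rightarrow> (k choose a) * (l choose (n - a)) * h n) = 0"
    proof
      fix q assume q: "q \<in> (SIGMA n:{..k + l}. {..n}) - (\<lambda>(a, m). (a + m, a)) ` ({..k} \<times> {..l})"
      obtain n a where na: "q = (n, a)" by (cases q)
      have *: "a \<le> n" "(n, a) \<notin> (\<lambda>(a, m). (a + m, a)) ` ({..k} \<times> {..l})" using q na by auto
      have "\<not> (a \<le> k \<and> n - a \<le> l)"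
      proof
        assume "a \<le> k \<and> n - a \<le> l"
        then have "(n, a) \<in> (\<lambda>(a, m). (a + m, a)) ` ({..k} \<times> {..l})"
          using *(1) by (auto intro!: image_eqI[of _ _ "(a, n - a)"])
        with * show False by simp
      qed
      then show "(case q of (n, a) \<Rightarrow> (k choose a) * (l choose (n - a)) * h n) = 0"
        using na by (auto simp: not_le binomial_eq_0)
    qed
  qed auto
  also have "\<dots> = (\<Sum>(a, m)\<in>{..k} \<times> {..l}. (k choose a) * (l choose m) * h (a + m))"
    by (subst sum.reindex) (auto simp: inj_on_def case_prod_unfold)
  finally show ?thesis by (simp add: sum.cartesian_product mult.assoc)
qed

definition choose_prod :: "nat list \<Rightarrow> nat list \<Rightarrow> nat" where
  "choose_prod ks s = (\<Prod>t<length ks. (ks ! t) choose (s ! t))"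

lemma choose_prod_Cons: "choose_prod (k # ks) (a # s) = (k choose a) * choose_prod ks s"
  by (simp add: choose_prod_def prod.lessThan_Suc_shift del: prod.lessThan_Suc)

lemma sum_choose_prod:
  "(\<Sum>s\<in>indices ks. choose_prod ks s * h (sum_list s)) = (\<Sum>m\<le>sum_list ks. (sum_list ks choose m) * h m)"
proof (induction ks arbitrary: h)
  case (Cons k ks)
  have "(\<Sum>s\<in>indices (k # ks). choose_prod (k # ks) s * h (sum_list s)) =
    (\<Sum>a\<le>k. (k choose a) * (\<Sum>s\<in>indices ks. choose_prod ks s * h (a + sum_list s)))"
    by (simp add: sum_indices_Cons choose_prod_Cons sum_distrib_left mult.assoc)
  also have "\<dots> = (\<Sum>a\<le>k. \<Sum>m\<le>sum_list ks. (k choose a) * ((sum_list ks choose m) * h (a + m)))"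
    by (simp add: Cons[of "\<lambda>n. h (_ + n)"] sum_distrib_left)
  finally show ?case by (simp only: vandermonde_weighted sum_list.Cons)
qed (simp add: choose_prod_def)

text \<open>Coordinate \<open>t\<close> is kept, while all the others merge into one binomial sum of
  size \<open>sum_list ks - ks ! t\<close>.\<close>

lemma sum_choose_prod_nth:
  assumes "t < length ks"
  shows "(\<Sum>s\<in>indices ks. choose_prod ks s * h (s ! t) (sum_list s)) =
    (\<Sum>r\<le>ks ! t. \<Sum>m\<le>sum_list ks - ks ! t. (ks ! t choose r) * ((sum_list ks - ks ! t choose m) * h r (r + m)))"
  using assms
proof (induction ks arbitrary: h t)
  case (Cons k ks)
  show ?case
  proof (cases t)
    case 0
    then show ?thesis
      by (simp add: sum_indices_Cons choose_prod_Cons mult.assoc flip: sum_distrib_left)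
         (simp add: sum_choose_prod[of _ "\<lambda>n. h _ (_ + n)"])
  next
    case (Suc t')
    let ?k = "ks ! t'" and ?K = "sum_list ks"
    have t': "t' < length ks" using Suc Cons.prems by simp
    then have le: "?k \<le> ?K" by (simp add: elem_le_sum_list)
    have "(\<Sum>s\<in>indices (k # ks). choose_prod (k # ks) s * h (s ! t) (sum_list s)) =
      (\<Sum>a\<le>k. (k choose a) * (\<Sum>s\<in>indices ks. choose_prod ks s * h (s ! t') (a + sum_list s)))"
      by (simp add: Suc sum_indices_Cons choose_prod_Cons sum_distrib_left mult.assoc)
    also have "\<dots> = (\<Sum>a\<le>k. \<Sum>r\<le>?k. \<Sum>m\<le>?K - ?k. (k choose a) * ((?k choose r) * ((?K - ?k choose m) * h r (r + (a + m)))))"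
      by (simp add: Cons.IH[OF t', of "\<lambda>r n. h r (_ + n)"] sum_distrib_left add.left_commute)
    also have "\<dots> = (\<Sum>r\<le>?k. (?k choose r) * (\<Sum>a\<le>k. \<Sum>m\<le>?K - ?k. (k choose a) * ((?K - ?k choose m) * h r (r + (a + m)))))"
      by (subst sum.swap) (simp add: sum_distrib_left mult.left_commute)
    also have "\<dots> = (\<Sum>r\<le>?k. (?k choose r) * (\<Sum>m\<le>k + (?K - ?k). (k + (?K - ?k) choose m) * h r (r + m)))"
      by (simp add: vandermonde_weighted[of k "?K - ?k" "\<lambda>n. h _ (_ + n)"])
    finally show ?thesis using le by (simp add: Suc sum_distrib_left)
  qed
qed simp

text \<open>Comparison of coefficients in
  \<open>(1 - X)^(-r-1) * (1 - X)^(-q-1) = (1 - X)^(-r-q-2)\<close>; the double induction uses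
  Pascal's rule instead of generating functions.\<close>

lemma sum_choose_convolution:
  "(\<Sum>m\<le>M. ((r + m) choose m) * ((q + (M - m)) choose (M - m))) = (r + q + M + 1) choose M"
proof (induction r arbitrary: M)
  case 0
  have "(\<Sum>m\<le>M. (0 + m choose m) * (q + (M - m) choose (M - m))) = (\<Sum>m\<le>M. (q + m choose m))"
    by (rule sum.reindex_bij_witness[of _ "\<lambda>m. M - m" "\<lambda>m. M - m"]) auto
  then show ?case by (simp add: sum_choose_lower)
next
  case (Suc r)
  note r_IH = Suc
  show ?case
  proof (induction M)
    case (Suc M)
    have "(\<Sum>m\<le>Suc M. (Suc r + m choose m) * (q + (Suc M - m) choose (Suc M - m))) =
      (\<Sum>m\<le>Suc M. (r + m choose m) * (q + (Suc M - m) choose (Suc M - m))) +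
      (\<Sum>m\<le>M. (Suc r + m choose m) * (q + (M - m) choose (M - m)))"
      unfolding sum.atMost_Suc_shift by (simp add: sum.distrib[symmetric] algebra_simps)
    then show ?case by (simp only: Suc r_IH) (simp add: algebra_simps)
  qed simp
qed

text \<open>With \<open>K = sum_list ks\<close>, division by \<open>(K + 1)!\<close> gives the
  probability of \<open>s\<close> under a uniform parameter \<theta>: the function
  \<open>\<theta>^n (1 - \<theta>)^(K - n)\<close> integrates over [0, 1] to
  \<open>n! (K - n)! / (K + 1)!\<close>.\<close>

definition tuple_weight :: "nat list \<Rightarrow> nat list \<Rightarrow> nat" where
  "tuple_weight ks s = choose_prod ks s * (fact (sum_list s) * fact (sum_list ks - sum_list s))"

lemma sum_weight_total:
  assumes "n \<le> sum_list ks"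
  shows "(\<Sum>s\<in>{s \<in> indices ks. sum_list s = n}. tuple_weight ks s) = fact (sum_list ks)"
proof -
  let ?K = "sum_list ks"
  have "(\<Sum>s\<in>{s \<in> indices ks. sum_list s = n}. tuple_weight ks s) =
    (\<Sum>s\<in>indices ks. choose_prod ks s * (if sum_list s = n then fact (sum_list s) * fact (?K - sum_list s) else 0))"
    by (rule sum.mono_neutral_cong_left) (auto simp: tuple_weight_def)
  also have "\<dots> = (\<Sum>m\<le>?K. (?K choose m) * (if m = n then fact m * fact (?K - m) else 0))"
    by (rule sum_choose_prod)
  also have "\<dots> = (\<Sum>m\<le>?K. if m = n then (?K choose m) * (fact m * fact (?K - m)) else 0)"
    by (intro sum.cong) auto
  also have "\<dots> = (?K choose n) * (fact n * fact (?K - n))" using assms by simp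
  also have "\<dots> = fact ?K" using binomial_fact_lemma[OF assms] by (simp add: mult.commute mult.left_commute)
  finally show ?thesis .
qed

text \<open>What matters is independence of \<open>r\<close>. The value is
  \<open>(K + 1)! / (ks ! t + 1)\<close> with \<open>K = sum_list ks\<close>, as for a uniform
  distribution on \<open>ks ! t + 1\<close> values.\<close>

lemma sum_weight_nth:
  assumes t: "t < length ks" and r: "r \<le> ks ! t"
  shows "(\<Sum>s\<in>{s \<in> indices ks. s ! t = r}. tuple_weight ks s) =
    fact (ks ! t) * fact (sum_list ks - ks ! t) * ((sum_list ks + 1) choose (sum_list ks - ks ! t))"
proof -
  let ?K = "sum_list ks" and ?k = "ks ! t"
  have le: "?k \<le> ?K" using t by (simp add: elem_le_sum_list)
  define M where "M = ?K - ?k"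
  have K: "?K = ?k + M" using le by (simp add: M_def)
  have "(\<Sum>s\<in>{s \<in> indices ks. s ! t = r}. tuple_weight ks s) =
    (\<Sum>s\<in>indices ks. choose_prod ks s * (if s ! t = r then fact (sum_list s) * fact (?K - sum_list s) else 0))"
    by (rule sum.mono_neutral_cong_left) (auto simp: tuple_weight_def)
  also have "\<dots> = (\<Sum>r'\<le>?k. \<Sum>m\<le>M. (?k choose r') * ((M choose m) * (if r' = r then fact (r' + m) * fact (?K - (r' + m)) else 0)))"
    unfolding M_def by (rule sum_choose_prod_nth[OF t, of "\<lambda>r' n. if r' = r then fact n * fact (?K - n) else 0"])
  also have "\<dots> = (\<Sum>r'\<le>?k. if r' = r then \<Sum>m\<le>M. (?k choose r') * ((M choose m) * (fact (r' + m) * fact (?K - (r' + m)))) else 0)"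
    by (intro sum.cong) auto
  also have "\<dots> = (\<Sum>m\<le>M. (?k choose r) * ((M choose m) * (fact (r + m) * fact (?K - (r + m)))))"
    using r by simp
  also have "\<dots> = (\<Sum>m\<le>M. fact ?k * fact M * (((r + m) choose m) * ((?k - r + (M - m)) choose (M - m))))"
  proof (rule sum.cong)
    fix m assume "m \<in> {..M}"
    then have m: "m \<le> M" by simp
    have 1: "fact (r + m) = (fact m * fact r * ((r + m) choose m) :: nat)"
      using binomial_fact_lemma[of m "r + m"] by simp
    have 2: "?K - (r + m) = ?k - r + (M - m)" using K r m by simp
    have 3: "fact (?k - r + (M - m)) = (fact (M - m) * fact (?k - r) * ((?k - r + (M - m)) choose (M - m)) :: nat)"
      using binomial_fact_lemma[of "M - m" "?k - r + (M - m)"] by simp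
    have 4: "fact ?k = fact r * fact (?k - r) * (?k choose r)" "fact M = fact m * fact (M - m) * (M choose m)"
      using binomial_fact_lemma[OF r] binomial_fact_lemma[OF m] by simp_all
    show "(?k choose r) * ((M choose m) * (fact (r + m) * fact (?K - (r + m)))) =
      fact ?k * fact M * (((r + m) choose m) * ((?k - r + (M - m)) choose (M - m)))"
      unfolding 2 1 3 4 by (simp only: mult_ac)
  qed simp
  also have "\<dots> = fact ?k * fact M * ((r + (?k - r) + M + 1) choose M)"
    by (simp only: sum_distrib_left[symmetric] sum_choose_convolution)
  also have "r + (?k - r) + M + 1 = ?K + 1" using r K by simp
  finally show ?thesis by (simp only: M_def)
qed

lemma tuple_weight_pos:
  assumes "s \<in> indices ks"
  shows "tuple_weight ks s > 0"
  using assms by (auto simp: tuple_weight_def choose_prod_def indices_nth intro!: prod_pos)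

lemma prod_power_group:
  fixes d :: "'b \<Rightarrow> 'a::comm_monoid_mult"
  assumes "finite S" "finite R" "f ` S \<subseteq> R"
  shows "(\<Prod>s\<in>S. d (f s) ^ N s) = (\<Prod>r\<in>R. d r ^ (\<Sum>s\<in>{s \<in> S. f s = r}. N s))"
proof -
  have "(\<Prod>s\<in>S. d (f s) ^ N s) = (\<Prod>r\<in>R. \<Prod>s\<in>{s \<in> S. f s = r}. d (f s) ^ N s)"
    using prod.group[OF assms, of "\<lambda>s. d (f s) ^ N s"] by simp
  also have "\<dots> = (\<Prod>r\<in>R. \<Prod>s\<in>{s \<in> S. f s = r}. d r ^ N s)"
    by (intro prod.cong) auto
  finally show ?thesis by (simp add: power_sum)
qed

text \<open>Discrete intermediate values: starting from \<open>l\<close>, an entry still below its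
  bound is raised by 1 at each step.\<close>

lemma sum_list_between:
  fixes l u :: "nat list"
  assumes "length l = length u" "\<And>t. t < length u \<Longrightarrow> l ! t \<le> u ! t"
    and "sum_list l \<le> n" "n \<le> sum_list u"
  shows "\<exists>s\<in>indices u. sum_list s = n \<and> (\<forall>t<length u. l ! t \<le> s ! t)"
  using assms(3,4)
proof (induction n rule: dec_induct)
  case base
  then show ?case using assms(1,2) by (auto simp: indices_def intro!: bexI[of _ l])
next
  case (step n)
  then obtain s where s: "s \<in> indices u" "sum_list s = n" "\<forall>t<length u. l ! t \<le> s ! t" by auto
  have len: "length s = length u" using s(1) by (rule indices_length)
  have "\<exists>t<length u. s ! t < u ! t"
  proof (rule ccontr)
    assume "\<not> ?thesis"
    then have "sum_list u \<le> sum_list s"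
      unfolding sum_list_sum_nth len by (intro sum_mono) (meson atLeastLessThan_iff not_less)
    then show False using s(2) step by simp
  qed
  then obtain t where t: "t < length u" "s ! t < u ! t" by blast
  have "sum_list (s[t := Suc (s ! t)]) = Suc n"
    using t len s(2) elem_le_sum_list[of t s] by (simp add: sum_list_update)
  moreover have "s[t := Suc (s ! t)] \<in> indices u"
    using s(1) t by (auto simp: indices_def nth_list_update)
  ultimately show ?case using s(3) t len
    by (intro bexI[of _ "s[t := Suc (s ! t)]"]) (auto simp: nth_list_update le_SucI)
qed

section \<open>From integral products to values in arithmetic progression\<close>

context place
begin

definition unit :: "'a \<Rightarrow> bool" where
  "unit x \<longleftrightarrow> x \<noteq> 0 \<and> x \<in> \<O> \<and> inverse x \<in> \<O>"

lemma unit_one [simp]: "unit 1"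
  by (simp add: unit_def)

lemma unit_mult: "unit x \<Longrightarrow> unit y \<Longrightarrow> unit (x * y)"
  by (auto simp: unit_def inverse_mult_distrib intro: mult_mem)

lemma unit_inverse: "unit x \<Longrightarrow> unit (inverse x)"
  by (auto simp: unit_def)

lemma unit_divide: "unit x \<Longrightarrow> unit y \<Longrightarrow> unit (x / y)"
  by (simp add: divide_inverse unit_mult unit_inverse)

lemma unit_prod: "(\<And>i. i \<in> I \<Longrightarrow> unit (f i)) \<Longrightarrow> unit (prod f I)"
  by (induction I rule: infinite_finite_induct) (auto intro: unit_mult)

lemma unit_power: "unit x \<Longrightarrow> unit (x ^ n)"
  by (induction n) (auto intro: unit_mult)

lemma unit_of_mult: "x \<in> \<O> \<Longrightarrow> y \<in> \<O> \<Longrightarrow> unit (x * y) \<Longrightarrow> unit x"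
proof -
  assume *: "x \<in> \<O>" "y \<in> \<O>" "unit (x * y)"
  then have eq: "y * inverse (x * y) = inverse x" by (simp add: unit_def field_simps)
  have "y * inverse (x * y) \<in> \<O>" using * by (intro mult_mem) (simp_all only: unit_def)
  then have "inverse x \<in> \<O>" by (simp only: eq)
  then show "unit x" using * by (auto simp: unit_def)
qed

lemma unit_of_prod:
  assumes "finite I" "i \<in> I" "\<And>i. i \<in> I \<Longrightarrow> f i \<in> \<O>" "unit (prod f I)"
  shows "unit (f i)"
  using assms by (intro unit_of_mult[of "f i" "prod f (I - {i})"]) (auto simp: prod.remove intro!: prod_mem)

text \<open>The value group has no torsion: if \<open>x\<close> is not integral, its inverse has
  residue 0, and so have the positive powers of that inverse.\<close>

lemma unit_of_power:
  assumes "unit (x ^ n)" "n > 0"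
  shows "unit x"
proof -
  have x: "x \<in> \<O>"
  proof (rule ccontr)
    assume x: "x \<notin> \<O>"
    have "\<chi> (inverse x ^ n) = 0"
      using \<chi>_inverse[OF x] inverse_mem[OF x] assms(2) by (cases n) (auto simp: \<chi>_mult power_mem)
    moreover have "inverse x ^ n \<in> \<O>" using inverse_mem[OF x] by (rule power_mem)
    moreover have "x ^ n * inverse x ^ n = 1" using assms(1) by (auto simp: unit_def power_inverse)
    ultimately show False using \<chi>_mult[of "x ^ n" "inverse x ^ n"] assms(1) by (simp add: unit_def)
  qed
  show ?thesis
    by (rule unit_of_mult[of x "x ^ (n - 1)"])
       (use x assms in \<open>simp_all add: power_mem power_Suc[symmetric] del: power_Suc\<close>)
qed

text \<open>
  Additively: nonnegative sums \<open>a(s\<^sub>1 + \<dots> + s\<^sub>p) + b\<^sub>1(s\<^sub>1) + \<dots> + b\<^sub>p(s\<^sub>p)\<close> vanish if the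
  values of each of \<open>a, b\<^sub>1, \<dots>, b\<^sub>p\<close> add up to 0.  Indeed, if \<open>s\<^sub>t\<close> is binomially distributed
  with parameters \<open>k\<^sub>t\<close> and \<open>\<theta>\<close>, independently given a uniformly distributed \<open>\<theta>\<close>, then every \<open>s\<^sub>t\<close> and
  also their sum is uniformly distributed.  The weights are the probabilities, cleared of denominators.
\<close>

lemma unit_of_prod_units:
  fixes a :: "nat \<Rightarrow> 'a" and b :: "nat \<Rightarrow> nat \<Rightarrow> 'a"
  assumes mem: "\<And>s. s \<in> indices ks \<Longrightarrow> a (sum_list s) * (\<Prod>t<length ks. b t (s ! t)) \<in> \<O>"
    and a: "unit (\<Prod>n\<le>sum_list ks. a n)"
    and b: "\<And>t. t < length ks \<Longrightarrow> unit (\<Prod>r\<le>ks ! t. b t r)"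
    and s: "s \<in> indices ks"
  shows "unit (a (sum_list s) * (\<Prod>t<length ks. b t (s ! t)))"
proof -
  let ?F = "\<lambda>s. a (sum_list s) * (\<Prod>t<length ks. b t (s ! t))"
  let ?N = "tuple_weight ks"
  have le: "sum_list s \<le> sum_list ks" if "s \<in> indices ks" for s
    using that by (auto simp: sum_list_sum_nth indices_length indices_nth intro!: sum_mono)
  \<comment> \<open>Every \<open>a n\<close> collects the same total exponent, so only the product
    of all \<open>a n\<close> matters; \<open>2\<close> does the same for each
    \<open>b t\<close>.\<close>
  have "(\<Prod>s\<in>indices ks. a (sum_list s) ^ ?N s) = (\<Prod>n\<le>sum_list ks. a n ^ (\<Sum>s\<in>{s \<in> indices ks. sum_list s = n}. ?N s))"
    by (rule prod_power_group) (auto simp: le)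
  also have "\<dots> = (\<Prod>n\<le>sum_list ks. a n) ^ fact (sum_list ks)"
    by (simp add: sum_weight_total prod_power_distrib)
  finally have 1: "unit (\<Prod>s\<in>indices ks. a (sum_list s) ^ ?N s)" using a by (simp add: unit_power)
  have 2: "unit (\<Prod>s\<in>indices ks. b t (s ! t) ^ ?N s)" if t: "t < length ks" for t
  proof -
    have "(\<Prod>s\<in>indices ks. b t (s ! t) ^ ?N s) = (\<Prod>r\<le>ks ! t. b t r ^ (\<Sum>s\<in>{s \<in> indices ks. s ! t = r}. ?N s))"
      by (rule prod_power_group) (use t in \<open>auto simp: indices_nth\<close>)
    also have "\<dots> = (\<Prod>r\<le>ks ! t. b t r) ^ (fact (ks ! t) * fact (sum_list ks - ks ! t) * ((sum_list ks + 1) choose (sum_list ks - ks ! t)))"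
      using sum_weight_nth[OF t] by (simp add: prod_power_distrib)
    finally show ?thesis using b[OF t] by (simp add: unit_power)
  qed
  have "(\<Prod>s\<in>indices ks. ?F s ^ ?N s) =
    (\<Prod>s\<in>indices ks. a (sum_list s) ^ ?N s) * (\<Prod>t<length ks. \<Prod>s\<in>indices ks. b t (s ! t) ^ ?N s)"
    by (subst prod.swap) (simp add: power_mult_distrib prod.distrib prod_power_distrib)
  then have "unit (\<Prod>s\<in>indices ks. ?F s ^ ?N s)"
    using unit_mult[OF 1 unit_prod[of "{..<length ks}", OF 2]] by simp
  \<comment> \<open>Integral elements whose product is a unit are units themselves.\<close>
  then have "unit (?F s ^ ?N s)"
    by (intro unit_of_prod[of "indices ks" s "\<lambda>s. ?F s ^ ?N s"]) (use mem s in \<open>auto intro!: power_mem\<close>)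
  then show ?thesis using tuple_weight_pos[OF s] by (rule unit_of_power)
qed

text \<open>Cauchy's functional equation up to units. Tuples with a single nonzero entry express
  \<open>b t r\<close> through \<open>E r\<close>, and then \<open>E\<close> turns sums of entries
  into products. Having two positive \<open>ks ! t\<close> allows every \<open>n \<ge> 2\<close> to
  be split into smaller parts, so \<open>E n\<close> is a unit multiple of
  \<open>c ^ n\<close>.\<close>

lemma unit_exponents:
  fixes a :: "nat \<Rightarrow> 'a" and b :: "nat \<Rightarrow> nat \<Rightarrow> 'a"
  assumes unit: "\<And>s. s \<in> indices ks \<Longrightarrow> unit (a (sum_list s) * (\<Prod>t<length ks. b t (s ! t)))"
    and t12: "t1 < length ks" "t2 < length ks" "t1 \<noteq> t2" "ks ! t1 > 0" "ks ! t2 > 0"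
  shows "\<exists>c. c \<noteq> 0 \<and> (\<forall>n\<le>sum_list ks. unit (a 0 / (a n * c ^ n))) \<and>
    (\<forall>t<length ks. \<forall>r\<le>ks ! t. unit (b t r / (b t 0 * c ^ r)))"
proof -
  let ?p = "length ks"
  define z where "z t r = (replicate ?p 0)[t := r]" for t r :: nat
  have z: "z t r \<in> indices ks" "sum_list (z t r) = r" if "t < ?p" "r \<le> ks ! t" for t r
    using that by (auto simp: z_def indices_def nth_list_update sum_list_update)
  have nz: "a (sum_list s) \<noteq> 0" "\<And>t. t < ?p \<Longrightarrow> b t (s ! t) \<noteq> 0" if "s \<in> indices ks" for s
    using unit[OF that] by (auto simp: unit_def)
  have b_nz: "b t r \<noteq> 0" if "t < ?p" "r \<le> ks ! t" for t r
    using nz(2)[OF z(1)[OF that] that(1)] that by (simp add: z_def)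
  have a_nz: "a n \<noteq> 0" if "n \<le> sum_list ks" for n
  proof -
    have "\<exists>s\<in>indices ks. sum_list s = n \<and> (\<forall>t<?p. replicate ?p 0 ! t \<le> s ! t)"
      by (rule sum_list_between) (use that in \<open>auto simp: sum_list_replicate\<close>)
    then obtain s where "s \<in> indices ks" "sum_list s = n" by blast
    then show ?thesis using nz(1) by blast
  qed
  define E where "E n = a 0 / a n" for n
  have E_nz: "E n \<noteq> 0" if "n \<le> sum_list ks" for n
    using a_nz[OF that] a_nz[of 0] by (simp add: E_def)
  have u0: "unit (a 0 * (\<Prod>t<?p. b t 0))"
    using unit[of "replicate ?p 0"] by (simp add: indices_def sum_list_replicate)
  have bE: "unit (b t r / (b t 0 * E r))" if t: "t < ?p" and r: "r \<le> ks ! t" for t r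
  proof -
    have "(\<Prod>u<?p. b u (z t r ! u)) = b t r * (\<Prod>u\<in>{..<?p} - {t}. b u 0)"
      using t by (subst prod.remove[of _ t]) (auto simp: z_def intro!: prod.cong)
    moreover have "(\<Prod>u<?p. b u 0) = b t 0 * (\<Prod>u\<in>{..<?p} - {t}. b u 0)"
      using t by (subst prod.remove[of _ t]) auto
    moreover have "(\<Prod>u\<in>{..<?p} - {t}. b u 0) \<noteq> 0" using b_nz by auto
    ultimately have "b t r / (b t 0 * E r) = (a r * (\<Prod>u<?p. b u (z t r ! u))) / (a 0 * (\<Prod>t<?p. b t 0))"
      using a_nz[of 0] by (simp add: E_def mult_ac)
    then show ?thesis using unit[OF z(1)[OF t r]] z(2)[OF t r] u0 by (simp add: unit_divide)
  qed
  have EE: "unit (E (sum_list s) / (\<Prod>t<?p. E (s ! t)))" if s: "s \<in> indices ks" for s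
  proof -
    have le: "s ! t \<le> sum_list ks" if "t < ?p" for t
      using indices_nth[OF s that] elem_le_sum_list[OF that] by linarith
    have "(\<Prod>t<?p. b t (s ! t) / (b t 0 * E (s ! t))) = (\<Prod>t<?p. b t (s ! t)) / ((\<Prod>t<?p. b t 0) * (\<Prod>t<?p. E (s ! t)))"
      by (simp add: prod_dividef prod.distrib)
    moreover have "(\<Prod>t<?p. b t (s ! t)) \<noteq> 0" "(\<Prod>t<?p. b t 0) \<noteq> 0" "(\<Prod>t<?p. E (s ! t)) \<noteq> 0"
      using b_nz E_nz le indices_nth[OF s] by auto
    moreover have "a (sum_list s) \<noteq> 0" using nz(1)[OF s] .
    ultimately have "E (sum_list s) / (\<Prod>t<?p. E (s ! t)) =
      ((\<Prod>t<?p. b t (s ! t) / (b t 0 * E (s ! t))) * (a 0 * (\<Prod>t<?p. b t 0))) / (a (sum_list s) * (\<Prod>t<?p. b t (s ! t)))"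
      by (simp add: E_def)
    moreover have "unit (\<Prod>t<?p. b t (s ! t) / (b t 0 * E (s ! t)))"
      by (intro unit_prod bE indices_nth[OF s]) auto
    ultimately show ?thesis using unit_divide[OF unit_mult[OF _ u0] unit[OF s]] by simp
  qed
  define c where "c = E 1"
  have ge: "2 \<le> sum_list ks"
  proof -
    have "(\<Sum>t\<in>{t1, t2}. ks ! t) \<le> (\<Sum>t<?p. ks ! t)" using t12 by (intro sum_mono2) auto
    then show ?thesis using t12 by (simp add: sum_list_sum_nth atLeast0LessThan)
  qed
  have c_nz: "c \<noteq> 0" using E_nz[of 1] ge by (simp add: c_def)
  have Ec: "unit (E n / c ^ n)" if "n \<le> sum_list ks" for n
    using that
  proof (induction n rule: less_induct)
    case (less n)
    consider "n = 0" | "n = 1" | "n \<ge> 2" by linarith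
    then show ?case
    proof cases
      case 1
      then show ?thesis using a_nz[of 0] by (simp add: E_def)
    next
      case 2
      then show ?thesis using c_nz by (simp add: c_def)
    next
      case 3
      \<comment> \<open>A tuple of sum \<open>n\<close> dominating \<open>?l\<close> is positive at
        both \<open>t1\<close> and \<open>t2\<close>, so all its entries are smaller than
        \<open>n\<close>.\<close>
      let ?l = "(replicate ?p 0)[t1 := 1, t2 := 1 :: nat]"
      have "sum_list ?l = 2" using t12 by (simp add: sum_list_update nth_list_update)
      moreover have "?l ! t \<le> ks ! t" if "t < ?p" for t using that t12 by (auto simp: nth_list_update)
      ultimately obtain s where s: "s \<in> indices ks" "sum_list s = n" "\<forall>t<?p. ?l ! t \<le> s ! t"
        using sum_list_between[of ?l ks n] 3 less.prems by auto
      have pos: "s ! t1 > 0" "s ! t2 > 0"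
        using s(3)[rule_format, of t1] s(3)[rule_format, of t2] t12 by (simp_all add: nth_list_update)
      have lt: "s ! t < n" if t: "t < ?p" for t
      proof -
        obtain t' where t': "t' < ?p" "t' \<noteq> t" "s ! t' > 0" using t12 pos by (cases "t = t1") auto
        have "(\<Sum>u\<in>{t, t'}. s ! u) \<le> (\<Sum>u<?p. s ! u)" using t t' by (intro sum_mono2) auto
        also have "\<dots> = n" using s(2) indices_length[OF s(1)] by (simp add: sum_list_sum_nth atLeast0LessThan)
        finally show ?thesis using t' by simp
      qed
      have "unit (\<Prod>t<?p. E (s ! t) / c ^ (s ! t))"
      proof (intro unit_prod less.IH)
        fix t assume "t \<in> {..<?p}"
        then have "s ! t < n" using lt by simp
        then show "s ! t < n" "s ! t \<le> sum_list ks" using less.prems by linarith+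
      qed
      moreover have "(\<Prod>t<?p. c ^ (s ! t)) = c ^ n"
        using s(2) indices_length[OF s(1)] by (simp add: power_sum[symmetric] sum_list_sum_nth atLeast0LessThan)
      moreover have "(\<Prod>t<?p. E (s ! t)) \<noteq> 0"
        using E_nz lt less.prems by (auto simp: prod_zero_iff) (meson less_imp_le_nat order.trans)
      ultimately have "unit (E n / (\<Prod>t<?p. E (s ! t)) * ((\<Prod>t<?p. E (s ! t)) / c ^ n))"
        using EE[OF s(1)] s(2) by (intro unit_mult) (auto simp: prod_dividef)
      then show ?thesis using \<open>(\<Prod>t<?p. E (s ! t)) \<noteq> 0\<close> by simp
    qed
  qed
  show ?thesis
  proof (intro exI[of _ c] conjI allI impI c_nz)
    fix n assume "n \<le> sum_list ks"
    then show "unit (a 0 / (a n * c ^ n))" using Ec[of n] by (simp add: E_def)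
  next
    fix t r assume t: "t < ?p" and r: "r \<le> ks ! t"
    have "r \<le> sum_list ks" using r elem_le_sum_list[OF t] by linarith
    then have "unit (b t r / (b t 0 * E r) * (E r / c ^ r))" "E r \<noteq> 0"
      using unit_mult[OF bE[OF t r] Ec] E_nz by blast+
    then show "unit (b t r / (b t 0 * c ^ r))" by simp
  qed
qed

end

section \<open>Nondegenerate tensors\<close>

definition inverse_mats :: "nat list \<Rightarrow> (nat \<Rightarrow> 'a::comm_ring_1 mat) \<Rightarrow> (nat \<Rightarrow> 'a mat) \<Rightarrow> bool" where
  "inverse_mats k g h \<longleftrightarrow> format_mats k g \<and> format_mats k h \<and>
     (\<forall>j<length k. g j * h j = 1\<^sub>m (k ! j + 1) \<and> h j * g j = 1\<^sub>m (k ! j + 1))"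

lemma inverse_mats_sym: "inverse_mats k g h \<Longrightarrow> inverse_mats k h g"
  by (auto simp: inverse_mats_def)

lemma multiact_inverse:
  assumes "inverse_mats k g h" "\<And>i. i \<notin> indices k \<Longrightarrow> A i = 0"
  shows "multiact k g (multiact k h A) = A"
  using assms by (subst multiact_multiact) (auto simp: inverse_mats_def intro!: multiact_one)

lemma invertible_mat_iff:
  fixes M :: "'a::comm_ring_1 mat"
  assumes M: "M \<in> carrier_mat n n"
  shows "invertible_mat M \<longleftrightarrow> (\<exists>B\<in>carrier_mat n n. M * B = 1\<^sub>m n \<and> B * M = 1\<^sub>m n)"
proof
  assume "invertible_mat M"
  then obtain B where B: "M * B = 1\<^sub>m n" "B * M = 1\<^sub>m (dim_row B)"
    using M by (auto simp: invertible_mat_def inverts_mat_def)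
  have "dim_col (M * B) = n" "dim_col (B * M) = n" using B(1) M by auto
  then have "B \<in> carrier_mat n n" using B(2) by auto
  then show "\<exists>B\<in>carrier_mat n n. M * B = 1\<^sub>m n \<and> B * M = 1\<^sub>m n" using B by auto
next
  assume "\<exists>B\<in>carrier_mat n n. M * B = 1\<^sub>m n \<and> B * M = 1\<^sub>m n"
  then show "invertible_mat M" using M by (auto simp: invertible_mat_def inverts_mat_def)
qed

lemma sum_tail_indices:
  assumes "i \<in> indices (m # ks)"
  shows "(\<Sum>t=1..<length (m # ks). i ! t) = sum_list (tl i)"
proof -
  obtain a js where i: "i = a # js" and js: "js \<in> indices ks" using assms by (auto simp: indices_Cons)
  have "(\<Sum>t=1..<Suc (length ks). i ! t) = (\<Sum>t=0..<length ks. js ! t)"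
    using sum.shift_bounds_Suc_ivl[of "\<lambda>t. i ! t" 0 "length ks"] by (simp add: i)
  then show ?thesis using indices_length[OF js] by (simp add: i sum_list_sum_nth)
qed

lemma change_of_bases_eq_multiact:
  assumes e: "e \<in> bases k"
  shows "(\<lambda>l. \<Sum>i\<in>indices k. a i * pure_tensor k (map2 col e i) l) = multiact k (\<lambda>j. e ! j) a"
proof
  fix l
  have "pure_tensor k (map2 col e i) l = (\<Prod>j<length k. (e ! j) $$ (l ! j, i ! j))"
    if i: "i \<in> indices k" and l: "l \<in> indices k" for i
  proof -
    have "map2 col e i ! j $ (l ! j) = (e ! j) $$ (l ! j, i ! j)" if j: "j < length k" for j
    proof -
      have "e ! j \<in> carrier_mat (k ! j + 1) (k ! j + 1)" using e j by (auto simp: bases_def)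
      then show ?thesis using e j indices_nth[OF i j] indices_nth[OF l j] indices_length[OF i] by (auto simp: bases_def)
    qed
    then show ?thesis using l by (auto simp: pure_tensor_def)
  qed
  then show "(\<Sum>i\<in>indices k. a i * pure_tensor k (map2 col e i) l) = multiact k (\<lambda>j. e ! j) a l"
    by (auto simp: multiact_def mult.commute pure_tensor_def intro!: sum.cong)
qed

lemma triangulable_multiact:
  "triangulable (k0 # ks) A \<longleftrightarrow> (\<exists>e\<in>bases (k0 # ks). \<exists>a\<in>tensors (k0 # ks).
     A = multiact (k0 # ks) (\<lambda>j. e ! j) a \<and> (\<forall>i\<in>indices (k0 # ks). i ! 0 > sum_list (tl i) \<longrightarrow> a i = 0))"
  unfolding triangulable_def
  by (intro bex_cong refl conj_cong ball_cong)
     (simp_all only: sum_tail_indices change_of_bases_eq_multiact)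

lemma triangulable_iff:
  "triangulable (k0 # ks) A \<longleftrightarrow> (\<exists>e h a. inverse_mats (k0 # ks) e h \<and> a \<in> tensors (k0 # ks) \<and>
     A = multiact (k0 # ks) e a \<and> (\<forall>i\<in>indices (k0 # ks). i ! 0 > sum_list (tl i) \<longrightarrow> a i = 0))"
  (is "_ \<longleftrightarrow> ?R")
proof
  let ?k = "k0 # ks"
  assume "triangulable ?k A"
  then obtain e a where e: "e \<in> bases ?k" and a: "a \<in> tensors ?k" "A = multiact ?k (\<lambda>j. e ! j) a"
    "\<forall>i\<in>indices ?k. i ! 0 > sum_list (tl i) \<longrightarrow> a i = 0"
    unfolding triangulable_multiact by blast
  have "\<exists>B. B \<in> carrier_mat (?k ! j + 1) (?k ! j + 1) \<and> e ! j * B = 1\<^sub>m (?k ! j + 1) \<and> B * e ! j = 1\<^sub>m (?k ! j + 1)"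
    if "j < length ?k" for j
    using e that invertible_mat_iff[of "e ! j" "?k ! j + 1"] unfolding bases_def by blast
  then obtain h where "\<And>j. j < length ?k \<Longrightarrow> h j \<in> carrier_mat (?k ! j + 1) (?k ! j + 1) \<and>
    e ! j * h j = 1\<^sub>m (?k ! j + 1) \<and> h j * e ! j = 1\<^sub>m (?k ! j + 1)" by metis
  then have "inverse_mats ?k (\<lambda>j. e ! j) h"
    using e unfolding inverse_mats_def format_mats_def bases_def by blast
  then show ?R using a by blast
next
  let ?k = "k0 # ks"
  assume ?R
  then obtain e h a where e: "inverse_mats ?k e h" and a: "a \<in> tensors ?k" "A = multiact ?k e a"
    "\<forall>i\<in>indices ?k. i ! 0 > sum_list (tl i) \<longrightarrow> a i = 0" by blast
  define e' where "e' = map e [0..<length ?k]"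
  have e': "e' ! j = e j" if "j < length ?k" for j
    using that unfolding e'_def by (subst nth_map) (simp_all del: upt_Suc)
  have eb: "e' \<in> bases ?k"
    unfolding bases_def
  proof (intro CollectI conjI allI impI)
    show "length e' = length ?k" by (simp add: e'_def)
    fix j assume j: "j < length ?k"
    then have c: "e j \<in> carrier_mat (?k ! j + 1) (?k ! j + 1)" "h j \<in> carrier_mat (?k ! j + 1) (?k ! j + 1)"
      "e j * h j = 1\<^sub>m (?k ! j + 1)" "h j * e j = 1\<^sub>m (?k ! j + 1)"
      using e unfolding inverse_mats_def format_mats_def by blast+
    show "e' ! j \<in> carrier_mat (?k ! j + 1) (?k ! j + 1)" unfolding e'[OF j] by (rule c)
    show "invertible_mat (e' ! j)" unfolding e'[OF j] invertible_mat_iff[OF c(1)] using c by blast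
  qed
  have "multiact ?k e a = multiact ?k (\<lambda>j. e' ! j) a" by (rule multiact_cong) (simp_all add: e')
  then show "triangulable ?k A"
    unfolding triangulable_multiact using eb a by metis
qed

lemma multiact_Cons:
  assumes "a \<le> k0" "i \<in> indices ks"
  shows "multiact (k0 # ks) g A (a # i) =
    (\<Sum>b\<le>k0. g 0 $$ (a, b) * multiact ks (\<lambda>t. g (Suc t)) (\<lambda>l. A (b # l)) i)"
  using assms
  by (simp add: multiact_def sum_indices_Cons prod.lessThan_Suc_shift sum_distrib_left mult.assoc del: prod.lessThan_Suc)

text \<open>The contraction \<open>A(v\<^sub>1 \<otimes> \<dots> \<otimes> v\<^sub>p)\<close> does not vanish for nonzero \<open>v\<^sub>t\<close>; here \<open>t\<close> is counted from 0.\<close>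

definition nondegenerate :: "nat \<Rightarrow> nat list \<Rightarrow> tensor \<Rightarrow> bool" where
  "nondegenerate k0 ks A \<longleftrightarrow> (\<forall>v. (\<forall>t<length ks. \<exists>r\<le>ks ! t. v t r \<noteq> 0) \<longrightarrow>
     (\<exists>a\<le>k0. multilinear ks (\<lambda>i. A (a # i)) v \<noteq> 0))"

text \<open>Contraction is adjoint to the action: the matrices of the last factors act on the
  vectors by their transposes, and \<open>g 0\<close> acts on the resulting vector.\<close>

lemma multilinear_multiact:
  assumes a: "a \<le> k0"
  shows "multilinear ks (\<lambda>i. multiact (k0 # ks) g A (a # i)) v =
    (\<Sum>b\<le>k0. g 0 $$ (a, b) * multilinear ks (\<lambda>l. A (b # l)) (\<lambda>t r. \<Sum>q\<le>ks ! t. g (Suc t) $$ (q, r) * v t q))"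
proof -
  let ?G = "\<lambda>i l. \<Prod>t<length ks. g (Suc t) $$ (i ! t, l ! t)"
  let ?v = "\<lambda>i. \<Prod>t<length ks. v t (i ! t)"
  have "multilinear ks (\<lambda>i. multiact (k0 # ks) g A (a # i)) v =
    (\<Sum>i\<in>indices ks. \<Sum>b\<le>k0. \<Sum>l\<in>indices ks. g 0 $$ (a, b) * (A (b # l) * (?G i l * ?v i)))"
    unfolding multilinear_def
    by (intro sum.cong refl)
       (simp add: multiact_Cons[OF a], simp add: multiact_def sum_distrib_left sum_distrib_right mult_ac)
  also have "\<dots> = (\<Sum>b\<le>k0. \<Sum>l\<in>indices ks. \<Sum>i\<in>indices ks. g 0 $$ (a, b) * (A (b # l) * (?G i l * ?v i)))"
    by (rule trans[OF sum.swap]) (rule sum.cong[OF refl], rule sum.swap)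
  also have "\<dots> = (\<Sum>b\<le>k0. g 0 $$ (a, b) * (\<Sum>l\<in>indices ks. A (b # l) * (\<Sum>i\<in>indices ks. ?G i l * ?v i)))"
    by (simp add: sum_distrib_left)
  also have "\<dots> = (\<Sum>b\<le>k0. g 0 $$ (a, b) * (\<Sum>l\<in>indices ks. A (b # l) *
      (\<Prod>t<length ks. \<Sum>q\<le>ks ! t. g (Suc t) $$ (q, l ! t) * v t q)))"
  proof -
    have "(\<Sum>i\<in>indices ks. ?G i l * ?v i) = (\<Prod>t<length ks. \<Sum>q\<le>ks ! t. g (Suc t) $$ (q, l ! t) * v t q)" for l
      using sum_indices_prod[of "\<lambda>t q. g (Suc t) $$ (q, l ! t) * v t q" ks] by (simp add: prod.distrib)
    then show ?thesis by simp
  qed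
  finally show ?thesis by (simp add: multilinear_def)
qed

text \<open>Phrased with functions instead of matrices so that it serves both for a matrix and for a
  transpose.\<close>

lemma left_inverse_zero:
  fixes w :: "nat \<Rightarrow> 'a::comm_ring_1"
  assumes inv: "\<And>q. q \<le> n \<Longrightarrow> (\<Sum>a\<le>n. H a * G a q) = (if b = q then 1 else 0)"
    and zero: "\<And>a. a \<le> n \<Longrightarrow> (\<Sum>q\<le>n. G a q * w q) = 0" and b: "b \<le> n"
  shows "w b = 0"
proof -
  have "0 = (\<Sum>a\<le>n. H a * (\<Sum>q\<le>n. G a q * w q))" using zero by simp
  also have "\<dots> = (\<Sum>a\<le>n. \<Sum>q\<le>n. H a * G a q * w q)"
    by (simp add: sum_distrib_left mult.assoc)
  also have "\<dots> = (\<Sum>q\<le>n. (\<Sum>a\<le>n. H a * G a q) * w q)"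
    by (subst sum.swap) (simp add: sum_distrib_right)
  also have "\<dots> = (\<Sum>q\<le>n. if b = q then w q else 0)"
    by (intro sum.cong) (simp_all add: inv)
  finally show ?thesis using b by simp
qed

text \<open>Transposes of invertible matrices keep the vectors nonzero, and \<open>g 0\<close> keeps
  the contraction nonzero.\<close>

lemma nondegenerate_multiact:
  assumes gh: "inverse_mats (k0 # ks) g h" and nd: "nondegenerate k0 ks A"
  shows "nondegenerate k0 ks (multiact (k0 # ks) g A)"
  unfolding nondegenerate_def
proof (intro allI impI)
  fix v :: "nat \<Rightarrow> nat \<Rightarrow> complex"
  assume v: "\<forall>t<length ks. \<exists>r\<le>ks ! t. v t r \<noteq> 0"
  have c: "g j \<in> carrier_mat ((k0 # ks) ! j + 1) ((k0 # ks) ! j + 1)" "h j \<in> carrier_mat ((k0 # ks) ! j + 1) ((k0 # ks) ! j + 1)"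
    and inv: "g j * h j = 1\<^sub>m ((k0 # ks) ! j + 1)" "h j * g j = 1\<^sub>m ((k0 # ks) ! j + 1)" if "j \<le> length ks" for j
    using gh that unfolding inverse_mats_def format_mats_def by (auto simp: less_Suc_eq_le)
  define v' where "v' t r = (\<Sum>q\<le>ks ! t. g (Suc t) $$ (q, r) * v t q)" for t r
  have "\<exists>r\<le>ks ! t. v' t r \<noteq> 0" if t: "t < length ks" for t
  proof (rule ccontr)
    assume "\<not> ?thesis"
    then have 0: "\<And>r. r \<le> ks ! t \<Longrightarrow> v' t r = 0" by blast
    obtain r where r: "r \<le> ks ! t" "v t r \<noteq> 0" using v t by blast
    have "v t r = 0"
    proof (rule left_inverse_zero)
      show "(\<Sum>q\<le>ks ! t. h (Suc t) $$ (q, r) * g (Suc t) $$ (s, q)) = (if r = s then 1 else 0)" if "s \<le> ks ! t" for s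
        using mat_times_index[of "g (Suc t)" "ks ! t" "h (Suc t)" s r] c[of "Suc t"] inv(1)[of "Suc t"] t r that
        by (cases "s = r") (auto simp: mult.commute)
    qed (use 0 r in \<open>simp_all add: v'_def\<close>)
    then show False using r by simp
  qed
  then obtain b where b: "b \<le> k0" "multilinear ks (\<lambda>i. A (b # i)) v' \<noteq> 0"
    using nd unfolding nondegenerate_def by blast
  define w where "w b = multilinear ks (\<lambda>i. A (b # i)) v'" for b
  have eq: "multilinear ks (\<lambda>i. multiact (k0 # ks) g A (a # i)) v = (\<Sum>b\<le>k0. g 0 $$ (a, b) * w b)" if "a \<le> k0" for a
    unfolding multilinear_multiact[OF that] w_def v'_def ..
  show "\<exists>a\<le>k0. multilinear ks (\<lambda>i. multiact (k0 # ks) g A (a # i)) v \<noteq> 0"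
  proof (rule ccontr)
    assume "\<not> ?thesis"
    then have 0: "\<And>a. a \<le> k0 \<Longrightarrow> (\<Sum>b\<le>k0. g 0 $$ (a, b) * w b) = 0" using eq by auto
    have "w b = 0"
    proof (rule left_inverse_zero[OF _ 0 b(1)])
      show "(\<Sum>a\<le>k0. h 0 $$ (b, a) * g 0 $$ (a, q)) = (if b = q then 1 else 0)" if "q \<le> k0" for q
        using mat_times_index[of "h 0" k0 "g 0" b q] c[of 0] inv(2)[of 0] b that by simp
    qed
    then show False using b by (simp add: w_def)
  qed
qed

text \<open>If the block vanished, only the \<open>sum_list s\<close> forms with index above
  \<open>k0 - sum_list s\<close> would remain on the product of projective spaces of dimensions
  \<open>s\<close>. They have a common zero, and extending it by 0 would contradict
  nondegeneracy.\<close>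

lemma nondegenerate_block:
  assumes nd: "nondegenerate k0 ks B" and s: "s \<in> indices ks" and k0: "k0 = sum_list ks"
  shows "\<exists>a\<le>k0 - sum_list s. \<exists>i\<in>indices s. B (a # i) \<noteq> 0"
proof -
  let ?E = "{k0 - sum_list s<..k0}"
  have len: "length s = length ks" using s by (rule indices_length)
  have "card ?E \<le> sum_list s" by simp
  then obtain v where v: "\<And>t. t < length s \<Longrightarrow> \<exists>r\<le>s ! t. v t r \<noteq> 0"
    "\<And>a. a \<in> ?E \<Longrightarrow> multilinear s (\<lambda>i. B (a # i)) v = 0"
    using multilinear_common_zero[of ?E s "\<lambda>a i. B (a # i)"] by blast
  define v' where "v' t r = (if r \<le> s ! t then v t r else 0)" for t r
  have "\<exists>r\<le>ks ! t. v' t r \<noteq> 0" if t: "t < length ks" for t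
  proof -
    obtain r where r: "r \<le> s ! t" "v t r \<noteq> 0" using v(1) t len by auto
    then show ?thesis using indices_nth[OF s t] by (intro exI[of _ r]) (auto simp: v'_def)
  qed
  then obtain a where a: "a \<le> k0" "multilinear ks (\<lambda>i. B (a # i)) v' \<noteq> 0"
    using nd unfolding nondegenerate_def by blast
  have sub: "indices s \<subseteq> indices ks"
    using s len by (auto simp: indices_def) (meson order.trans)
  have "multilinear ks (\<lambda>i. B (a # i)) v' = multilinear s (\<lambda>i. B (a # i)) v"
    unfolding multilinear_def
  proof (rule sum.mono_neutral_cong_right[OF finite_indices sub])
    show "\<forall>i\<in>indices ks - indices s. B (a # i) * (\<Prod>t<length ks. v' t (i ! t)) = 0"
    proof
      fix i assume i: "i \<in> indices ks - indices s"
      then obtain t where "t < length ks" "s ! t < i ! t" using len by (auto simp: indices_def not_le)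
      then have "(\<Prod>t<length ks. v' t (i ! t)) = 0" by (intro prod_zero bexI[of _ t]) (auto simp: v'_def)
      then show "B (a # i) * (\<Prod>t<length ks. v' t (i ! t)) = 0" by simp
    qed
    show "B (a # i) * (\<Prod>t<length ks. v' t (i ! t)) = B (a # i) * (\<Prod>t<length s. v t (i ! t))"
      if "i \<in> indices s" for i
      using indices_nth[OF that] len by (auto simp: v'_def intro!: arg_cong[where f = "(*) (B (a # i))"] prod.cong)
  qed
  then have nz: "multilinear s (\<lambda>i. B (a # i)) v \<noteq> 0" using a by simp
  then have "a \<le> k0 - sum_list s" using v(2)[of a] a(1) by (cases "a \<in> ?E") auto
  moreover have "\<exists>i\<in>indices s. B (a # i) \<noteq> 0"
    using nz by (auto simp: multilinear_def intro: ccontr)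
  ultimately show ?thesis by blast
qed

text \<open>All factors but \<open>V_0\<close> and one other are lines, so \<open>A\<close> is a
  square matrix \<open>M\<close>, invertible by nondegeneracy. With the columns of \<open>M\<close>
  as basis of \<open>V_0\<close> the coordinate array becomes the identity, supported where the two
  remaining indices agree.\<close>

lemma single_factor_triangulable:
  assumes nd: "nondegenerate k0 ks A" and A: "A \<in> tensors (k0 # ks)" and k0: "k0 = sum_list ks"
    and t: "t < length ks" and others: "\<And>u. u < length ks \<Longrightarrow> u \<noteq> t \<Longrightarrow> ks ! u = 0"
  shows "triangulable (k0 # ks) A"
proof -
  let ?k = "k0 # ks" and ?p = "length ks"
  define z where "z r = (replicate ?p 0)[t := r]" for r :: nat
  have z_nth: "z r ! u = (if u = t then r else 0)" if "u < ?p" for r u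
    using that t by (auto simp: z_def nth_list_update)
  have kt: "ks ! t = k0"
    using others t k0 by (auto simp: sum_list_sum_nth sum.remove[of _ t] atLeast0LessThan)
  have z_mem: "z r \<in> indices ks \<longleftrightarrow> r \<le> k0" for r
    using t kt by (auto simp: indices_def z_nth z_def nth_list_update)
  have z_eq: "i = z (i ! t)" if "i \<in> indices ks" for i
  proof (rule nth_equalityI)
    show "length i = length (z (i ! t))" using that by (simp add: indices_length z_def)
    fix u assume "u < length i"
    then have u: "u < ?p" using that by (simp add: indices_length)
    show "i ! u = z (i ! t) ! u" using indices_nth[OF that u] others[OF u] unfolding z_nth[OF u] by auto
  qed
  have indices_z: "indices ks = z ` {..k0}"
  proof (rule equalityI; rule subsetI)
    fix i assume "i \<in> indices ks"
    then show "i \<in> z ` {..k0}" using z_eq[of i] indices_nth[of i ks t] t kt by auto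
  next
    fix i assume "i \<in> z ` {..k0}"
    then show "i \<in> indices ks" using z_mem by auto
  qed
  have inj: "inj_on z {..k0}" using t by (auto simp: inj_on_def z_def) (metis length_replicate nth_list_update_eq)
  define M where "M = mat (k0 + 1) (k0 + 1) (\<lambda>(a, r). A (a # z r))"
  have Mc: "M \<in> carrier_mat (k0 + 1) (k0 + 1)" by (simp add: M_def)
  have "det M \<noteq> 0"
  proof
    assume "det M = 0"
    then obtain v where v: "v \<in> carrier_vec (k0 + 1)" "v \<noteq> 0\<^sub>v (k0 + 1)" "M *\<^sub>v v = 0\<^sub>v (k0 + 1)"
      using det_0_iff_vec_prod_zero[OF Mc] by blast
    \<comment> \<open>The kernel vector is completed by 1 in the one-dimensional factors, so that
      every factor is nonzero.\<close>
    define w where "w u r = (if u = t then v $ r else 1)" for u r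
    have "\<exists>r\<le>ks ! u. w u r \<noteq> 0" for u
    proof (cases "u = t")
      case True
      then show ?thesis using v(1,2) kt by (auto simp: w_def less_Suc_eq_le vec_eq_iff)
    qed (auto simp: w_def)
    then obtain a where a: "a \<le> k0" "multilinear ks (\<lambda>i. A (a # i)) w \<noteq> 0"
      using nd unfolding nondegenerate_def by blast
    have "multilinear ks (\<lambda>i. A (a # i)) w = (\<Sum>r\<le>k0. A (a # z r) * v $ r)"
      unfolding multilinear_def indices_z using t
      by (subst sum.reindex[OF inj]) (auto simp: w_def z_nth prod.remove[of _ t] intro!: sum.cong)
    also have "\<dots> = (M *\<^sub>v v) $ a"
      using a v(1) by (simp add: M_def scalar_prod_def atLeast0LessThan lessThan_Suc_atMost del: sum.op_ivl_Suc)
    also have "\<dots> = 0" using v a by simp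
    finally show False using a by simp
  qed
  then have "invertible_mat M" using Mc det_non_zero_imp_unit[OF Mc]
    by (auto simp: invertible_mat_iff[OF Mc] Units_def ring_mat_def)
  then obtain M' where M': "M' \<in> carrier_mat (k0 + 1) (k0 + 1)" "M * M' = 1\<^sub>m (k0 + 1)" "M' * M = 1\<^sub>m (k0 + 1)"
    using invertible_mat_iff[OF Mc] by blast
  define e where "e j = (if j = 0 then M else 1\<^sub>m (?k ! j + 1))" for j
  define h where "h j = (if j = 0 then M' else 1\<^sub>m (?k ! j + 1))" for j
  define a where "a i = (if i \<in> indices ?k \<and> i ! 0 = i ! Suc t then 1 else 0 :: complex)" for i
  have eh: "inverse_mats ?k e h"
    using M' Mc by (auto simp: inverse_mats_def format_mats_def e_def h_def)
  have "A = multiact ?k e a"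
  proof
    fix i
    show "A i = multiact ?k e a i"
    proof (cases "i \<in> indices ?k")
      case True
      then obtain b js where i: "i = b # js" and b: "b \<le> k0" and js: "js \<in> indices ks" by (auto simp: indices_Cons)
      have jt: "js ! t \<le> k0" using indices_nth[OF js t] kt by simp
      have tail: "multiact ks (\<lambda>u. e (Suc u)) (\<lambda>l. a (c # l)) js = a (c # js)" for c
        by (rule multiact_one_index[OF _ js]) (simp add: e_def)
      have "multiact ?k e a i = (\<Sum>c\<le>k0. e 0 $$ (b, c) * (if c = js ! t then 1 else 0))"
        unfolding i multiact_Cons[OF b js] tail using js by (intro sum.cong) (auto simp: a_def)
      also have "\<dots> = (\<Sum>c\<le>k0. if c = js ! t then e 0 $$ (b, c) else 0)" by (intro sum.cong) auto
      also have "\<dots> = A (b # z (js ! t))" using jt b by (simp add: e_def M_def)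
      finally show ?thesis using z_eq[OF js] i by simp
    next
      case False
      then show ?thesis using A by (simp add: tensors_def multiact_def)
    qed
  qed
  moreover have "a i = 0" if i: "i \<in> indices ?k" and gt: "i ! 0 > sum_list (tl i)" for i
  proof -
    obtain b js where i': "i = b # js" "js \<in> indices ks" using i by (auto simp: indices_Cons)
    then have "js ! t \<le> sum_list js" using t elem_le_sum_list[of t js] by (simp add: indices_length)
    then show ?thesis using gt i' by (simp add: a_def)
  qed
  moreover have "a \<in> tensors ?k" by (auto simp: tensors_def a_def)
  ultimately show ?thesis using eh unfolding triangulable_iff by blast
qed

section \<open>Integrality or triangularity\<close>

text \<open>
  The diagonal entries obtained from \<open>smith_form_exists\<close> have increasing values in all factors, whereas
  \<open>triangulable\<close> needs decreasing ones in \<open>V\<^sub>0\<close>.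
\<close>

definition reversal :: "nat \<Rightarrow> complex mat" where
  "reversal m = mat (m + 1) (m + 1) (\<lambda>(i, j). if i + j = m then 1 else 0)"

lemma reversal_carrier [simp]: "reversal m \<in> carrier_mat (m + 1) (m + 1)"
  by (simp add: reversal_def)

lemma reversal_index: "i \<le> m \<Longrightarrow> j \<le> m \<Longrightarrow> reversal m $$ (i, j) = (if j = m - i then 1 else 0)"
  by (auto simp: reversal_def)

lemma reversal_times_reversal: "reversal m * reversal m = 1\<^sub>m (m + 1)"
proof (rule eq_matI)
  fix i j assume "i < dim_row (1\<^sub>m (m + 1) :: complex mat)" "j < dim_col (1\<^sub>m (m + 1) :: complex mat)"
  then have ij: "i \<le> m" "j \<le> m" by auto
  have "(reversal m * reversal m) $$ (i, j) = (\<Sum>c\<le>m. reversal m $$ (i, c) * reversal m $$ (c, j))"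
    by (rule mat_times_index) (use ij reversal_carrier in \<open>auto simp del: One_nat_def reversal_carrier\<close>)
  also have "\<dots> = (\<Sum>c\<le>m. if c = m - i then (if i = j then 1 else 0) else 0)"
    using ij by (intro sum.cong) (auto simp: reversal_index)
  finally show "(reversal m * reversal m) $$ (i, j) = 1\<^sub>m (m + 1) $$ (i, j)"
    using ij by simp
qed (simp_all add: reversal_def)

lemma triangulable_of_reversed:
  assumes gh: "inverse_mats (k0 # ks) g h" and A: "A \<in> tensors (k0 # ks)"
    and zero: "\<And>a i. a \<le> k0 \<Longrightarrow> i \<in> indices ks \<Longrightarrow> sum_list i < k0 - a \<Longrightarrow> multiact (k0 # ks) g A (a # i) = 0"
  shows "triangulable (k0 # ks) A"
proof -
  let ?k = "k0 # ks"
  define R where "R j = (if j = 0 then reversal k0 else 1\<^sub>m (?k ! j + 1))" for j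
  have R: "inverse_mats ?k R R"
    by (auto simp: inverse_mats_def format_mats_def R_def reversal_times_reversal simp del: One_nat_def)
  define e where "e j = h j * R j" for j
  define e' where "e' j = R j * g j" for j
  have c: "g j \<in> carrier_mat (?k ! j + 1) (?k ! j + 1)" "h j \<in> carrier_mat (?k ! j + 1) (?k ! j + 1)"
    "R j \<in> carrier_mat (?k ! j + 1) (?k ! j + 1)"
    and inv: "g j * h j = 1\<^sub>m (?k ! j + 1)" "h j * g j = 1\<^sub>m (?k ! j + 1)" "R j * R j = 1\<^sub>m (?k ! j + 1)"
    if "j < length ?k" for j
    using gh R that unfolding inverse_mats_def format_mats_def by blast+
  have "e j * e' j = 1\<^sub>m (?k ! j + 1) \<and> e' j * e j = 1\<^sub>m (?k ! j + 1)" if j: "j < length ?k" for j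
  proof -
    let ?n = "?k ! j + 1"
    have "e j * e' j = h j * (R j * R j) * g j" "e' j * e j = R j * (g j * h j) * R j"
      using c[OF j] by (simp_all add: e_def e'_def assoc_mult_mat[of _ ?n ?n _ ?n _ ?n] mult_carrier_mat[of _ ?n ?n _ ?n] del: One_nat_def)
    then show ?thesis using c[OF j] inv[OF j] by simp
  qed
  then have ee': "inverse_mats ?k e e'"
    using c unfolding inverse_mats_def format_mats_def e_def e'_def by (auto simp del: One_nat_def intro!: mult_carrier_mat)
  define a where "a = multiact ?k e' A"
  have a_eq: "a = multiact ?k R (multiact ?k g A)"
    unfolding a_def e'_def using R gh by (subst multiact_multiact) (auto simp: inverse_mats_def)
  have "A = multiact ?k e a"
    unfolding a_def by (rule multiact_inverse[OF ee', symmetric]) (use A in \<open>simp add: tensors_def\<close>)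
  moreover have "a \<in> tensors ?k" by (auto simp: a_def tensors_def multiact_def)
  moreover have "a i = 0" if i: "i \<in> indices ?k" and gt: "i ! 0 > sum_list (tl i)" for i
  proof -
    obtain b js where i': "i = b # js" and b: "b \<le> k0" and js: "js \<in> indices ks" using i by (auto simp: indices_Cons)
    have "multiact ks (\<lambda>t. R (Suc t)) (\<lambda>l. multiact ?k g A (c # l)) js = multiact ?k g A (c # js)" for c
      by (rule multiact_one_index[OF _ js]) (simp add: R_def)
    then have "a i = (\<Sum>c\<le>k0. R 0 $$ (b, c) * multiact ?k g A (c # js))"
      unfolding a_eq i' multiact_Cons[OF b js] by simp
    also have "\<dots> = (\<Sum>c\<le>k0. if c = k0 - b then multiact ?k g A (c # js) else 0)"
      using b by (intro sum.cong) (auto simp: R_def reversal_index)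
    also have "\<dots> = multiact ?k g A ((k0 - b) # js)" by simp
    also have "\<dots> = 0" using gt i' b js by (intro zero) auto
    finally show ?thesis .
  qed
  ultimately show ?thesis using ee' unfolding triangulable_iff by blast
qed

context place
begin

lemma map_mat_\<chi>_times:
  assumes "A \<in> integral_mats m n" "B \<in> integral_mats n l"
  shows "map_mat \<chi> (A * B) = map_mat \<chi> A * map_mat \<chi> B"
proof (rule eq_matI)
  fix i j assume "i < dim_row (map_mat \<chi> A * map_mat \<chi> B)" "j < dim_col (map_mat \<chi> A * map_mat \<chi> B)"
  then have ij: "i < m" "j < l" using assms by (auto simp: integral_mats_def)
  have mem: "A $$ (i, q) \<in> \<O>" "B $$ (q, j) \<in> \<O>" if "q < n" for q
    using assms ij that by (auto simp: integral_mats_def)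
  have "map_mat \<chi> (A * B) $$ (i, j) = \<chi> (\<Sum>q<n. A $$ (i, q) * B $$ (q, j))"
    using assms ij by (auto simp: integral_mats_def scalar_prod_def atLeast0LessThan)
  also have "\<dots> = (\<Sum>q<n. \<chi> (A $$ (i, q)) * \<chi> (B $$ (q, j)))"
    by (subst \<chi>_sum) (auto simp: \<chi>_mult mem intro: mult_mem)
  also have "\<dots> = (map_mat \<chi> A * map_mat \<chi> B) $$ (i, j)"
    using assms ij by (auto simp: integral_mats_def scalar_prod_def atLeast0LessThan intro!: sum.cong)
  finally show "map_mat \<chi> (A * B) $$ (i, j) = (map_mat \<chi> A * map_mat \<chi> B) $$ (i, j)" .
qed (use assms in \<open>auto simp: integral_mats_def\<close>)

lemma map_mat_\<chi>_one: "map_mat \<chi> (1\<^sub>m n) = 1\<^sub>m n"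
  by (rule eq_matI) auto

lemma det_mem:
  assumes "M \<in> integral_mats n n"
  shows "det M \<in> \<O>" "\<chi> (det M) = det (map_mat \<chi> M)"
proof -
  have sign: "signof p \<in> \<O> \<and> \<chi> (signof p) = signof p" for p
    using uminus_mem[OF one_mem] \<chi>_uminus[OF one_mem] by (cases p rule: sign_cases) simp_all
  have M: "M \<in> carrier_mat n n" "map_mat \<chi> M \<in> carrier_mat n n" using assms by (auto simp: integral_mats_def)
  have mem: "M $$ (i, p i) \<in> \<O>" if "p permutes {0..<n}" "i \<in> {0..<n}" for p i
    using assms that permutes_in_image[OF that(1), of i] by (auto simp: integral_mats_def)
  then have mem': "(\<Prod>i = 0..<n. M $$ (i, p i)) \<in> \<O>" if "p permutes {0..<n}" for p
    using that by (intro prod_mem) auto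
  show "det M \<in> \<O>"
    unfolding det_def'[OF M(1)] using sign mem' by (intro sum_mem mult_mem) auto
  show "\<chi> (det M) = det (map_mat \<chi> M)"
    unfolding det_def'[OF M(1)] det_def'[OF M(2)]
  proof (subst \<chi>_sum)
    show "signof p * (\<Prod>i = 0..<n. M $$ (i, p i)) \<in> \<O>" if "p \<in> {p. p permutes {0..<n}}" for p
      using sign mem' that by (intro mult_mem) auto
    show "(\<Sum>p\<in>{p. p permutes {0..<n}}. \<chi> (signof p * (\<Prod>i = 0..<n. M $$ (i, p i)))) =
      (\<Sum>p\<in>{p. p permutes {0..<n}}. signof p * (\<Prod>i = 0..<n. map_mat \<chi> M $$ (i, p i)))"
    proof (rule sum.cong[OF refl])
      fix p assume "p \<in> {p. p permutes {0..<n}}"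
      then have p: "p permutes {0..<n}" by simp
      have "\<chi> (signof p * (\<Prod>i = 0..<n. M $$ (i, p i))) = signof p * (\<Prod>i = 0..<n. \<chi> (M $$ (i, p i)))"
        using sign[of p] mem'[OF p] \<chi>_prod[of "{0..<n}" "\<lambda>i. M $$ (i, p i)"] mem[OF p] by (simp add: \<chi>_mult)
      also have "(\<Prod>i = 0..<n. \<chi> (M $$ (i, p i))) = (\<Prod>i = 0..<n. map_mat \<chi> M $$ (i, p i))"
        using M permutes_in_image[OF p] by (intro prod.cong) auto
      finally show "\<chi> (signof p * (\<Prod>i = 0..<n. M $$ (i, p i))) =
        signof p * (\<Prod>i = 0..<n. map_mat \<chi> M $$ (i, p i))" .
    qed
  qed
qed

lemma unit_det:
  assumes "U \<in> integral_GL n"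
  shows "unit (det U)"
proof -
  obtain U' where U: "U \<in> integral_mats n n" "U' \<in> integral_mats n n" "U * U' = 1\<^sub>m n"
    using assms unfolding integral_GL_def by blast
  have "det (U * U') = det U * det U'"
    by (rule det_mult[OF integral_mats_carrier[OF U(1)] integral_mats_carrier[OF U(2)]])
  then have "det U * det U' = 1" by (simp only: U(3) det_one)
  then have "unit (det U * det U')" by simp
  then show ?thesis by (rule unit_of_mult[OF det_mem(1)[OF U(1)] det_mem(1)[OF U(2)]])
qed

lemma multiact_mem:
  assumes "\<And>j. j < length k \<Longrightarrow> V j \<in> integral_mats (k ! j + 1) (k ! j + 1)" "\<And>i. i \<in> indices k \<Longrightarrow> x i \<in> \<O>"
  shows "multiact k V x i \<in> \<O>"
    "\<chi> (multiact k V x i) = multiact k (\<lambda>j. map_mat \<chi> (V j)) (\<lambda>i. \<chi> (x i)) i"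
proof -
  have mem: "V j $$ (i ! j, l ! j) \<in> \<O>" if "i \<in> indices k" "l \<in> indices k" "j < length k" for i l j
    using integral_mats_index[OF assms(1)[OF that(3)]] indices_nth[OF that(1,3)] indices_nth[OF that(2,3)] by simp
  show "multiact k V x i \<in> \<O>"
    by (auto simp: multiact_def intro!: sum_mem mult_mem prod_mem mem assms(2))
  have "\<chi> (\<Sum>l\<in>indices k. (\<Prod>j<length k. V j $$ (i ! j, l ! j)) * x l) =
    (\<Sum>l\<in>indices k. (\<Prod>j<length k. map_mat \<chi> (V j) $$ (i ! j, l ! j)) * \<chi> (x l))" if i: "i \<in> indices k"
  proof (subst \<chi>_sum)
    show "(\<Prod>j<length k. V j $$ (i ! j, l ! j)) * x l \<in> \<O>" if "l \<in> indices k" for l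
      using mem[OF i that] assms(2)[OF that] by (intro mult_mem prod_mem) auto
    show "(\<Sum>l\<in>indices k. \<chi> ((\<Prod>j<length k. V j $$ (i ! j, l ! j)) * x l)) =
      (\<Sum>l\<in>indices k. (\<Prod>j<length k. map_mat \<chi> (V j) $$ (i ! j, l ! j)) * \<chi> (x l))"
    proof (rule sum.cong[OF refl])
      fix l assume l: "l \<in> indices k"
      have "\<chi> ((\<Prod>j<length k. V j $$ (i ! j, l ! j)) * x l) = (\<Prod>j<length k. \<chi> (V j $$ (i ! j, l ! j))) * \<chi> (x l)"
      proof -
        have "(\<Prod>j<length k. V j $$ (i ! j, l ! j)) \<in> \<O>" using mem[OF i l] by (intro prod_mem) auto
        then show ?thesis
          using assms(2)[OF l] mem[OF i l] \<chi>_prod[of "{..<length k}" "\<lambda>j. V j $$ (i ! j, l ! j)"]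
          by (simp add: \<chi>_mult)
      qed
      also have "(\<Prod>j<length k. \<chi> (V j $$ (i ! j, l ! j))) = (\<Prod>j<length k. map_mat \<chi> (V j) $$ (i ! j, l ! j))"
        using integral_mats_carrier[OF assms(1)] indices_nth[OF i] indices_nth[OF l]
        by (intro prod.cong) (force simp: less_Suc_eq_le)+
      finally show "\<chi> ((\<Prod>j<length k. V j $$ (i ! j, l ! j)) * x l) =
        (\<Prod>j<length k. map_mat \<chi> (V j) $$ (i ! j, l ! j)) * \<chi> (x l)" .
    qed
  qed
  then show "\<chi> (multiact k V x i) = multiact k (\<lambda>j. map_mat \<chi> (V j)) (\<lambda>i. \<chi> (x i)) i"
    by (simp add: multiact_def)
qed

lemma divides_in_mem: "divides_in x y \<Longrightarrow> x \<in> \<O> \<Longrightarrow> y \<in> \<O>"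
  by (auto simp: divides_in_def intro: mult_mem)

lemma divides_in_mult: "divides_in x y \<Longrightarrow> divides_in x' y' \<Longrightarrow> divides_in (x * x') (y * y')"
proof -
  assume "divides_in x y" "divides_in x' y'"
  then obtain z z' where "z \<in> \<O>" "z' \<in> \<O>" "y = x * z" "y' = x' * z'" by (auto simp: divides_in_def)
  then show ?thesis unfolding divides_in_def by (intro bexI[of _ "z * z'"] mult_mem) simp_all
qed

lemma divides_in_prod: "(\<And>i. i \<in> I \<Longrightarrow> divides_in (f i) (g i)) \<Longrightarrow> divides_in (prod f I) (prod g I)"
  by (induction I rule: infinite_finite_induct) (auto intro: divides_in_mult divides_in_refl)

lemma unit_mult_iff: "unit x \<Longrightarrow> unit (x * y) \<longleftrightarrow> unit y"
  using unit_mult[of "inverse x" "x * y"] unit_inverse[of x] unit_mult[of x y]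
  by (auto simp: unit_def[of x] mult.assoc[symmetric])

theorem integral_or_triangulable:
  assumes k0: "k0 = sum_list ks" "k0 > 0" and nd: "nondegenerate k0 ks A" and A: "A \<in> tensors (k0 # ks)"
    and g: "format_mats (k0 # ks) g" and det: "\<And>j. j \<le> length ks \<Longrightarrow> det (g j) = 1"
    and gA: "\<And>i. i \<in> indices (k0 # ks) \<Longrightarrow> multiact (k0 # ks) g (\<lambda>i. \<iota> (A i)) i \<in> \<O>"
  shows "triangulable (k0 # ks) A \<or> (\<forall>j\<le>length ks. g j \<in> integral_mats ((k0 # ks) ! j + 1) ((k0 # ks) ! j + 1))"
proof (rule disjCI)
  let ?k = "k0 # ks"
  assume not_int: "\<not> (\<forall>j\<le>length ks. g j \<in> integral_mats (?k ! j + 1) (?k ! j + 1))"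
  have gc: "g j \<in> carrier_mat (?k ! j + 1) (?k ! j + 1)" if "j < length ?k" for j
    using g that by (auto simp: format_mats_def)
  have "\<forall>j. \<exists>U d V. j < length ?k \<longrightarrow> smith_form (?k ! j + 1) (g j) U d V"
  proof
    fix j
    show "\<exists>U d V. j < length ?k \<longrightarrow> smith_form (?k ! j + 1) (g j) U d V"
    proof (cases "j < length ?k")
      case True
      then obtain U d V where "smith_form (?k ! j + 1) (g j) U d V"
        using smith_form_exists[OF gc[OF True]] by (elim exE conjE)
      then show ?thesis by blast
    qed blast
  qed
  then obtain U d V where smith: "\<forall>j. j < length ?k \<longrightarrow> smith_form (?k ! j + 1) (g j) (U j) (d j) (V j)"
    unfolding choice_iff by (elim exE)
  have U: "U j \<in> integral_GL (?k ! j + 1)" and V: "V j \<in> integral_GL (?k ! j + 1)"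
    and gj: "g j = U j * diagonal (?k ! j + 1) (d j) * V j"
    and chain: "\<And>a b. a \<le> b \<Longrightarrow> b \<le> ?k ! j \<Longrightarrow> divides_in (d j a) (d j b)" if "j < length ?k" for j
    using smith[rule_format, OF that] by (auto simp: smith_form_def)
  have "\<forall>j. \<exists>U'. j < length ?k \<longrightarrow> U' \<in> integral_mats (?k ! j + 1) (?k ! j + 1) \<and>
      U j * U' = 1\<^sub>m (?k ! j + 1) \<and> U' * U j = 1\<^sub>m (?k ! j + 1)"
    using U unfolding integral_GL_def by blast
  then obtain U' where U': "\<And>j. j < length ?k \<Longrightarrow> U' j \<in> integral_mats (?k ! j + 1) (?k ! j + 1)"
    "\<And>j. j < length ?k \<Longrightarrow> U' j * U j = 1\<^sub>m (?k ! j + 1)" unfolding choice_iff by blast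
  have "\<forall>j. \<exists>V'. j < length ?k \<longrightarrow> V' \<in> integral_mats (?k ! j + 1) (?k ! j + 1) \<and>
      V j * V' = 1\<^sub>m (?k ! j + 1) \<and> V' * V j = 1\<^sub>m (?k ! j + 1)"
    using V unfolding integral_GL_def by blast
  then obtain V' where V': "\<And>j. j < length ?k \<Longrightarrow> V' j \<in> integral_mats (?k ! j + 1) (?k ! j + 1)"
    "\<And>j. j < length ?k \<Longrightarrow> V j * V' j = 1\<^sub>m (?k ! j + 1)"
    "\<And>j. j < length ?k \<Longrightarrow> V' j * V j = 1\<^sub>m (?k ! j + 1)" unfolding choice_iff by blast
  note Ui = integral_GL_integral[OF U] and Vi = integral_GL_integral[OF V]
  note Uc = integral_GL_carrier[OF U] and Vc = integral_GL_carrier[OF V] and U'c = integral_mats_carrier[OF U'(1)]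
  define D where "D j = diagonal (?k ! j + 1) (d j)" for j
  have Dc: "D j \<in> carrier_mat (?k ! j + 1) (?k ! j + 1)" for j unfolding D_def by (rule diagonal_carrier)
  \<comment> \<open>\<open>w\<close> is integral and reduces to \<open>B\<close>; applying the
    integral inverse of \<open>U\<close> to \<open>g A\<close> will show that \<open>D\<close>
    applied to \<open>w\<close> is integral too.\<close>
  define w where "w = multiact ?k V (\<lambda>i. \<iota> (A i))"
  define W where "W j = map_mat \<chi> (V j)" for j
  define B where "B = multiact ?k W A"
  have w: "w i \<in> \<O>" "\<chi> (w i) = B i" for i
    unfolding w_def B_def W_def using multiact_mem[of ?k V "\<lambda>i. \<iota> (A i)"] Vi const_mem by (simp_all add: \<chi>_const)
  have W: "inverse_mats ?k W (\<lambda>j. map_mat \<chi> (V' j))"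
    unfolding inverse_mats_def format_mats_def W_def
  proof (intro conjI allI impI)
    fix j assume j: "j < length ?k"
    show "map_mat \<chi> (V j) \<in> carrier_mat (?k ! j + 1) (?k ! j + 1)"
      "map_mat \<chi> (V' j) \<in> carrier_mat (?k ! j + 1) (?k ! j + 1)"
      using Vc[OF j] integral_mats_carrier[OF V'(1)[OF j]] by simp_all
    show "map_mat \<chi> (V j) * map_mat \<chi> (V' j) = 1\<^sub>m (?k ! j + 1)"
      "map_mat \<chi> (V' j) * map_mat \<chi> (V j) = 1\<^sub>m (?k ! j + 1)"
      using map_mat_\<chi>_times[OF Vi[OF j] V'(1)[OF j]] map_mat_\<chi>_times[OF V'(1)[OF j] Vi[OF j]]
        V'(2,3)[OF j] map_mat_\<chi>_one by simp_all
  qed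
  have ndB: "nondegenerate k0 ks B" unfolding B_def by (rule nondegenerate_multiact[OF W nd])
  have "U' j * g j = D j * V j" if j: "j < length ?k" for j
  proof -
    let ?n = "?k ! j + 1"
    have "U' j * g j = (U' j * U j) * D j * V j"
      unfolding gj[OF j] D_def[symmetric] using Uc[OF j] Vc[OF j] U'c[OF j] Dc[of j]
      by (simp add: assoc_mult_mat[of _ ?n ?n _ ?n _ ?n] mult_carrier_mat[of _ ?n ?n _ ?n] del: One_nat_def)
    then show ?thesis using U'(2)[OF j] Dc[of j] by simp
  qed
  then have "multiact ?k U' (multiact ?k g (\<lambda>i. \<iota> (A i))) = multiact ?k (\<lambda>j. D j * V j) (\<lambda>i. \<iota> (A i))"
    using g U'c by (subst multiact_multiact) (auto simp: format_mats_def intro!: multiact_cong)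
  also have "\<dots> = multiact ?k D w"
    unfolding w_def using Vc Dc by (subst multiact_multiact) (auto simp: format_mats_def simp del: One_nat_def)
  finally have Dw: "multiact ?k U' (multiact ?k g (\<lambda>i. \<iota> (A i))) = multiact ?k D w" .
  have dw: "(\<Prod>j<length ?k. d j (i ! j)) * w i \<in> \<O>" if i: "i \<in> indices ?k" for i
  proof -
    have "multiact ?k D w i = (\<Prod>j<length ?k. d j (i ! j)) * w i"
      by (rule multiact_diagonal[OF _ i]) (simp add: D_def diagonal_index)
    moreover have "multiact ?k U' (multiact ?k g (\<lambda>i. \<iota> (A i))) i \<in> \<O>"
      by (rule multiact_mem(1)) (use U'(1) gA in auto)
    ultimately show ?thesis using Dw by simp
  qed
  \<comment> \<open>The index of \<open>V_0\<close> is reversed: \<open>a (sum_list s)\<close> is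
    then the diagonal entry of largest value in the range \<open>c \<le> k0 - sum_list s\<close> of
    a block.\<close>
  define a where "a n = d 0 (k0 - n)" for n
  define b where "b t r = d (Suc t) r" for t r
  \<comment> \<open>Where \<open>B\<close> is nonzero the entry of \<open>w\<close> is a unit, and
    cancelling it leaves the product of diagonal entries.\<close>
  have support: "d 0 c * (\<Prod>t<length ks. b t (i ! t)) \<in> \<O>" if c: "c \<le> k0" and i: "i \<in> indices ks" and nz: "B (c # i) \<noteq> 0" for c i
  proof -
    have ci: "c # i \<in> indices ?k" using c i by simp
    have \<chi>w: "\<chi> (w (c # i)) \<noteq> 0" using w(2)[of "c # i"] nz by simp
    have "w (c # i) \<noteq> 0" using \<chi>w by (metis \<chi>_zero)
    moreover have "(\<Prod>j<length ?k. d j ((c # i) ! j)) * w (c # i) * inverse (w (c # i)) \<in> \<O>"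
      by (rule mult_mem[OF dw[OF ci] inverse_mem_of_\<chi>[OF w(1) \<chi>w]])
    ultimately have "(\<Prod>j<length ?k. d j ((c # i) ! j)) \<in> \<O>"
      by (simp add: mult.assoc del: prod.lessThan_Suc length_Cons list.size)
    then show ?thesis by (simp add: prod.lessThan_Suc_shift b_def del: prod.lessThan_Suc)
  qed
  \<comment> \<open>The values of \<open>d\<close> increase, so integrality at some nonzero entry of
    the block carries over to its far corner.\<close>
  have mem: "a (sum_list s) * (\<Prod>t<length ks. b t (s ! t)) \<in> \<O>" if s: "s \<in> indices ks" for s
  proof -
    obtain c i where c: "c \<le> k0 - sum_list s" and i: "i \<in> indices s" and nz: "B (c # i) \<noteq> 0"
      using nondegenerate_block[OF ndB s k0(1)] by blast
    have len: "length s = length ks" using s by (rule indices_length)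
    have i': "i \<in> indices ks" using s i len by (auto simp: indices_def) (meson order.trans)
    have "divides_in (d 0 c * (\<Prod>t<length ks. b t (i ! t))) (a (sum_list s) * (\<Prod>t<length ks. b t (s ! t)))"
      unfolding a_def b_def using chain[of 0] c chain[of "Suc _"] indices_nth[OF i] indices_nth[OF s] len
      by (intro divides_in_mult divides_in_prod) auto
    then show ?thesis using support[OF _ i' nz] c divides_in_mem by auto
  qed
  \<comment> \<open>\<open>U j\<close> and \<open>V j\<close> have unit determinants, so determinant
    1 of \<open>g j\<close> makes the values in each factor add up to 0.\<close>
  have dprod: "unit (\<Prod>r\<le>?k ! j. d j r)" if j: "j < length ?k" for j
  proof -
    let ?n = "?k ! j + 1"
    have "det (g j) = det (U j * D j) * det (V j)"
      unfolding gj[OF j] D_def[symmetric] by (rule det_mult[OF mult_carrier_mat[OF Uc[OF j] Dc] Vc[OF j]])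
    also have "det (U j * D j) = det (U j) * det (D j)" by (rule det_mult[OF Uc[OF j] Dc])
    also have "det (g j) = 1" using det j by simp
    finally have "det (U j) * det (V j) * det (D j) = 1" by (simp add: mult_ac)
    then have "unit (det (U j) * det (V j) * det (D j))" by simp
    then have "unit (det (D j))" using unit_det[OF U[OF j]] unit_det[OF V[OF j]] by (simp add: unit_mult unit_mult_iff)
    then show ?thesis by (simp add: D_def det_diagonal lessThan_Suc_atMost)
  qed
  have a_prod: "unit (\<Prod>n\<le>sum_list ks. a n)"
  proof -
    have "(\<Prod>n\<le>k0. a n) = (\<Prod>r\<le>k0. d 0 r)"
      by (rule prod.reindex_bij_witness[of _ "\<lambda>r. k0 - r" "\<lambda>r. k0 - r"]) (auto simp: a_def)
    then show ?thesis using dprod[of 0] k0 by simp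
  qed
  have b_prod: "unit (\<Prod>r\<le>ks ! t. b t r)" if "t < length ks" for t
    using dprod[of "Suc t"] that by (simp add: b_def)
  have units: "unit (a (sum_list s) * (\<Prod>t<length ks. b t (s ! t)))" if "s \<in> indices ks" for s
    by (rule unit_of_prod_units[OF mem a_prod b_prod that])
  obtain t1 where t1: "t1 < length ks" "ks ! t1 > 0"
  proof -
    have "\<exists>t<length ks. ks ! t \<noteq> 0" using k0 by (auto simp: sum_list_sum_nth intro: ccontr)
    then show ?thesis using that by auto
  qed
  show "triangulable ?k A"
  proof (cases "\<exists>t2<length ks. t2 \<noteq> t1 \<and> ks ! t2 > 0")
    case False
    then show ?thesis by (intro single_factor_triangulable[OF nd A k0(1) t1(1)]) auto
  next
    case True
    then obtain t2 where t2: "t2 < length ks" "t1 \<noteq> t2" "ks ! t2 > 0" by blast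
    obtain c where c: "c \<noteq> 0" and ac: "\<And>n. n \<le> k0 \<Longrightarrow> unit (a 0 / (a n * c ^ n))"
      and bc: "\<And>t r. t < length ks \<Longrightarrow> r \<le> ks ! t \<Longrightarrow> unit (b t r / (b t 0 * c ^ r))"
      using unit_exponents[of ks a b, OF units t1(1) t2(1,2) t1(2) t2(3)] k0(1) by blast
    have a_nz: "a n \<noteq> 0" if "n \<le> k0" for n using ac[OF that] by (auto simp: unit_def)
    have b_nz: "b t 0 \<noteq> 0" if "t < length ks" for t using bc[OF that, of 0] by (auto simp: unit_def)
    \<comment> \<open>If the common difference were 0, the values in each factor would be equal with
      sum 0, hence all 0, and \<open>g\<close> would be integral.\<close>
    have "\<not> unit c"
    proof
      assume uc: "unit c"
      have b1: "unit (b t r / b t 0)" if "t < length ks" "r \<le> ks ! t" for t r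
        using unit_mult[OF bc[OF that] unit_power[OF uc, of r]] c by simp
      have b0: "unit (b t 0)" if t: "t < length ks" for t
      proof -
        have "(\<Prod>r\<le>ks ! t. b t r) / (\<Prod>r\<le>ks ! t. b t r / b t 0) = b t 0 ^ Suc (ks ! t)"
          using b_prod[OF t] by (simp add: prod_dividef unit_def[of "prod _ _"])
        moreover have "unit ((\<Prod>r\<le>ks ! t. b t r) / (\<Prod>r\<le>ks ! t. b t r / b t 0))"
          by (intro unit_divide b_prod[OF t] unit_prod b1 t) simp
        ultimately show ?thesis by (intro unit_of_power[of "b t 0" "Suc (ks ! t)"]) simp_all
      qed
      have bu: "b t r \<in> \<O>" if "t < length ks" "r \<le> ks ! t" for t r
        using unit_mult[OF b0[OF that(1)] b1[OF that]] b_nz[OF that(1)] by (simp add: unit_def)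
      have a1: "unit (a 0 / a n)" if "n \<le> k0" for n
        using unit_mult[OF ac[OF that] unit_power[OF uc, of n]] c by simp
      have a0: "unit (a 0)"
      proof -
        have "(\<Prod>n\<le>k0. a n) * (\<Prod>n\<le>k0. a 0 / a n) = a 0 ^ Suc k0"
          using a_prod k0(1) by (simp add: prod_dividef unit_def[of "prod _ _"])
        moreover have "unit ((\<Prod>n\<le>k0. a n) * (\<Prod>n\<le>k0. a 0 / a n))"
          using a_prod k0(1) unit_prod[of "{..k0}" "\<lambda>n. a 0 / a n"] a1 by (intro unit_mult) simp_all
        ultimately show ?thesis by (intro unit_of_power[of "a 0" "Suc k0"]) simp_all
      qed
      have au: "a n \<in> \<O>" if "n \<le> k0" for n
      proof -
        have "a n = a 0 / (a 0 / a n)" using a_nz[of 0] by simp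
        then show ?thesis using unit_divide[OF a0 a1[OF that]] by (simp add: unit_def)
      qed
      have "g j \<in> integral_mats (?k ! j + 1) (?k ! j + 1)" if "j \<le> length ks" for j
      proof -
        have j: "j < length ?k" using that by simp
        have "d j r \<in> \<O>" if "r \<le> ?k ! j" for r
        proof (cases j)
          case 0
          then show ?thesis using au[of "k0 - r"] that by (simp add: a_def)
        next
          case (Suc t)
          then show ?thesis using bu[of t r] that j by (simp add: b_def)
        qed
        then have "D j \<in> integral_mats (?k ! j + 1) (?k ! j + 1)"
          by (auto simp: D_def integral_mats_def diagonal_def)
        then show ?thesis unfolding gj[OF j] D_def[symmetric]
          using Ui[OF j] Vi[OF j] by (intro integral_mats_times)
      qed
      with not_int show False by blast
    qed
    \<comment> \<open>The increasing order of the values makes the common difference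
      nonnegative.\<close>
    have c_mem: "c \<in> \<O>"
    proof -
      have "divides_in (b t1 0) (b t1 1)"
        using chain[of "Suc t1" 0 1] t1 by (simp add: b_def)
      then obtain z where z: "z \<in> \<O>" "b t1 1 = b t1 0 * z" by (auto simp: divides_in_def)
      have "unit (z / c)" using bc[OF t1(1), of 1] t1(2) z b_nz[OF t1(1)] by simp
      then have "inverse (z / c) \<in> \<O>" "z \<noteq> 0" by (auto simp: unit_def)
      then have "inverse (z / c) * z \<in> \<O>" using z(1) by (intro mult_mem) auto
      then show ?thesis using \<open>z \<noteq> 0\<close> by simp
    qed
    show ?thesis
    proof (rule triangulable_of_reversed[OF W A])
      fix q i assume q: "q \<le> k0" and i: "i \<in> indices ks" and lt: "sum_list i < k0 - q"
      let ?P = "\<Prod>t<length ks. b t (i ! t)" and ?m = "sum_list i" and ?n = "k0 - q"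
      show "multiact ?k W A (q # i) = 0"
      proof (rule ccontr)
        assume "multiact ?k W A (q # i) \<noteq> 0"
        then have 1: "a ?n * ?P \<in> \<O>"
          using support[OF q i] q by (simp add: B_def a_def)
        have 2: "unit (a ?m * ?P)" by (rule units[OF i])
        have 3: "unit (a 0 / (a ?n * c ^ ?n))" "unit (a 0 / (a ?m * c ^ ?m))" using lt by (auto intro!: ac)
        have "?n = ?m + Suc (?n - ?m - 1)" using lt by simp
        then have cn: "c ^ ?n = c ^ ?m * (c * c ^ (?n - ?m - 1))"
          by (metis power_add power_Suc)
        have nz: "a 0 \<noteq> 0" "a ?n \<noteq> 0" "a ?m \<noteq> 0" "?P \<noteq> 0"
          using 2 a_nz[of 0] a_nz[of ?n] a_nz[of ?m] lt by (auto simp: unit_def)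
        \<comment> \<open>Up to units, \<open>a ?n * ?P\<close> is \<open>c\<close> to the negative
          power \<open>?m - ?n\<close>; multiplying by \<open>c ^ (?n - ?m - 1)\<close> leaves
          \<open>inverse c\<close>, which is not integral.\<close>
        have eq: "inverse c = (a ?n * ?P) * (inverse (a ?m * ?P) *
          ((a 0 / (a ?n * c ^ ?n)) * (inverse (a 0 / (a ?m * c ^ ?m)) * c ^ (?n - ?m - 1))))"
          unfolding cn using nz c by (simp add: field_simps)
        have mem: "inverse (a ?m * ?P) \<in> \<O>" "a 0 / (a ?n * c ^ ?n) \<in> \<O>" "inverse (a 0 / (a ?m * c ^ ?m)) \<in> \<O>"
          using 2 3 unfolding unit_def by blast+
        have "inverse c \<in> \<O>"
          unfolding eq by (intro mult_mem[OF 1] mult_mem[OF mem(1)] mult_mem[OF mem(2)] mult_mem[OF mem(3)] power_mem c_mem)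
        then show False using \<open>\<not> unit c\<close> c c_mem by (simp add: unit_def)
      qed
    qed
  qed
qed

end

section \<open>Stability of tensors that are not triangulable\<close>

definition monomial_eval :: "(nat list \<Rightarrow>\<^sub>0 nat) \<Rightarrow> tensor \<Rightarrow> complex" where
  "monomial_eval m A = (\<Prod>i\<in>Poly_Mapping.keys m. A i ^ Poly_Mapping.lookup m i)"

lemma monomial_eval_superset:
  assumes "finite S" "Poly_Mapping.keys m \<subseteq> S"
  shows "monomial_eval m A = (\<Prod>i\<in>S. A i ^ Poly_Mapping.lookup m i)"
  unfolding monomial_eval_def using assms by (intro prod.mono_neutral_left) (auto simp: in_keys_iff)

lemma monomial_eval_add: "monomial_eval (m + n) A = monomial_eval m A * monomial_eval n A"
proof -
  let ?S = "Poly_Mapping.keys m \<union> Poly_Mapping.keys n"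
  have "monomial_eval (m + n) A = (\<Prod>i\<in>?S. A i ^ Poly_Mapping.lookup (m + n) i)"
    by (intro monomial_eval_superset) (auto dest: set_mp[OF keys_add])
  also have "\<dots> = (\<Prod>i\<in>?S. A i ^ Poly_Mapping.lookup m i) * (\<Prod>i\<in>?S. A i ^ Poly_Mapping.lookup n i)"
    by (simp add: lookup_add power_add prod.distrib)
  also have "\<dots> = monomial_eval m A * monomial_eval n A"
    by (simp add: monomial_eval_superset[of ?S])
  finally show ?thesis .
qed

lemma poly_eval_superset:
  assumes "finite S" "Poly_Mapping.keys Q \<subseteq> S"
  shows "poly_eval Q A = (\<Sum>m\<in>S. Poly_Mapping.lookup Q m * monomial_eval m A)"
  unfolding poly_eval_def monomial_eval_def using assms by (intro sum.mono_neutral_left) (auto simp: in_keys_iff)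

lemma poly_eval_add: "poly_eval (P + Q) A = poly_eval P A + poly_eval Q A"
proof -
  let ?S = "Poly_Mapping.keys P \<union> Poly_Mapping.keys Q"
  have "poly_eval (P + Q) A = (\<Sum>m\<in>?S. Poly_Mapping.lookup (P + Q) m * monomial_eval m A)"
    by (intro poly_eval_superset) (auto dest: set_mp[OF keys_add])
  also have "\<dots> = (\<Sum>m\<in>?S. Poly_Mapping.lookup P m * monomial_eval m A) + (\<Sum>m\<in>?S. Poly_Mapping.lookup Q m * monomial_eval m A)"
    by (simp add: lookup_add distrib_right sum.distrib)
  also have "\<dots> = poly_eval P A + poly_eval Q A"
    by (simp add: poly_eval_superset[of ?S])
  finally show ?thesis .
qed

lemma poly_eval_0: "poly_eval 0 A = 0"
  by (simp add: poly_eval_def)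

lemma poly_eval_sum: "poly_eval (sum f I) A = (\<Sum>i\<in>I. poly_eval (f i) A)"
  by (induction I rule: infinite_finite_induct) (auto simp: poly_eval_0 poly_eval_add)

lemma poly_eval_single: "poly_eval (Poly_Mapping.single m c) A = c * monomial_eval m A"
  by (subst poly_eval_superset[of "{m}"]) (auto split: if_splits)

lemma sum_single_lookup: "(\<Sum>m\<in>Poly_Mapping.keys P. Poly_Mapping.single m (Poly_Mapping.lookup P m)) = P"
  by (rule poly_mapping_eqI) (auto simp: lookup_sum lookup_single when_def in_keys_iff)

lemma poly_eval_mult: "poly_eval (P * Q) A = poly_eval P A * poly_eval Q A"
proof -
  let ?f = "\<lambda>P m. Poly_Mapping.single m (Poly_Mapping.lookup P m)"
  have "P * Q = (\<Sum>m\<in>Poly_Mapping.keys P. ?f P m) * (\<Sum>n\<in>Poly_Mapping.keys Q. ?f Q n)"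
    by (simp only: sum_single_lookup)
  also have "\<dots> = (\<Sum>m\<in>Poly_Mapping.keys P. \<Sum>n\<in>Poly_Mapping.keys Q.
      Poly_Mapping.single (m + n) (Poly_Mapping.lookup P m * Poly_Mapping.lookup Q n))"
    by (simp add: sum_product mult_single)
  also have "poly_eval \<dots> A = (\<Sum>m\<in>Poly_Mapping.keys P. \<Sum>n\<in>Poly_Mapping.keys Q.
      (Poly_Mapping.lookup P m * monomial_eval m A) * (Poly_Mapping.lookup Q n * monomial_eval n A))"
    by (simp add: poly_eval_sum poly_eval_single monomial_eval_add mult_ac)
  also have "\<dots> = poly_eval P A * poly_eval Q A"
    by (simp add: poly_eval_def monomial_eval_def sum_product)
  finally show ?thesis .
qed

lemma polys_add: "P \<in> polys k \<Longrightarrow> Q \<in> polys k \<Longrightarrow> P + Q \<in> polys k"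
  using keys_add[of P Q] by (fastforce simp: polys_def)

lemma polys_mult:
  assumes "P \<in> polys k" "Q \<in> polys k"
  shows "P * Q \<in> polys k"
  unfolding polys_def
proof (intro CollectI ballI)
  fix m assume "m \<in> Poly_Mapping.keys (P * Q)"
  then obtain a b where "m = a + b" "a \<in> Poly_Mapping.keys P" "b \<in> Poly_Mapping.keys Q"
    using keys_mult[of P Q] by blast
  then show "Poly_Mapping.keys m \<subseteq> indices k" using assms keys_add[of a b] by (force simp: polys_def)
qed

lemma polys_const: "Poly_Mapping.single 0 c \<in> polys k" "poly_eval (Poly_Mapping.single 0 c) A = c"
  by (auto simp: polys_def poly_eval_single monomial_eval_def)

lemma polys_coordinate:
  assumes "i \<in> indices k"
  shows "Poly_Mapping.single (Poly_Mapping.single i 1) 1 \<in> polys k"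
    "poly_eval (Poly_Mapping.single (Poly_Mapping.single i 1) 1) A = A i"
  using assms by (auto simp: polys_def poly_eval_single monomial_eval_def)

text \<open>Lets finitely many nonvanishing conditions be expressed by a single polynomial.\<close>

lemma polys_prod:
  assumes "finite X" "X \<subseteq> polys k"
  shows "\<exists>R\<in>polys k. \<forall>A. poly_eval R A = (\<Prod>Q\<in>X. poly_eval Q A)"
  using assms
proof (induction X)
  case empty
  show ?case by (rule bexI[OF _ polys_const(1)[of 1]]) (simp only: polys_const(2) prod.empty simp_thms)
next
  case (insert Q X)
  then obtain R where "R \<in> polys k" "\<forall>A. poly_eval R A = (\<Prod>Q\<in>X. poly_eval Q A)" by auto
  then show ?case using insert by (intro bexI[of _ "Q * R"]) (auto simp: poly_eval_mult polys_mult)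
qed

lemma zariski_closure_subset: "S \<subseteq> tensors k \<Longrightarrow> S \<subseteq> zariski_closure k S"
  by (auto simp: zariski_closure_def)

section \<open>Matrices over the ultrapower\<close>

lemma field_hom_ultra_const: "field_hom (ultra_const :: complex \<Rightarrow> 'x ultra)"
  by unfold_locales (simp_all add: ultra_arith)

definition ultra_mats :: "nat list \<Rightarrow> ('x set \<Rightarrow> complex mat list) \<Rightarrow> nat \<Rightarrow> 'x ultra mat" where
  "ultra_mats k g j = mat (k ! j + 1) (k ! j + 1) (\<lambda>(a, b). ultra (\<lambda>J. (g J ! j) $$ (a, b)))"

lemma format_mats_ultra: "format_mats k (ultra_mats k g)"
  by (simp add: format_mats_def ultra_mats_def)

lemma multiact_ultra: "i \<in> indices k \<Longrightarrow>
    multiact k (ultra_mats k g) (\<lambda>i. ultra_const (A i)) i = ultra (\<lambda>J. act k (g J) A i)"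
proof -
  assume i: "i \<in> indices k"
  have "(\<Prod>j<length k. ultra_mats k g j $$ (i ! j, l ! j)) = ultra (\<lambda>J. \<Prod>j<length k. (g J ! j) $$ (i ! j, l ! j))"
    if l: "l \<in> indices k" for l
  proof -
    have "(\<Prod>j<length k. ultra_mats k g j $$ (i ! j, l ! j)) = (\<Prod>j<length k. ultra (\<lambda>J. (g J ! j) $$ (i ! j, l ! j)))"
      using indices_nth[OF i] indices_nth[OF l] by (intro prod.cong) (auto simp: ultra_mats_def less_Suc_eq_le)
    then show ?thesis by (simp add: ultra_prod)
  qed
  then show ?thesis using i by (simp add: multiact_def act_def ultra_arith ultra_sum)
qed

text \<open>An instance of the theorem of Los: the determinant is a polynomial in the entries, so it
  may be computed at each index \<open>J\<close>.\<close>

lemma det_ultra: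
  assumes "j < length k" "\<And>J. g J \<in> SL_product k"
  shows "det (ultra_mats k g j) = 1"
proof -
  let ?n = "k ! j + 1"
  have c: "ultra_mats k g j \<in> carrier_mat ?n ?n" by (simp add: ultra_mats_def)
  have gc: "g J ! j \<in> carrier_mat ?n ?n" and det1: "det (g J ! j) = 1" for J
    using assms by (auto simp: SL_product_def)
  have sign: "signof p = (ultra (\<lambda>J. signof p) :: 'b ultra)" for p :: "nat \<Rightarrow> nat"
    by (cases p rule: sign_cases) (simp_all add: ultra_arith uminus_ultra.abs_eq)
  have "det (ultra_mats k g j) = (\<Sum>p\<in>{p. p permutes {0..<?n}}. signof p * (\<Prod>i = 0..<?n. ultra_mats k g j $$ (i, p i)))"
    by (rule det_def'[OF c])
  also have "\<dots> = (\<Sum>p\<in>{p. p permutes {0..<?n}}. ultra (\<lambda>J. signof p * (\<Prod>i = 0..<?n. (g J ! j) $$ (i, p i))))"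
  proof (rule sum.cong[OF refl])
    fix p assume "p \<in> {p. p permutes {0..<?n}}"
    then have p: "p permutes {0..<?n}" by simp
    have "(\<Prod>i = 0..<?n. ultra_mats k g j $$ (i, p i)) = (\<Prod>i = 0..<?n. ultra (\<lambda>J. (g J ! j) $$ (i, p i)))"
      using permutes_in_image[OF p] by (intro prod.cong) (auto simp: ultra_mats_def simp del: One_nat_def)
    also have "\<dots> = ultra (\<lambda>J. \<Prod>i = 0..<?n. (g J ! j) $$ (i, p i))" by (rule ultra_prod)
    finally show "signof p * (\<Prod>i = 0..<?n. ultra_mats k g j $$ (i, p i)) =
      ultra (\<lambda>J. signof p * (\<Prod>i = 0..<?n. (g J ! j) $$ (i, p i)))"
      by (simp only: sign[of p] ultra_arith)
  qed
  also have "\<dots> = ultra (\<lambda>J. det (g J ! j))"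
    unfolding ultra_sum by (simp only: det_def'[OF gc])
  also have "\<dots> = 1" by (simp add: det1 ultra_arith)
  finally show ?thesis .
qed

section \<open>Finite stabilizer and closed orbit\<close>

context
  fixes k0 :: nat and ks :: "nat list" and A :: tensor
  assumes k0: "k0 = sum_list ks" "k0 > 0"
    and nd: "nondegenerate k0 ks A" and A: "A \<in> tensors (k0 # ks)"
    and not_tri: "\<not> triangulable (k0 # ks) A"
begin

lemma ultra_mats_integral:
  fixes g :: "'x set \<Rightarrow> complex mat list"
  assumes P: "place ultra_const \<O> \<chi>" and g: "\<And>J. g J \<in> SL_product (k0 # ks)"
    and mem: "\<And>i. i \<in> indices (k0 # ks) \<Longrightarrow> ultra (\<lambda>J. act (k0 # ks) (g J) A i) \<in> \<O>" and j: "j < length (k0 # ks)"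
  shows "ultra_mats (k0 # ks) g j \<in> place.integral_mats \<O> ((k0 # ks) ! j + 1) ((k0 # ks) ! j + 1)"
proof -
  interpret place ultra_const \<O> \<chi> by fact
  have "triangulable (k0 # ks) A \<or> (\<forall>j\<le>length ks. ultra_mats (k0 # ks) g j \<in> integral_mats ((k0 # ks) ! j + 1) ((k0 # ks) ! j + 1))"
    by (rule integral_or_triangulable[OF k0 nd A format_mats_ultra])
       (use mem det_ultra[of _ "k0 # ks" g] g in \<open>auto simp: multiact_ultra\<close>)
  then show ?thesis using not_tri j by auto
qed

text \<open>An infinite stabilizer allows \<open>g J\<close> to be picked outside each finite
  \<open>J\<close>. Since \<open>g A = A\<close> is constant, the entries of \<open>g\<close> are
  integral at every place, hence constant. So \<open>g J\<close> is one fixed \<open>h\<close> for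
  almost all \<open>J\<close>, although \<open>h\<close> lies in almost all
  \<open>J\<close>.\<close>

lemma finite_stabilizer: "finite {g \<in> SL_product (k0 # ks). act (k0 # ks) g A = A}"
proof (rule ccontr)
  let ?k = "k0 # ks" and ?H = "{g \<in> SL_product (k0 # ks). act (k0 # ks) g A = A}"
  assume inf: "infinite ?H"
  have "\<forall>J. \<exists>g. g \<in> ?H \<and> (finite J \<longrightarrow> g \<notin> J)"
  proof
    fix J
    show "\<exists>g. g \<in> ?H \<and> (finite J \<longrightarrow> g \<notin> J)"
    proof (cases "finite J")
      case True
      then have "infinite (?H - J)" using inf by simp
      then have "?H - J \<noteq> {}" by (metis finite.emptyI)
      then show ?thesis by blast
    next
      case False
      have "?H \<noteq> {}" using inf by (metis finite.emptyI)
      then show ?thesis using False by blast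
    qed
  qed
  then obtain g where g: "\<forall>J. g J \<in> ?H \<and> (finite J \<longrightarrow> g J \<notin> J)"
    unfolding choice_iff by (elim exE)
  then have gSL: "g J \<in> SL_product ?k" and gA: "act ?k (g J) A = A" and gJ: "finite J \<Longrightarrow> g J \<notin> J" for J
    by simp_all
  have const: "ultra (\<lambda>J. (g J ! j) $$ (a, b)) \<in> range ultra_const" if j: "j < length ?k" and ab: "a \<le> ?k ! j" "b \<le> ?k ! j" for j a b
  proof (rule ccontr)
    assume "\<not> ?thesis"
    then obtain \<O> \<chi> where P: "place ultra_const \<O> \<chi>" and not: "ultra (\<lambda>J. (g J ! j) $$ (a, b)) \<notin> \<O>"
      using place_avoiding[OF field_hom_ultra_const] by blast
    interpret place ultra_const \<O> \<chi> by fact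
    have "ultra (\<lambda>J. act ?k (g J) A i) \<in> \<O>" for i
      using const_mem[of "A i"] by (simp add: gA ultra_arith)
    then have "ultra_mats ?k g j \<in> integral_mats (?k ! j + 1) (?k ! j + 1)"
      by (rule ultra_mats_integral[OF P gSL _ j])
    then show False using not ab by (auto simp: integral_mats_def ultra_mats_def less_Suc_eq_le)
  qed
  then have "\<forall>j a b. \<exists>c. j < length ?k \<longrightarrow> a \<le> ?k ! j \<longrightarrow> b \<le> ?k ! j \<longrightarrow> ultra (\<lambda>J. (g J ! j) $$ (a, b)) = ultra_const c"
    by blast
  then obtain c where c: "\<forall>j a b. j < length ?k \<longrightarrow> a \<le> ?k ! j \<longrightarrow> b \<le> ?k ! j \<longrightarrow> ultra (\<lambda>J. (g J ! j) $$ (a, b)) = ultra_const (c j a b)"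
    unfolding choice_iff by (elim exE)
  define h where "h = map (\<lambda>j. mat (?k ! j + 1) (?k ! j + 1) (\<lambda>(a, b). c j a b)) [0..<length ?k]"
  have "eventually (\<lambda>J. \<forall>j\<in>{..<length ?k}. \<forall>a\<in>{..?k ! j}. \<forall>b\<in>{..?k ! j}. (g J ! j) $$ (a, b) = c j a b) ultra_filter"
    using c by (subst eventually_ball_finite_distrib, simp)+ (auto simp: ultra_arith ultra_eq_iff)
  then have "eventually (\<lambda>J. False) (ultra_filter :: complex mat list set filter)"
    using eventually_ultra_filter_mem[of h] eventually_ultra_filter_finite
  proof eventually_elim
    case (elim J)
    have "g J = h"
    proof (rule nth_equalityI)
      show "length (g J) = length h" using gSL[of J] by (simp add: SL_product_def h_def)
      fix j assume "j < length (g J)"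
      then have j: "j < length ?k" using gSL[of J] by (simp add: SL_product_def)
      then have gc: "g J ! j \<in> carrier_mat (?k ! j + 1) (?k ! j + 1)" using gSL[of J] by (simp add: SL_product_def)
      have hj: "h ! j = mat (?k ! j + 1) (?k ! j + 1) (\<lambda>(a, b). c j a b)"
        using j unfolding h_def by (subst nth_map) (simp_all del: upt_Suc)
      show "g J ! j = h ! j"
        unfolding hj using elim(1) j gc by (intro eq_matI) (auto simp: less_Suc_eq_le)
    qed
    then show False using elim gJ by blast
  qed
  then show False using eventually_ultra_filter_False by contradiction
qed

text \<open>
  For \<open>A'\<close> in the closure, \<open>g J\<close> is chosen such that no polynomial in the finite set \<open>J\<close> vanishes at
  \<open>g J \<cdot> A\<close> unless it vanishes at \<open>A'\<close>.  The specialisation of \<open>g A\<close> to \<open>A'\<close> is then well defined on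
  the ultrapower.
\<close>

lemma closed_orbit: "zariski_closed (k0 # ks) ((\<lambda>g. act (k0 # ks) g A) ` SL_product (k0 # ks))"
  unfolding zariski_closed_def
proof (rule equalityI; rule subsetI)
  let ?k = "k0 # ks" and ?orbit = "(\<lambda>g. act (k0 # ks) g A) ` SL_product (k0 # ks)"
  fix A' assume A': "A' \<in> zariski_closure ?k ?orbit"
  then have A't: "A' \<in> tensors ?k"
    and van: "\<And>Q. Q \<in> polys ?k \<Longrightarrow> (\<And>g. g \<in> SL_product ?k \<Longrightarrow> poly_eval Q (act ?k g A) = 0) \<Longrightarrow> poly_eval Q A' = 0"
    by (auto simp: zariski_closure_def)
  have ex: "\<exists>g. g \<in> SL_product ?k \<and> (\<forall>Q\<in>J. Q \<in> polys ?k \<longrightarrow> poly_eval Q A' \<noteq> 0 \<longrightarrow> poly_eval Q (act ?k g A) \<noteq> 0)"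
    if J: "finite J" for J
  proof -
    \<comment> \<open>The product of the polynomials in \<open>J\<close> not vanishing at
      \<open>A'\<close> does not vanish at \<open>A'\<close> either, hence not identically on the
      orbit, as \<open>A'\<close> lies in its closure.\<close>
    let ?X = "{Q \<in> J. Q \<in> polys ?k \<and> poly_eval Q A' \<noteq> 0}"
    obtain R where R: "R \<in> polys ?k" "\<And>B. poly_eval R B = (\<Prod>Q\<in>?X. poly_eval Q B)"
      using polys_prod[of ?X ?k] J by auto
    have "poly_eval R A' \<noteq> 0" using J by (simp add: R(2))
    then obtain g where "g \<in> SL_product ?k" "poly_eval R (act ?k g A) \<noteq> 0" using van[OF R(1)] by blast
    then show ?thesis using J by (auto simp: R(2))
  qed
  have "\<forall>J. \<exists>g. g \<in> SL_product ?k \<and> (finite J \<longrightarrow> (\<forall>Q\<in>J. Q \<in> polys ?k \<longrightarrow> poly_eval Q A' \<noteq> 0 \<longrightarrow> poly_eval Q (act ?k g A) \<noteq> 0))"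
  proof
    fix J
    show "\<exists>g. g \<in> SL_product ?k \<and> (finite J \<longrightarrow> (\<forall>Q\<in>J. Q \<in> polys ?k \<longrightarrow> poly_eval Q A' \<noteq> 0 \<longrightarrow> poly_eval Q (act ?k g A) \<noteq> 0))"
    proof (cases "finite J")
      case True
      show ?thesis using ex[OF True] by (elim exE conjE) (intro exI conjI impI)
    next
      case False
      obtain g where "g \<in> SL_product ?k" using ex[OF finite.emptyI] by (elim exE conjE)
      then show ?thesis using False by blast
    qed
  qed
  then obtain g where g: "\<forall>J. g J \<in> SL_product ?k \<and> (finite J \<longrightarrow> (\<forall>Q\<in>J. Q \<in> polys ?k \<longrightarrow> poly_eval Q A' \<noteq> 0 \<longrightarrow> poly_eval Q (act ?k (g J) A) \<noteq> 0))"
    unfolding choice_iff by (elim exE)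
  then have gSL: "g J \<in> SL_product ?k"
    and gQ: "finite J \<Longrightarrow> Q \<in> J \<Longrightarrow> Q \<in> polys ?k \<Longrightarrow> poly_eval Q A' \<noteq> 0 \<Longrightarrow> poly_eval Q (act ?k (g J) A) \<noteq> 0" for J Q
    by simp_all
  define ev where "ev Q = ultra (\<lambda>J. poly_eval Q (act ?k (g J) A))" for Q
  define G where "G = {(ev Q, poly_eval Q A') |Q. Q \<in> polys ?k}"
  have GI: "(ev Q, poly_eval Q A') \<in> G" if "Q \<in> polys ?k" for Q unfolding G_def using that by blast
  have "place_graph ultra_const G"
    unfolding place_graph_def
  proof (intro conjI allI impI)
    show "(ultra_const c, c) \<in> G" for c
      using GI[OF polys_const(1)[of c]] by (simp add: polys_const(2) ev_def ultra_arith)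
    show "(0, 1) \<notin> G"
    proof
      assume "(0, 1) \<in> G"
      then obtain Q where Q: "Q \<in> polys ?k" "ev Q = 0" "poly_eval Q A' = 1" unfolding G_def by auto
      then have "eventually (\<lambda>J. poly_eval Q (act ?k (g J) A) = 0) ultra_filter"
        by (simp add: ev_def ultra_arith ultra_eq_iff)
      then have "eventually (\<lambda>J. False) (ultra_filter :: tensor_poly set filter)"
        using eventually_ultra_filter_mem[of Q] eventually_ultra_filter_finite
      proof eventually_elim
        case (elim J)
        then show False using gQ[of J Q] Q by simp
      qed
      then show False using eventually_ultra_filter_False by contradiction
    qed
    fix x a y b assume "(x, a) \<in> G" "(y, b) \<in> G"
    then obtain P Q where PQ: "P \<in> polys ?k" "Q \<in> polys ?k"
      and eq: "x = ev P" "a = poly_eval P A'" "y = ev Q" "b = poly_eval Q A'" unfolding G_def by blast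
    show "(x + y, a + b) \<in> G" "(x * y, a * b) \<in> G"
      unfolding eq using GI[OF polys_add[OF PQ]] GI[OF polys_mult[OF PQ]]
      by (simp_all add: ev_def ultra_arith poly_eval_add poly_eval_mult)
  qed
  from place_extension[OF field_hom_ultra_const this] obtain \<O> \<chi> where P: "place ultra_const \<O> \<chi>"
    and ext: "\<And>x a. (x, a) \<in> G \<Longrightarrow> x \<in> \<O> \<and> \<chi> x = a" by blast
  interpret place ultra_const \<O> \<chi> by fact
  have coord: "ultra (\<lambda>J. act ?k (g J) A i) \<in> \<O>" "\<chi> (ultra (\<lambda>J. act ?k (g J) A i)) = A' i" if "i \<in> indices ?k" for i
    using ext[OF GI[OF polys_coordinate(1)[OF that]]] by (simp_all only: ev_def polys_coordinate(2)[OF that])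
  have int: "ultra_mats ?k g j \<in> integral_mats (?k ! j + 1) (?k ! j + 1)" if "j < length ?k" for j
    by (rule ultra_mats_integral[OF P gSL coord(1) that])
  \<comment> \<open>As \<open>g\<close> is integral, its residue matrices have determinant 1 and
    carry \<open>A\<close> to the residue \<open>A'\<close> of \<open>g A\<close>.\<close>
  define h where "h = map (\<lambda>j. map_mat \<chi> (ultra_mats ?k g j)) [0..<length ?k]"
  have h: "h ! j = map_mat \<chi> (ultra_mats ?k g j)" if "j < length ?k" for j
    using that unfolding h_def by (subst nth_map) (simp_all del: upt_Suc)
  have "h \<in> SL_product ?k"
    unfolding SL_product_def
  proof (intro CollectI conjI allI impI)
    show "length h = length ?k" by (simp add: h_def)
    fix j assume j: "j < length ?k"
    show "h ! j \<in> carrier_mat (?k ! j + 1) (?k ! j + 1)" using integral_mats_carrier[OF int[OF j]] by (simp add: h[OF j])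
    have "det (h ! j) = \<chi> (det (ultra_mats ?k g j))" by (simp only: h[OF j] det_mem(2)[OF int[OF j]])
    also have "\<dots> = 1" by (simp only: det_ultra[OF j gSL] \<chi>_one)
    finally show "det (h ! j) = 1" .
  qed
  moreover have "act ?k h A = A'"
  proof
    fix i
    show "act ?k h A i = A' i"
    proof (cases "i \<in> indices ?k")
      case True
      have "A' i = \<chi> (multiact ?k (ultra_mats ?k g) (\<lambda>i. ultra_const (A i)) i)"
        by (simp only: multiact_ultra[OF True] coord(2)[OF True])
      also have "\<dots> = multiact ?k (\<lambda>j. map_mat \<chi> (ultra_mats ?k g j)) (\<lambda>i. \<chi> (ultra_const (A i))) i"
        by (rule multiact_mem(2)) (use int const_mem in blast)+
      also have "\<dots> = act ?k h A i"
        unfolding act_eq_multiact by (rule fun_cong[OF multiact_cong]) (simp_all only: h \<chi>_const)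
      finally show ?thesis ..
    next
      case False
      then show ?thesis using A't by (simp add: act_def tensors_def)
    qed
  qed
  ultimately show "A' \<in> ?orbit" by blast
next
  fix x assume "x \<in> (\<lambda>g. act (k0 # ks) g A) ` SL_product (k0 # ks)"
  moreover have "(\<lambda>g. act (k0 # ks) g A) ` SL_product (k0 # ks) \<subseteq> tensors (k0 # ks)"
    by (auto simp: tensors_def act_def)
  ultimately show "x \<in> zariski_closure (k0 # ks) ((\<lambda>g. act (k0 # ks) g A) ` SL_product (k0 # ks))"
    using zariski_closure_subset by blast
qed

end

section \<open>Instability of triangulable tensors\<close>

text \<open>Quotients occur because the weights may be negative; centring them at 0 gives
  determinant 1, and doubling keeps them integers.\<close>

definition weight :: "nat list \<Rightarrow> complex \<Rightarrow> nat \<Rightarrow> nat \<Rightarrow> complex" where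
  "weight k t j r = (if j = 0 then t ^ (k ! 0) / t ^ (2 * r) else t ^ (2 * r) / t ^ (k ! j))"

lemma prod_weight:
  assumes "t \<noteq> 0"
  shows "(\<Prod>r\<le>k ! j. weight k t j r) = 1"
proof -
  have "(\<Prod>r\<le>m. t ^ (2 * r)) = t ^ (m * Suc m)" for m
  proof (induction m)
    case (Suc m)
    have "m * Suc m + 2 * Suc m = Suc m * Suc (Suc m)" by simp
    then show ?case using Suc by (simp only: prod.atMost_Suc power_add[symmetric])
  qed simp
  moreover have "(\<Prod>r\<le>m. t ^ m) = t ^ (m * Suc m)" for m
    by (simp only: power_mult prod_constant card_atMost)
  ultimately show ?thesis
    using assms by (cases "j = 0") (simp_all only: weight_def prod_dividef if_True if_False simp_thms, simp_all)
qed

text \<open>The constant parts of the weights cancel because \<open>k0 = sum_list ks\<close>; what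
  remains is twice the signed distance from the triangular boundary.\<close>

lemma prod_weight_index:
  assumes t: "t \<noteq> 0" and k0: "k0 = sum_list ks" and i: "i \<in> indices (k0 # ks)"
  shows "(\<Prod>j<length (k0 # ks). weight (k0 # ks) t j (i ! j)) = t ^ (2 * sum_list (tl i)) / t ^ (2 * i ! 0)"
proof -
  obtain a js where i': "i = a # js" and js: "js \<in> indices ks" using i by (auto simp: indices_Cons)
  have "(\<Prod>j<length ks. t ^ (2 * js ! j)) = t ^ (2 * sum_list js)"
    using indices_length[OF js] by (simp add: power_sum[symmetric] sum_list_sum_nth atLeast0LessThan sum_distrib_left)
  moreover have "(\<Prod>j<length ks. t ^ (ks ! j)) = t ^ k0"
    by (simp add: k0 power_sum[symmetric] sum_list_sum_nth atLeast0LessThan)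
  ultimately show ?thesis
    using t by (simp add: prod.lessThan_Suc_shift weight_def i' prod_dividef del: prod.lessThan_Suc)
qed

lemma continuous_on_poly_eval:
  fixes f :: "complex \<Rightarrow> tensor"
  assumes "\<And>i. continuous_on UNIV (\<lambda>t. f t i)"
  shows "continuous_on UNIV (\<lambda>t. poly_eval Q (f t))"
  unfolding poly_eval_def by (intro continuous_intros assms)

lemma continuous_zero_at_0:
  fixes f :: "complex \<Rightarrow> complex"
  assumes "continuous_on UNIV f" "\<And>t. t \<noteq> 0 \<Longrightarrow> f t = 0"
  shows "f 0 = 0"
proof -
  have "f \<midarrow>0\<rightarrow> f 0" using assms(1) by (auto simp: continuous_on_def)
  moreover have "f \<midarrow>0\<rightarrow> 0"
    by (rule tendsto_eventually) (auto simp: eventually_at_filter assms(2))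
  ultimately show ?thesis using LIM_unique by blast
qed

lemma SL_product_inverse:
  assumes "g \<in> SL_product k"
  shows "\<exists>h. inverse_mats k (\<lambda>j. g ! j) h"
proof -
  have "inverse_mats k (\<lambda>j. g ! j) (\<lambda>j. adj_mat (g ! j))"
    unfolding inverse_mats_def format_mats_def
  proof (intro conjI allI impI)
    fix j assume j: "j < length k"
    have c: "g ! j \<in> carrier_mat (k ! j + 1) (k ! j + 1)" and d: "det (g ! j) = 1"
      using assms j by (auto simp: SL_product_def)
    have one: "(1 :: complex) \<cdot>\<^sub>m 1\<^sub>m n = 1\<^sub>m n" for n by (rule eq_matI) auto
    show "g ! j \<in> carrier_mat (k ! j + 1) (k ! j + 1)" by (rule c)
    show "adj_mat (g ! j) \<in> carrier_mat (k ! j + 1) (k ! j + 1)" by (rule adj_mat(1)[OF c])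
    show "g ! j * adj_mat (g ! j) = 1\<^sub>m (k ! j + 1)" unfolding adj_mat(2)[OF c] d one ..
    show "adj_mat (g ! j) * g ! j = 1\<^sub>m (k ! j + 1)" unfolding adj_mat(3)[OF c] d one ..
  qed
  then show ?thesis by blast
qed

text \<open>If the orbit is closed, the limit \<open>P 0\<close> of the one-parameter subgroup is
  \<open>g A\<close> for some \<open>g\<close>. That subgroup fixes the limit, so conjugating it by
  \<open>g\<close> gives infinitely many elements of the stabilizer of \<open>A\<close>.\<close>

lemma triangulable_not_stable:
  assumes k0: "k0 = sum_list ks" "k0 > 0" and tri: "triangulable (k0 # ks) A"
  shows "\<not> GIT_stable (k0 # ks) A"
proof
  let ?k = "k0 # ks" and ?orbit = "(\<lambda>g. act (k0 # ks) g A) ` SL_product (k0 # ks)"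
  assume stable: "GIT_stable ?k A"
  obtain e h a where eh: "inverse_mats ?k e h" and a: "a \<in> tensors ?k" "A = multiact ?k e a"
    and upper: "\<And>i. i \<in> indices ?k \<Longrightarrow> i ! 0 > sum_list (tl i) \<Longrightarrow> a i = 0"
    using tri unfolding triangulable_iff by blast
  have ec: "e j \<in> carrier_mat (?k ! j + 1) (?k ! j + 1)" and hc: "h j \<in> carrier_mat (?k ! j + 1) (?k ! j + 1)"
    and eh1: "e j * h j = 1\<^sub>m (?k ! j + 1)" and he1: "h j * e j = 1\<^sub>m (?k ! j + 1)" if "j < length ?k" for j
    using eh that unfolding inverse_mats_def format_mats_def by blast+
  define D where "D t j = diagonal (?k ! j + 1) (weight ?k t j)" for t j
  have Dc: "D t j \<in> carrier_mat (?k ! j + 1) (?k ! j + 1)" for t j unfolding D_def by (rule diagonal_carrier)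
  define L where "L t j = e j * (D t j * h j)" for t j
  have Lc: "L t j \<in> carrier_mat (?k ! j + 1) (?k ! j + 1)" if "j < length ?k" for t j
    unfolding L_def by (rule mult_carrier_mat[OF ec[OF that] mult_carrier_mat[OF Dc hc[OF that]]])
  have detL: "det (L t j) = 1" if j: "j < length ?k" and t: "t \<noteq> 0" for t j
  proof -
    have "det (L t j) = det (e j) * (det (D t j) * det (h j))"
      unfolding L_def using det_mult[OF ec[OF j] mult_carrier_mat[OF Dc hc[OF j]]] det_mult[OF Dc hc[OF j]] by metis
    moreover have "det (D t j) = 1"
      unfolding D_def det_diagonal using prod_weight[OF t, of ?k j] by (simp add: lessThan_Suc_atMost)
    moreover have "det (e j) * det (h j) = 1"
      using det_mult[OF ec[OF j] hc[OF j]] eh1[OF j] by simp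
    ultimately show ?thesis by simp
  qed
  have LD: "multiact ?k (L t) (multiact ?k e x) = multiact ?k e (multiact ?k (D t) x)" if x: "x \<in> tensors ?k" for t x
  proof -
    have fm: "format_mats ?k e" "format_mats ?k h" "format_mats ?k (D t)"
      using eh Dc unfolding inverse_mats_def format_mats_def by blast+
    have "multiact ?k (L t) (multiact ?k e x) = multiact ?k e (multiact ?k (D t) (multiact ?k h (multiact ?k e x)))"
      unfolding L_def using fm
      by (subst multiact_multiact[symmetric, OF fm(1) format_mats_times[OF fm(3,2)]],
          subst multiact_multiact[symmetric, OF fm(3,2)]) simp
    also have "multiact ?k h (multiact ?k e x) = x"
      using x by (intro multiact_inverse[OF inverse_mats_sym[OF eh]]) (simp add: tensors_def)
    finally show ?thesis .
  qed
  have Dact: "multiact ?k (D t) x i = t ^ (2 * sum_list (tl i)) / t ^ (2 * i ! 0) * x i" if t: "t \<noteq> 0" and i: "i \<in> indices ?k" for t x i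
  proof -
    have "multiact ?k (D t) x i = (\<Prod>j<length ?k. weight ?k t j (i ! j)) * x i"
      by (rule multiact_diagonal[OF _ i]) (simp add: D_def diagonal_index)
    then show ?thesis by (simp only: prod_weight_index[OF t k0(1) i])
  qed
  \<comment> \<open>Truncated subtraction is harmless where \<open>i ! 0\<close> exceeds the sum,
    since \<open>a\<close> vanishes there; at \<open>t = 0\<close> the convention
    \<open>0 ^ 0 = 1\<close> keeps exactly the entries with equality.\<close>
  define curve where "curve t i = t ^ (2 * (sum_list (tl i) - i ! 0)) * a i" for t :: complex and i
  have att: "curve t \<in> tensors ?k" for t using a(1) by (auto simp: tensors_def curve_def)
  have Dat: "multiact ?k (D t) a = curve t" if t: "t \<noteq> 0" for t
  proof
    fix i
    show "multiact ?k (D t) a i = curve t i"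
    proof (cases "i \<in> indices ?k")
      case False
      then show ?thesis using a(1) by (simp add: multiact_def curve_def tensors_def)
    next
      case True
      show ?thesis
      proof (cases "i ! 0 > sum_list (tl i)")
        case True
        then show ?thesis using upper[OF \<open>i \<in> indices ?k\<close>] Dact[OF t \<open>i \<in> indices ?k\<close>] by (simp add: curve_def)
      next
        case False
        then have "t ^ (2 * sum_list (tl i)) / t ^ (2 * i ! 0) = t ^ (2 * (sum_list (tl i) - i ! 0))"
          using t by (simp add: right_diff_distrib' power_diff)
        then show ?thesis using Dact[OF t \<open>i \<in> indices ?k\<close>] by (simp add: curve_def)
      qed
    qed
  qed
  have fixed: "multiact ?k (D t) (curve 0) = curve 0" if t: "t \<noteq> 0" for t
  proof
    fix i
    show "multiact ?k (D t) (curve 0) i = curve 0 i"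
    proof (cases "i \<in> indices ?k")
      case False
      then show ?thesis using att[of 0] by (simp add: multiact_def tensors_def)
    next
      case True
      have "t ^ (2 * sum_list (tl i)) / t ^ (2 * i ! 0) * curve 0 i = curve 0 i"
      proof (cases "sum_list (tl i) = i ! 0")
        case False
        then have "curve 0 i = 0" using upper[OF True] by (cases "i ! 0 > sum_list (tl i)") (simp_all add: curve_def)
        then show ?thesis by simp
      qed (use t in simp)
      then show ?thesis using Dact[OF t True] by simp
    qed
  qed
  define P where "P t = multiact ?k e (curve t)" for t
  have Porbit: "P t \<in> ?orbit" if t: "t \<noteq> 0" for t
  proof -
    let ?g = "map (L t) [0..<length ?k]"
    have g: "?g ! j = L t j" if "j < length ?k" for j
      using that by (subst nth_map) (simp_all del: upt_Suc)
    have "?g \<in> SL_product ?k"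
      unfolding SL_product_def using Lc detL[OF _ t] by (simp add: g del: upt_Suc)
    moreover have "P t = act ?k ?g A"
    proof -
      have "act ?k ?g A = multiact ?k (L t) A"
        unfolding act_eq_multiact by (rule multiact_cong) (simp_all only: g)
      then show ?thesis by (simp only: a(2) LD[OF a(1)] Dat[OF t] P_def)
    qed
    ultimately show ?thesis by blast
  qed
  \<comment> \<open>A polynomial vanishing along the curve for \<open>t \<noteq> 0\<close> vanishes
    at \<open>t = 0\<close> by continuity.\<close>
  have "P 0 \<in> zariski_closure ?k ?orbit"
    unfolding zariski_closure_def
  proof (intro CollectI conjI ballI impI)
    show "P 0 \<in> tensors ?k" by (simp add: P_def tensors_def multiact_def)
    fix Q assume "\<forall>B\<in>?orbit. poly_eval Q B = 0"
    then have "poly_eval Q (P t) = 0" if "t \<noteq> 0" for t using Porbit[OF that] by blast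
    moreover have "continuous_on UNIV (\<lambda>t. P t i)" for i
      by (cases "i \<in> indices ?k") (auto simp: P_def multiact_def curve_def intro!: continuous_intros)
    ultimately show "poly_eval Q (P 0) = 0"
      using continuous_zero_at_0[OF continuous_on_poly_eval, of P Q] by blast
  qed
  then obtain g where g: "g \<in> SL_product ?k" and gA: "act ?k g A = P 0"
    using stable unfolding GIT_stable_def zariski_closed_def by auto
  obtain g' where gg': "inverse_mats ?k (\<lambda>j. g ! j) g'" using SL_product_inverse[OF g] by blast
  have gc: "g ! j \<in> carrier_mat (?k ! j + 1) (?k ! j + 1)" and g'c: "g' j \<in> carrier_mat (?k ! j + 1) (?k ! j + 1)"
    and g1: "g ! j * g' j = 1\<^sub>m (?k ! j + 1)" "g' j * g ! j = 1\<^sub>m (?k ! j + 1)" if "j < length ?k" for j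
    using gg' that unfolding inverse_mats_def format_mats_def by blast+
  \<comment> \<open>The one-parameter subgroup, moved from the stabilizer of \<open>P 0\<close> to
    that of \<open>A\<close>.\<close>
  define C where "C t j = g' j * (L t j * g ! j)" for t j
  define Cs where "Cs t = map (C t) [0..<length ?k]" for t
  have Cs: "Cs t ! j = C t j" if "j < length ?k" for t j
    using that unfolding Cs_def by (subst nth_map) (simp_all del: upt_Suc)
  have stab: "Cs t \<in> {g \<in> SL_product ?k. act ?k g A = A}" if t: "t \<noteq> 0" for t
  proof -
    have Ct: "C t j \<in> carrier_mat (?k ! j + 1) (?k ! j + 1)" if "j < length ?k" for j
      unfolding C_def by (rule mult_carrier_mat[OF g'c[OF that] mult_carrier_mat[OF Lc[OF that] gc[OF that]]])
    have "det (C t j) = 1" if j: "j < length ?k" for j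
    proof -
      have "det (C t j) = det (g' j) * (det (L t j) * det (g ! j))"
        unfolding C_def using det_mult[OF g'c[OF j] mult_carrier_mat[OF Lc[OF j] gc[OF j]]] det_mult[OF Lc[OF j] gc[OF j]] by metis
      also have "\<dots> = det (g' j) * det (g ! j)" by (simp add: detL[OF j t])
      also have "\<dots> = 1" using det_mult[OF g'c[OF j] gc[OF j]] g1(2)[OF j] by simp
      finally show ?thesis .
    qed
    then have "Cs t \<in> SL_product ?k"
      unfolding SL_product_def using Ct by (simp add: Cs) (simp add: Cs_def del: upt_Suc)
    moreover have "act ?k (Cs t) A = A"
    proof -
      have fm: "format_mats ?k (\<lambda>j. g ! j)" "format_mats ?k g'" "format_mats ?k (L t)"
        using gg' Lc unfolding inverse_mats_def format_mats_def by blast+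
      have At: "i \<notin> indices ?k \<Longrightarrow> A i = 0" for i using a(2) by (simp add: multiact_def)
      have "act ?k (Cs t) A = multiact ?k (C t) A"
        unfolding act_eq_multiact by (rule multiact_cong) (simp_all only: Cs)
      also have "\<dots> = multiact ?k g' (multiact ?k (L t) (multiact ?k (\<lambda>j. g ! j) A))"
        unfolding C_def
        by (subst multiact_multiact[symmetric, OF fm(2) format_mats_times[OF fm(3,1)]],
            subst multiact_multiact[symmetric, OF fm(3,1)]) simp
      also have "multiact ?k (\<lambda>j. g ! j) A = P 0" using gA by (simp only: act_eq_multiact)
      also have "multiact ?k (L t) (P 0) = P 0"
        unfolding P_def LD[OF att] fixed[OF t] ..
      also have "P 0 = multiact ?k (\<lambda>j. g ! j) A" using gA by (simp only: act_eq_multiact)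
      also have "multiact ?k g' \<dots> = A"
        by (rule multiact_inverse[OF inverse_mats_sym[OF gg'] At])
      finally show ?thesis .
    qed
    ultimately show ?thesis by blast
  qed
  have recover: "h 0 * (g ! 0 * C t 0 * g' 0) * e 0 = D t 0" for t
  proof -
    let ?n = "?k ! 0 + 1"
    have j: "0 < length ?k" by simp
    note car = gc[OF j] g'c[OF j] ec[OF j] hc[OF j] Dc[of t 0]
    have "h 0 * (g ! 0 * C t 0 * g' 0) * e 0 =
      (h 0 * ((g ! 0 * g' 0) * (e 0 * (D t 0 * (h 0 * ((g ! 0 * g' 0) * e 0))))))"
      unfolding C_def L_def using car
      by (simp add: assoc_mult_mat[of _ ?n ?n _ ?n _ ?n] mult_carrier_mat[of _ ?n ?n _ ?n] del: One_nat_def nth_Cons_0)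
    also have "\<dots> = (h 0 * e 0) * D t 0 * (h 0 * e 0)"
      using car by (simp add: g1(1)[OF j] left_mult_one_mat[of _ ?n ?n] mult_carrier_mat[of _ ?n ?n _ ?n] assoc_mult_mat[of _ ?n ?n _ ?n _ ?n] del: One_nat_def nth_Cons_0)
    also have "\<dots> = D t 0" using car by (simp add: he1[OF j] del: One_nat_def nth_Cons_0)
    finally show ?thesis .
  qed
  \<comment> \<open>The corner entry of \<open>D t 0\<close> is \<open>t ^ k0\<close> with
    \<open>k0 > 0\<close>; restricting to positive reals avoids the ambiguity by roots of
    unity.\<close>
  have inj: "inj_on (\<lambda>t. Cs (complex_of_real t)) {0<..}"
  proof (rule inj_onI)
    fix s t :: real
    assume st: "s \<in> {0<..}" "t \<in> {0<..}" and eq: "Cs (complex_of_real s) = Cs (complex_of_real t)"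
    have "C s 0 = C t 0" using eq Cs[of 0 s] Cs[of 0 t] by simp
    then have "D s 0 = D t 0" using recover[of s] recover[of t] by metis
    then have "D s 0 $$ (0, 0) = D t 0 $$ (0, 0)" by simp
    then have "complex_of_real (s ^ k0) = complex_of_real (t ^ k0)"
      by (simp add: D_def diagonal_index weight_def)
    then have "s ^ k0 = t ^ k0" by (simp only: of_real_eq_iff)
    then show "s = t" using st k0(2) power_eq_imp_eq_base[of s k0 t] by simp
  qed
  have "infinite ((\<lambda>t. Cs (complex_of_real t)) ` {0<..})"
    using finite_imageD[OF _ inj] infinite_Ioi[of "0::real"] by blast
  moreover have "(\<lambda>t. Cs (complex_of_real t)) ` {0<..} \<subseteq> {g \<in> SL_product ?k. act ?k g A = A}"
    using stab by auto
  ultimately have "infinite {g \<in> SL_product ?k. act ?k g A = A}" using finite_subset by blast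
  then show False using stable unfolding GIT_stable_def by blast
qed

section \<open>Nonvanishing hyperdeterminant\<close>

lemma pure_tensor_Cons:
  assumes "a # i \<in> indices (k0 # ks)"
  shows "pure_tensor (k0 # ks) (x # v) (a # i) = x $ a * (\<Prod>t<length ks. (v ! t) $ (i ! t))"
  using assms by (simp add: pure_tensor_def prod.lessThan_Suc_shift del: prod.lessThan_Suc)

lemma pairing_pure_tensor:
  "pairing (k0 # ks) A (pure_tensor (k0 # ks) (x # v)) =
    (\<Sum>a\<le>k0. x $ a * multilinear ks (\<lambda>i. A (a # i)) (\<lambda>t r. (v ! t) $ r))"
  by (simp add: pairing_def sum_indices_Cons pure_tensor_Cons multilinear_def sum_distrib_left mult_ac)

lemma multilinear_update:
  assumes t: "t < length ks"
  shows "multilinear ks c (x(t := y)) = (\<Sum>r\<le>ks ! t. y r * multilinear ks c (x(t := (\<lambda>q. if q = r then 1 else 0))))"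
proof -
  have eq: "(\<Prod>u<length ks. (x(t := f)) u (i ! u)) = f (i ! t) * (\<Prod>u\<in>{..<length ks} - {t}. x u (i ! u))"
    for f :: "nat \<Rightarrow> 'a" and i
    using t by (subst prod.remove[of _ t]) (auto intro!: arg_cong2[where f = "(*)"] prod.cong)
  let ?P = "\<lambda>i. \<Prod>u\<in>{..<length ks} - {t}. x u (i ! u)"
  have "(\<Sum>r\<le>ks ! t. y r * multilinear ks c (x(t := (\<lambda>q. if q = r then 1 else 0)))) =
    (\<Sum>r\<le>ks ! t. \<Sum>i\<in>indices ks. if r = i ! t then y r * (c i * ?P i) else 0)"
    unfolding multilinear_def eq sum_distrib_left by (intro sum.cong refl) auto
  also have "\<dots> = (\<Sum>i\<in>indices ks. \<Sum>r\<le>ks ! t. if r = i ! t then y r * (c i * ?P i) else 0)"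
    by (rule sum.swap)
  also have "\<dots> = (\<Sum>i\<in>indices ks. y (i ! t) * (c i * ?P i))"
    using indices_nth[OF _ t] by (intro sum.cong) auto
  also have "\<dots> = multilinear ks c (x(t := y))"
    unfolding multilinear_def eq by (intro sum.cong) (auto simp: mult_ac)
  finally show ?thesis ..
qed

lemma multilinear_vec:
  assumes "\<And>t r. t < length ks \<Longrightarrow> r \<le> ks ! t \<Longrightarrow> x t r = y t r"
  shows "multilinear ks c x = multilinear ks c y"
  unfolding multilinear_def using assms indices_nth
  by (intro sum.cong refl arg_cong2[where f = "(*)"] prod.cong) auto

text \<open>Suppose nonzero vectors \<open>v\<close> contract \<open>A\<close> to 0. Varying the
  factor \<open>V_0\<close> then imposes nothing on \<open>x\<close>, while varying factor
  \<open>t\<close> imposes \<open>ks ! t + 1\<close> linear conditions, one of them redundant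
  because the direction \<open>v t\<close> already gives 0. The \<open>k0\<close> conditions left
  have a nonzero solution in dimension \<open>k0 + 1\<close>, giving a point of tangency.\<close>

lemma nondegenerate_of_not_tangent:
  assumes k0: "k0 = sum_list ks" and A: "A \<in> tensors (k0 # ks)" and not: "A \<notin> tangent_hyperplanes (k0 # ks)"
  shows "nondegenerate k0 ks A"
proof (rule ccontr)
  let ?k = "k0 # ks" and ?p = "length ks"
  assume "\<not> nondegenerate k0 ks A"
  then obtain v where v: "\<And>t. t < ?p \<Longrightarrow> \<exists>r\<le>ks ! t. v t r \<noteq> 0"
    and v0: "\<And>a. a \<le> k0 \<Longrightarrow> multilinear ks (\<lambda>i. A (a # i)) v = 0"
    unfolding nondegenerate_def by blast
  have "\<forall>t. \<exists>r. t < ?p \<longrightarrow> r \<le> ks ! t \<and> v t r \<noteq> 0" using v by blast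
  then obtain \<rho> where \<rho>: "\<And>t. t < ?p \<Longrightarrow> \<rho> t \<le> ks ! t" "\<And>t. t < ?p \<Longrightarrow> v t (\<rho> t) \<noteq> 0"
    unfolding choice_iff by blast
  \<comment> \<open>The omitted index \<open>\<rho> t\<close> is one where \<open>v t\<close> is
    nonzero; its condition follows from the others because \<open>M t (v t)\<close>
    vanishes.\<close>
  define E where "E = (SIGMA t:{..<?p}. {..ks ! t} - {\<rho> t})"
  define M where "M t f a = multilinear ks (\<lambda>i. A (a # i)) (v(t := f))" for t f a
  let ?e = "\<lambda>r q :: nat. if q = r then 1 else 0 :: complex"
  have cardE: "card E = k0"
  proof -
    have "card E = (\<Sum>t<?p. card ({..ks ! t} - {\<rho> t}))" by (simp add: E_def)
    also have "\<dots> = (\<Sum>t<?p. ks ! t)" using \<rho>(1) by (intro sum.cong) auto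
    finally show ?thesis by (simp add: k0 sum_list_sum_nth atLeast0LessThan)
  qed
  have finE: "finite E" by (simp add: E_def)
  obtain x where x: "\<exists>r\<le>k0. x r \<noteq> 0"
    and xE: "\<And>t r. (t, r) \<in> E \<Longrightarrow> (\<Sum>a\<le>k0. M t (?e r) a * x a) = 0"
  proof -
    \<comment> \<open>For the single factor \<open>[k0]\<close> this is the nonzero solution of
      \<open>k0\<close> linear equations in \<open>k0 + 1\<close> unknowns.\<close>
    have "\<exists>x. (\<forall>t<length [k0]. \<exists>r\<le>[k0] ! t. x t r \<noteq> 0) \<and>
        (\<forall>e\<in>E. multilinear [k0] (\<lambda>i. M (fst e) (?e (snd e)) (i ! 0)) x = 0)"
      by (rule multilinear_common_zero) (simp_all add: finE cardE)
    then obtain x where x: "\<forall>t<length [k0]. \<exists>r\<le>[k0] ! t. x t r \<noteq> 0"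
      "\<forall>e\<in>E. multilinear [k0] (\<lambda>i. M (fst e) (?e (snd e)) (i ! 0)) x = 0" by blast
    show thesis
    proof (rule that)
      show "\<exists>r\<le>k0. x 0 r \<noteq> 0" using x(1) by simp
      show "(\<Sum>a\<le>k0. M t (?e r) a * x 0 a) = 0" if "(t, r) \<in> E" for t r
        using x(2)[rule_format, OF that] by (simp add: multilinear_def sum_indices_Cons)
    qed
  qed
  have M_expand: "M t y a = (\<Sum>r\<le>ks ! t. y r * M t (?e r) a)" if "t < ?p" for t y a
    unfolding M_def by (rule multilinear_update[OF that])
  have M_v: "M t (v t) a = 0" if "a \<le> k0" for t a
    using v0[OF that] by (simp add: M_def)
  have xM: "(\<Sum>a\<le>k0. x a * M t y a) = 0" if t: "t < ?p" for t y
  proof -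
    define s where "s r = (\<Sum>a\<le>k0. x a * M t (?e r) a)" for r
    have lin: "(\<Sum>a\<le>k0. x a * M t y a) = (\<Sum>r\<le>ks ! t. y r * s r)" for y
    proof -
      have "(\<Sum>a\<le>k0. x a * M t y a) = (\<Sum>a\<le>k0. \<Sum>r\<le>ks ! t. y r * (x a * M t (?e r) a))"
        unfolding M_expand[OF t, of y] sum_distrib_left by (intro sum.cong refl) (simp only: mult_ac)
      also have "\<dots> = (\<Sum>r\<le>ks ! t. \<Sum>a\<le>k0. y r * (x a * M t (?e r) a))" by (rule sum.swap)
      finally show ?thesis by (simp add: s_def sum_distrib_left)
    qed
    have s0: "s r = 0" if "r \<le> ks ! t" "r \<noteq> \<rho> t" for r
      using xE[of t r] that t by (simp add: E_def s_def mult.commute)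
    have one: "(\<Sum>r\<le>ks ! t. y r * s r) = y (\<rho> t) * s (\<rho> t)" for y
      using \<rho>(1)[OF t] s0 by (subst sum.remove[of _ "\<rho> t"]) auto
    have "0 = v t (\<rho> t) * s (\<rho> t)" using lin[of "v t"] one[of "v t"] M_v by simp
    then show ?thesis using \<rho>(2)[OF t] lin[of y] one[of y] by simp
  qed
  define vs where "vs = vec (k0 + 1) x # map (\<lambda>t. vec (ks ! t + 1) (v t)) [0..<?p]"
  have vs_nth: "vs ! Suc t = vec (ks ! t + 1) (v t)" if "t < ?p" for t
    using that by (simp add: vs_def)
  have vs: "vs \<in> vectors ?k"
    by (auto simp: vectors_def vs_def nth_Cons split: nat.splits)
  have nz: "vs ! j \<noteq> 0\<^sub>v (?k ! j + 1)" if j: "j < length ?k" for j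
  proof (cases j)
    case 0
    obtain r where "r \<le> k0" "x r \<noteq> 0" using x by blast
    then have "vs ! j $ r \<noteq> 0\<^sub>v (?k ! j + 1) $ r" by (simp add: 0 vs_def)
    then show ?thesis by metis
  next
    case (Suc t)
    then have t: "t < ?p" using j by simp
    have "vs ! j $ \<rho> t \<noteq> 0\<^sub>v (?k ! j + 1) $ \<rho> t" using \<rho>[OF t] by (simp add: Suc vs_nth[OF t])
    then show ?thesis by metis
  qed
  have zero: "pairing ?k A (pure_tensor ?k (vs[j := y])) = 0"
    if j: "j < length ?k" and y: "y \<in> carrier_vec (?k ! j + 1)" for j y
  proof (cases j)
    case 0
    have "multilinear ks (\<lambda>i. A (a # i)) (\<lambda>t r. map (\<lambda>t. vec (ks ! t + 1) (v t)) [0..<?p] ! t $ r) = 0" if "a \<le> k0" for a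
    proof -
      have "multilinear ks (\<lambda>i. A (a # i)) (\<lambda>t r. map (\<lambda>t. vec (ks ! t + 1) (v t)) [0..<?p] ! t $ r) =
        multilinear ks (\<lambda>i. A (a # i)) v"
        by (rule multilinear_vec) simp
      then show ?thesis using v0[OF that] by simp
    qed
    then show ?thesis by (simp add: 0 vs_def pairing_pure_tensor)
  next
    case (Suc t)
    then have t: "t < ?p" using j by simp
    have "multilinear ks (\<lambda>i. A (a # i)) (\<lambda>u r. (map (\<lambda>t. vec (ks ! t + 1) (v t)) [0..<?p])[t := y] ! u $ r) = M t (\<lambda>r. y $ r) a" for a
      unfolding M_def using t by (intro multilinear_vec) (auto simp: nth_list_update)
    then have "pairing ?k A (pure_tensor ?k (vs[j := y])) = (\<Sum>a\<le>k0. x a * M t (\<lambda>r. y $ r) a)"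
      by (simp add: Suc vs_def pairing_pure_tensor)
    then show ?thesis using xM[OF t] by simp
  qed
  have "A \<in> tangent_hyperplanes ?k"
    unfolding tangent_hyperplanes_def using A vs nz zero by blast
  then show False using not by contradiction
qed

theorem theorem2p4:
  fixes p :: nat and k :: "nat list" and Det :: tensor_poly and A :: tensor
  assumes "p \<ge> 2" and "length k = p + 1"
    and "boundary_format k"
    and "k ! 0 > 0"
    and "is_hyperdeterminant k Det"
    and "A \<in> tensors k" and "A \<noteq> (\<lambda>_. 0)"
    and "poly_eval Det A \<noteq> 0"
  shows "triangulable k A \<longleftrightarrow> \<not> GIT_stable k A"
proof -
  obtain k0 ks where k: "k = k0 # ks" using assms(2) by (cases k) auto
  have "(\<Sum>j=1..<length k. k ! j) = sum_list ks"
    using sum.shift_bounds_Suc_ivl[of "\<lambda>j. k ! j" 0 "length ks"] by (simp add: k sum_list_sum_nth)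
  then have k0: "k0 = sum_list ks" "k0 > 0" using assms(3,4) by (simp_all add: k boundary_format_def)
  \<comment> \<open>The zero set of \<open>Det\<close> is the closure of the tangent hyperplanes, so
    a nonzero value of \<open>Det\<close> rules out tangency.\<close>
  have "tangent_hyperplanes k \<subseteq> dual_variety k"
    unfolding dual_variety_def by (rule zariski_closure_subset) (auto simp: tangent_hyperplanes_def)
  moreover have "A \<notin> dual_variety k" using assms(5,6,8) by (auto simp: is_hyperdeterminant_def)
  ultimately have "nondegenerate k0 ks A"
    using nondegenerate_of_not_tangent[OF k0(1)] assms(6) k by blast
  then have "GIT_stable k A" if "\<not> triangulable k A"
    using closed_orbit[OF k0 _ _ that[unfolded k]] finite_stabilizer[OF k0 _ _ that[unfolded k]] assms(6)
    unfolding GIT_stable_def k by blast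
  then show ?thesis using triangulable_not_stable[OF k0] k by blast
qed

end
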